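(* Let $\mathcal{B}=\{b_j: j\in I\}\subset L_2(\mu)$ be orthonormal, assume that $\varphi^*(x):=\sup_{j\in I}|b_j(x)|$ belongs to $L_2(\mu)$, and put $\varphi=\varphi^*/\|\varphi^*\|_{L_2(\mu)}$ and $\tilde B=\|\varphi^*\|_{L_2(\mu)}$. There exist universal constants $\alpha,\beta,\tau>0$ such that for all $n\in\mathbb{N}$, all $\gamma\in(0,1)$ and all finite $J\subset I$ with $n<|J|$ the following holds. If $$m\ \ge\ \alpha\tilde B^2n\Bigl(\log^2(\tilde B^2n)\,\log|J|+\log\bigl(\gamma^{-1}\log(\tilde B^2n)\bigr)\Bigr)$$ and $\mathbf{X}=\{x^1,\dots,x^m\}$ consists of $m$ points drawn independently and identically distributed according to the probability measure $\varphi^2\,\mathrm{d}\mu$, then with probability at least $1-\gamma$ we have $$\|f-\tilde H_{\mathbf{X}}(f)\|_{L_2(\mu)}\ \le\ (\beta+1)\Bigl(n^{-\frac12}\sigma_n(f;\mathcal{B})_{\mathcal{A}_1}+\|f-P_Jf\|_{L_\infty(\mu)}\Bigr)$$ for any $f\in\mathcal{A}_1$. Here $\tilde H_{\mathbf{X}}$ is either the modified rLasso decoder $\tilde R_{\mathbf{X}}^{\lambda}$ with $\lambda=3\tau n^{1/2}$, or the modified OMP decoder $\tilde P_{\mathbf{X}}^{24n}$.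
   Context: $\Omega$ is a topological space with a probability measure $\mu$. $\mathcal{B}=\{b_j\in C(\Omega): j\in I\}$ is countable, consists of continuous complex-valued functions, and is orthonormal in $L_2(\mu)$ (the $b_j$ need not be uniformly bounded). $\log$ is the natural logarithm. Put $\tilde b_j=b_j/\varphi$; then $\{\tilde b_j\}$ is orthonormal in $L_2(\varphi^2\mathrm{d}\mu)$ and $\sup_j\|\tilde b_j\|_{L_\infty}=\tilde B$ (points drawn from $\varphi^2\mathrm{d}\mu$ almost surely satisfy $0<\varphi(x)<\infty$). Coefficients: $[f]_j=\langle f,b_j\rangle_{L_2(\mu)}$, $[f]=([f]_j)_{j\in I}$. The Wiener space $\mathcal{A}_1=\mathcal{A}_1(\mathcal{B})$ consists of all $f=\sum_{j\in I}[f]_jb_j$ with $\|f\|_{\mathcal{A}_1}:=\|[f]\|_{\ell_1}<\infty$ (the series converges absolutely wherever $\varphi^*<\infty$, and $f(x)$ denotes its value). The best $n$-term approximation error is $$\sigma_n(f;\mathcal{B})_{\mathcal{A}_1}=\inf_{K\subset I,\,|K|\le n}\ \inf_{c_j\in\mathbb{C},\,j\in K}\Bigl\|f-\sum_{j\in K}c_jb_j\Bigr\|_{\mathcal{A}_1}.$$ For finite $J\subset I$ let $P_Jf=\sum_{j\in J}\langle f,b_j\rangle b_j$. Given $\mathbf{X}$ and $J$, put $\tilde{\mathbf{A}}=m^{-1/2}(\tilde b_j(x^l))_{1\le l\le m,\,j\in J}\in\mathbb{C}^{m\times|J|}$ and $\tilde{\mathbf{y}}=m^{-1/2}\bigl(f(x^l)/\varphi(x^l)\bigr)_{l=1}^m\in\mathbb{C}^m$.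 Modified rLasso decoder: for $\lambda>0$, $\tilde R_{\mathbf{X}}^\lambda(f)=\sum_{j\in J}\tilde r_j(\tilde{\mathbf{y}})b_j$, where $\tilde{\mathbf{r}}(\tilde{\mathbf{y}})$ is a minimizer (chosen by a fixed deterministic rule if not unique) of $\min_{\mathbf{z}\in\mathbb{C}^{|J|}}\|\mathbf{z}\|_{\ell_1}+\lambda\|\tilde{\mathbf{A}}\mathbf{z}-\tilde{\mathbf{y}}\|_{\ell_2}$. Modified OMP decoder: for $k_0\in\mathbb{N}$, $\tilde P_{\mathbf{X}}^{k_0}(f)=\sum_{j\in J}\tilde p_j^{k_0}(\tilde{\mathbf{y}})b_j$, where $S^0=\emptyset$, $\tilde{\mathbf{p}}^0=\mathbf{0}$, and recursively $S^{k+1}=S^k\cup\{j^*\}$ with $j^*$ an index maximizing $|(\tilde{\mathbf{A}}^*(\tilde{\mathbf{y}}-\tilde{\mathbf{A}}\tilde{\mathbf{p}}^k))_j|$ over $j$ (the smallest such index in a fixed enumeration of $J$ if not unique), and $\tilde{\mathbf{p}}^{k+1}=\mathrm{argmin}\{\|\tilde{\mathbf{y}}-\tilde{\mathbf{A}}\mathbf{p}\|_{\ell_2}:\mathrm{supp}(\mathbf{p})\subset S^{k+1}\}$. Note that the reconstructions use the original functions $b_j$.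
   Formalization: For n=1 the factor log(B̃²n) is replaced by max(1, log B̃²), since as written the bound on m is undefined or void for B̃ at or near 1 and the claim fails; the universal constants are stated for all spaces and index sets inside one arbitrary pair of ambient types. *)

theory Defs
  imports "HOL-Probability.Probability"
begin

section \<open>Norms, coefficients and the Wiener space\<close>

text \<open>
  Norms take values in \<open>ennreal\<close>, so that a divergent norm is \<open>\<infinity>\<close>
  rather than a default real value.
\<close>

definition L2_norm :: "'a measure \<Rightarrow> ('a \<Rightarrow> ennreal) \<Rightarrow> ennreal" where
  "L2_norm M g =
     (let s = (\<integral>\<^sup>+x. g x ^ 2 \<partial>M) in if s = \<infinity> then \<infinity> else ennreal (sqrt (enn2real s)))"

definition square_integrable :: "'a measure \<Rightarrow> ('a \<Rightarrow> complex) \<Rightarrow> bool" where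
  "square_integrable M f \<longleftrightarrow>
     f \<in> borel_measurable M \<and> L2_norm M (\<lambda>x. ennreal (cmod (f x))) < \<infinity>"

definition Linf_norm :: "'a measure \<Rightarrow> ('a \<Rightarrow> complex) \<Rightarrow> ennreal" where
  "Linf_norm M f = esssup M (\<lambda>x. ennreal (cmod (f x)))"

definition L2_inner :: "'a measure \<Rightarrow> ('a \<Rightarrow> complex) \<Rightarrow> ('a \<Rightarrow> complex) \<Rightarrow> complex" where
  "L2_inner M f g = (LINT x|M. f x * cnj (g x))"

definition orthonormal_system ::
    "'a measure \<Rightarrow> 'i set \<Rightarrow> ('i \<Rightarrow> 'a \<Rightarrow> complex) \<Rightarrow> bool" where
  "orthonormal_system M I b \<longleftrightarrow>
     (\<forall>j\<in>I. square_integrable M (b j)) \<and>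
     (\<forall>i\<in>I. \<forall>j\<in>I. L2_inner M (b i) (b j) = (if i = j then 1 else 0))"

definition phi_star :: "'i set \<Rightarrow> ('i \<Rightarrow> 'a \<Rightarrow> complex) \<Rightarrow> 'a \<Rightarrow> ennreal" where
  "phi_star I b x = (SUP j\<in>I. ennreal (cmod (b j x)))"

definition B_tilde :: "'a measure \<Rightarrow> 'i set \<Rightarrow> ('i \<Rightarrow> 'a \<Rightarrow> complex) \<Rightarrow> real" where
  "B_tilde M I b = enn2real (L2_norm M (phi_star I b))"

definition phi :: "'a measure \<Rightarrow> 'i set \<Rightarrow> ('i \<Rightarrow> 'a \<Rightarrow> complex) \<Rightarrow> 'a \<Rightarrow> ennreal" where
  "phi M I b x = phi_star I b x / L2_norm M (phi_star I b)"

definition coeff :: "'a measure \<Rightarrow> ('i \<Rightarrow> 'a \<Rightarrow> complex) \<Rightarrow> ('a \<Rightarrow> complex) \<Rightarrow> 'i \<Rightarrow> complex" where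
  "coeff M b f j = L2_inner M f (b j)"

definition wiener_norm ::
    "'a measure \<Rightarrow> 'i set \<Rightarrow> ('i \<Rightarrow> 'a \<Rightarrow> complex) \<Rightarrow> ('a \<Rightarrow> complex) \<Rightarrow> ennreal" where
  "wiener_norm M I b f = (\<Sum>\<^sub>\<infinity>j\<in>I. ennreal (cmod (coeff M b f j)))"

text \<open>
  Elements are genuine functions. Wherever \<open>phi_star\<close> is finite, \<open>f x\<close> is the
  value of the absolutely convergent series; on the remaining null set it is unconstrained
  up to measurability.
\<close>

definition wiener_space ::
    "'a measure \<Rightarrow> 'i set \<Rightarrow> ('i \<Rightarrow> 'a \<Rightarrow> complex) \<Rightarrow> ('a \<Rightarrow> complex) set" where
  "wiener_space M I b =
     {f. square_integrable M f \<and> wiener_norm M I b f < \<infinity> \<and>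
         (\<forall>x\<in>space M. phi_star I b x < \<infinity> \<longrightarrow>
            ((\<lambda>j. coeff M b f j * b j x) has_sum f x) I)}"

definition best_n_term ::
    "'a measure \<Rightarrow> 'i set \<Rightarrow> ('i \<Rightarrow> 'a \<Rightarrow> complex) \<Rightarrow> nat \<Rightarrow> ('a \<Rightarrow> complex) \<Rightarrow> ennreal" where
  "best_n_term M I b n f =
     (INF K\<in>{K. K \<subseteq> I \<and> finite K \<and> card K \<le> n}.
        INF c. wiener_norm M I b (\<lambda>x. f x - (\<Sum>j\<in>K. c j * b j x)))"

definition partial_expansion ::
    "'a measure \<Rightarrow> ('i \<Rightarrow> 'a \<Rightarrow> complex) \<Rightarrow> 'i set \<Rightarrow> ('a \<Rightarrow> complex) \<Rightarrow> 'a \<Rightarrow> complex" where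
  "partial_expansion M b J f x = (\<Sum>j\<in>J. coeff M b f j * b j x)"


section \<open>Random points, sampling matrix and samples\<close>

text \<open>
  A point set is a function \<open>X :: nat \<Rightarrow> 'a\<close> read on \<open>{..<m}\<close>. Matrices and
  vectors with rows indexed by \<open>{..<m}\<close> and columns indexed by \<open>J\<close> are
  functions of which only the entries with these indices are used.
\<close>

definition iid_points :: "'a measure \<Rightarrow> 'i set \<Rightarrow> ('i \<Rightarrow> 'a \<Rightarrow> complex) \<Rightarrow> nat \<Rightarrow> (nat \<Rightarrow> 'a) measure"
  where "iid_points M I b m = PiM {..<m} (\<lambda>_. density M (\<lambda>x. phi M I b x ^ 2))"

text \<open>
  The set of good outcomes need not be measurable a priori: it has to contain an event of
  probability at least \<open>p\<close>.
\<close>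

definition with_prob_ge :: "'w measure \<Rightarrow> real \<Rightarrow> ('w \<Rightarrow> bool) \<Rightarrow> bool" where
  "with_prob_ge P p Q \<longleftrightarrow> (\<exists>E\<in>sets P. measure P E \<ge> p \<and> (\<forall>w\<in>E. Q w))"

definition sampling_matrix ::
    "'a measure \<Rightarrow> 'i set \<Rightarrow> ('i \<Rightarrow> 'a \<Rightarrow> complex) \<Rightarrow> nat \<Rightarrow> (nat \<Rightarrow> 'a) \<Rightarrow> nat \<Rightarrow> 'i \<Rightarrow> complex" where
  "sampling_matrix M I b m X l j =
     of_real (1 / sqrt (real m)) * (b j (X l) / of_real (enn2real (phi M I b (X l))))"

definition samples ::
    "'a measure \<Rightarrow> 'i set \<Rightarrow> ('i \<Rightarrow> 'a \<Rightarrow> complex) \<Rightarrow> nat \<Rightarrow> (nat \<Rightarrow> 'a) \<Rightarrow> ('a \<Rightarrow> complex) \<Rightarrow> nat \<Rightarrow> complex"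
  where
  "samples M I b m X f l =
     of_real (1 / sqrt (real m)) * (f (X l) / of_real (enn2real (phi M I b (X l))))"

definition residual ::
    "'i set \<Rightarrow> (nat \<Rightarrow> 'i \<Rightarrow> complex) \<Rightarrow> (nat \<Rightarrow> complex) \<Rightarrow> ('i \<Rightarrow> complex) \<Rightarrow> nat \<Rightarrow> complex" where
  "residual J A y z l = y l - (\<Sum>j\<in>J. A l j * z j)"

definition residual_norm ::
    "'i set \<Rightarrow> nat \<Rightarrow> (nat \<Rightarrow> 'i \<Rightarrow> complex) \<Rightarrow> (nat \<Rightarrow> complex) \<Rightarrow> ('i \<Rightarrow> complex) \<Rightarrow> real" where
  "residual_norm J m A y z = L2_set (\<lambda>l. cmod (residual J A y z l)) {..<m}"


section \<open>The modified rLasso decoder\<close>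

text \<open>A deterministic rule choosing a minimizer for every matrix and data vector; \<open>\<kappa>\<close> is the penalty parameter of the residual.\<close>

definition rlasso_rule ::
    "'i set \<Rightarrow> nat \<Rightarrow> real \<Rightarrow> ((nat \<Rightarrow> 'i \<Rightarrow> complex) \<Rightarrow> (nat \<Rightarrow> complex) \<Rightarrow> 'i \<Rightarrow> complex) \<Rightarrow> bool" where
  "rlasso_rule J m \<kappa> r \<longleftrightarrow>
     (\<forall>A y. is_arg_min (\<lambda>z. (\<Sum>j\<in>J. cmod (z j)) + \<kappa> * residual_norm J m A y z)
              (\<lambda>_. True) (r A y))"

definition rlasso_decoder ::
    "((nat \<Rightarrow> 'i \<Rightarrow> complex) \<Rightarrow> (nat \<Rightarrow> complex) \<Rightarrow> 'i \<Rightarrow> complex) \<Rightarrow>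
     'a measure \<Rightarrow> 'i set \<Rightarrow> ('i \<Rightarrow> 'a \<Rightarrow> complex) \<Rightarrow> 'i set \<Rightarrow> nat \<Rightarrow> (nat \<Rightarrow> 'a) \<Rightarrow>
     ('a \<Rightarrow> complex) \<Rightarrow> 'a \<Rightarrow> complex" where
  "rlasso_decoder r M I b J m X f x =
     (\<Sum>j\<in>J. r (sampling_matrix M I b m X) (samples M I b m X f) j * b j x)"


section \<open>The modified OMP decoder\<close>

text \<open>
  \<open>ls A y S\<close> is a least squares solution supported in \<open>S\<close>; it is a choice only when
  the columns indexed by \<open>S\<close> are linearly dependent.
\<close>

definition least_squares_rule ::
    "'i set \<Rightarrow> nat \<Rightarrow>
     ((nat \<Rightarrow> 'i \<Rightarrow> complex) \<Rightarrow> (nat \<Rightarrow> complex) \<Rightarrow> 'i set \<Rightarrow> 'i \<Rightarrow> complex) \<Rightarrow> bool" where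
  "least_squares_rule J m ls \<longleftrightarrow>
     (\<forall>A y S. S \<subseteq> J \<longrightarrow>
        is_arg_min (residual_norm J m A y) (\<lambda>p. {j. p j \<noteq> 0} \<subseteq> S) (ls A y S))"

definition correlation ::
    "'i set \<Rightarrow> nat \<Rightarrow> (nat \<Rightarrow> 'i \<Rightarrow> complex) \<Rightarrow> (nat \<Rightarrow> complex) \<Rightarrow> ('i \<Rightarrow> complex) \<Rightarrow> 'i \<Rightarrow> real" where
  "correlation J m A y p j = cmod (\<Sum>l<m. cnj (A l j) * residual J A y p l)"

text \<open>\<open>enum\<close> is the position in the fixed enumeration of \<open>J\<close>; it breaks ties.\<close>

definition omp_index ::
    "('i \<Rightarrow> nat) \<Rightarrow> 'i set \<Rightarrow> nat \<Rightarrow> (nat \<Rightarrow> 'i \<Rightarrow> complex) \<Rightarrow> (nat \<Rightarrow> complex) \<Rightarrow> ('i \<Rightarrow> complex) \<Rightarrow> 'i" where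
  "omp_index enum J m A y p =
     arg_min enum (is_arg_max (correlation J m A y p) (\<lambda>j. j \<in> J))"

primrec omp ::
    "('i \<Rightarrow> nat) \<Rightarrow> ((nat \<Rightarrow> 'i \<Rightarrow> complex) \<Rightarrow> (nat \<Rightarrow> complex) \<Rightarrow> 'i set \<Rightarrow> 'i \<Rightarrow> complex) \<Rightarrow>
     'i set \<Rightarrow> nat \<Rightarrow> (nat \<Rightarrow> 'i \<Rightarrow> complex) \<Rightarrow> (nat \<Rightarrow> complex) \<Rightarrow> nat \<Rightarrow> 'i set \<times> ('i \<Rightarrow> complex)" where
  "omp enum ls J m A y 0 = ({}, \<lambda>_. 0)"
| "omp enum ls J m A y (Suc k) =
     (let (S, p) = omp enum ls J m A y k;
          S' = insert (omp_index enum J m A y p) S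
      in (S', ls A y S'))"

definition omp_decoder ::
    "('i \<Rightarrow> nat) \<Rightarrow> ((nat \<Rightarrow> 'i \<Rightarrow> complex) \<Rightarrow> (nat \<Rightarrow> complex) \<Rightarrow> 'i set \<Rightarrow> 'i \<Rightarrow> complex) \<Rightarrow> nat \<Rightarrow>
     'a measure \<Rightarrow> 'i set \<Rightarrow> ('i \<Rightarrow> 'a \<Rightarrow> complex) \<Rightarrow> 'i set \<Rightarrow> nat \<Rightarrow> (nat \<Rightarrow> 'a) \<Rightarrow>
     ('a \<Rightarrow> complex) \<Rightarrow> 'a \<Rightarrow> complex" where
  "omp_decoder enum ls k0 M I b J m X f x =
     (\<Sum>j\<in>J. snd (omp enum ls J m (sampling_matrix M I b m X) (samples M I b m X f) k0) j * b j x)"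


section \<open>The sampling condition and the error bound\<close>

text \<open>
  The factor \<open>log (B\<^sup>2 n)\<close>, except that it is read as at least \<open>1\<close> when
  \<open>n = 1\<close>. Without this, for \<open>n = 1\<close> and \<open>B\<close> close to \<open>1\<close> the term
  \<open>log (\<gamma>\<^sup>-\<^sup>1 log (B\<^sup>2 n))\<close> is very negative or undefined, the lower bound on
  \<open>m\<close> is void, and the recovery guarantee fails already for \<open>m = 0\<close>.
\<close>

definition log_factor :: "real \<Rightarrow> nat \<Rightarrow> real" where
  "log_factor B n = (if n = 1 then max 1 (ln (B\<^sup>2)) else ln (B\<^sup>2 * real n))"

definition recovery_bound ::
    "real \<Rightarrow> 'a measure \<Rightarrow> 'i set \<Rightarrow> ('i \<Rightarrow> 'a \<Rightarrow> complex) \<Rightarrow> nat \<Rightarrow> 'i set \<Rightarrow>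
     (('a \<Rightarrow> complex) \<Rightarrow> 'a \<Rightarrow> complex) \<Rightarrow> ('a \<Rightarrow> complex) \<Rightarrow> bool" where
  "recovery_bound \<beta> M I b n J H f \<longleftrightarrow>
     L2_norm M (\<lambda>x. ennreal (cmod (f x - H f x)))
       \<le> ennreal (\<beta> + 1) *
           (ennreal (real n powr (- 1 / 2)) * best_n_term M I b n f +
            Linf_norm M (\<lambda>x. f x - partial_expansion M b J f x))"

end

theory Submission
  imports Defs
begin

text \<open>
  Both decoders are stable for matrices \<open>A\<close> such that \<open>\<parallel>A v\<parallel>\<^sup>2\<close> agrees with \<open>\<parallel>v\<parallel>\<^sup>2\<close> for all
  \<open>v\<close>, up to \<open>(\<parallel>v\<parallel>\<^sup>2 + \<parallel>v\<parallel>\<^sub>1\<^sup>2 / s) / 100\<close> with \<open>s = 26 n\<close>. This form of the restricted isometry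
  property yields the null space property directly, without block decompositions.

  For a system bounded by \<open>K\<close> and \<open>\<parallel>v\<parallel>\<^sub>1 \<le> 1\<close>, split \<open>\<bar>g\<bar>\<^sup>2\<close>, where \<open>g = \<Sum> v\<^sub>j \<psi>\<^sub>j\<close>, dyadically
  into \<open>O(log (K\<^sup>2 s))\<close> levels of height \<open>h = K\<^sup>2 2\<^sup>-\<^sup>i\<close>. At level \<open>i\<close> replace \<open>g\<close> by an average of
  \<open>r \<approx> (K\<^sup>2 / h) log (K\<^sup>2 s)\<close> atoms \<open>2 u \<psi>\<^sub>j\<close>, \<open>u \<in> {0, \<plusminus>1, \<plusminus>\<i>}\<close> (Maurey's argument with Hoeffding's
  inequality); the approximation is accurate to within \<open>\<surd>h\<close> outside a set that is small both for the
  sampling measure and for the empirical measure. There are only \<open>(5 N)\<^sup>r\<close> such averages, so a Chernoff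
  bound for a function bounded by \<open>h\<close> and a union bound apply. The additive deviation
  \<open>(1 / L + 2\<^sup>-\<^sup>i) / s\<close> allowed at level \<open>i\<close> of \<open>L\<close> is summable; its first summand pays for the number of
  averages, its second one for the confidence \<open>\<gamma>\<close>.
\<close>

section \<open>Stable matrices and the rLasso decoder\<close>

text \<open>The union bound dictates the sample size. At level \<open>i\<close> there are
  \<open>exp (r i * ln (5 * N))\<close> averages with \<open>r i\<close> of order
  \<open>2 ^ i * \<Lambda>\<close>, while dividing the allowed deviation by the height of the level
  turns \<open>1 / L\<close> into \<open>2 ^ i / L\<close>. The powers of two cancel, so
  \<open>m / (s * K\<^sup>2)\<close> has to exceed a multiple of
  \<open>L * \<Lambda> * ln N\<close>: one logarithm is the number of levels, the other the accuracy
  of the averages. The other summand gives the same exponent at every level and only has to beat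
  \<open>L / \<gamma>\<close>. A second obstacle is the noise: the decoders see the samples of
  \<open>f - partial_expansion M b J f\<close> divided by the weight, and the supremum norm
  \<open>G\<close> of the remainder does not bound this quotient. The \<open>l1\<close> norm of the
  coefficients outside \<open>J\<close> does, but it has to be of order \<open>sqrt n * G\<close>
  plus the approximation error \<open>w\<close>. This holds because all but \<open>n\<close> of
  these coefficients are counted in \<open>w\<close>, and Bessel's inequality controls the others.
  Uniformity in \<open>f\<close> comes from using only events that do not mention \<open>f\<close>:
  stability of the matrix, the sample mean of one fixed variable, and one null set.\<close>

definition vec_norm :: "'k set \<Rightarrow> ('k \<Rightarrow> complex) \<Rightarrow> real" where
  "vec_norm X u = L2_set (\<lambda>k. cmod (u k)) X"

definition vec_norm1 :: "'k set \<Rightarrow> ('k \<Rightarrow> complex) \<Rightarrow> real" where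
  "vec_norm1 X u = (\<Sum>k\<in>X. cmod (u k))"

definition mat_vec :: "'i set \<Rightarrow> (nat \<Rightarrow> 'i \<Rightarrow> complex) \<Rightarrow> ('i \<Rightarrow> complex) \<Rightarrow> nat \<Rightarrow> complex" where
  "mat_vec J A v l = (\<Sum>j\<in>J. A l j * v j)"

text \<open>For \<open>s\<close>-sparse \<open>v\<close> Cauchy-Schwarz bounds the \<open>l1\<close>
  term by the Euclidean one, which gives the isometry bounds 98/100 and 102/100 used for OMP. As all
  \<open>v\<close> are allowed, error vectors of the decoders, which need not be sparse, can be
  inserted as well.\<close>

definition stable_matrix :: "'i set \<Rightarrow> nat \<Rightarrow> (nat \<Rightarrow> 'i \<Rightarrow> complex) \<Rightarrow> real \<Rightarrow> bool" where
  "stable_matrix J m A s \<longleftrightarrow>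
     (\<forall>v. \<bar>(vec_norm {..<m} (mat_vec J A v))\<^sup>2 - (vec_norm J v)\<^sup>2\<bar>
            \<le> 1/100 * ((vec_norm J v)\<^sup>2 + (vec_norm1 J v)\<^sup>2 / s))"

lemma vec_norm_nonneg [simp]: "0 \<le> vec_norm X u"
  by (simp add: vec_norm_def L2_set_nonneg)

lemma vec_norm1_nonneg [simp]: "0 \<le> vec_norm1 X u"
  by (simp add: vec_norm1_def sum_nonneg)

lemma vec_norm_power2: "(vec_norm X u)\<^sup>2 = (\<Sum>k\<in>X. (cmod (u k))\<^sup>2)"
  by (simp add: vec_norm_def L2_set_def sum_nonneg)

lemma vec_norm_cong: "(\<And>k. k \<in> X \<Longrightarrow> u k = w k) \<Longrightarrow> vec_norm X u = vec_norm X w"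
  by (simp add: vec_norm_def cong: L2_set_cong)

lemma vec_norm_uminus: "vec_norm X (\<lambda>k. - u k) = vec_norm X u"
  by (simp add: vec_norm_def)

lemma vec_norm_add_le: "vec_norm X (\<lambda>k. u k + w k) \<le> vec_norm X u + vec_norm X w"
proof -
  have "vec_norm X (\<lambda>k. u k + w k) \<le> L2_set (\<lambda>k. cmod (u k) + cmod (w k)) X"
    unfolding vec_norm_def by (rule L2_set_mono) (auto intro: norm_triangle_ineq)
  also have "\<dots> \<le> vec_norm X u + vec_norm X w"
    unfolding vec_norm_def by (rule L2_set_triangle_ineq)
  finally show ?thesis .
qed

lemma vec_norm_diff_le: "vec_norm X (\<lambda>k. u k - w k) \<le> vec_norm X u + vec_norm X w"
  using vec_norm_add_le[of X u "\<lambda>k. - w k"] by (simp add: vec_norm_uminus)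

lemma vec_norm_mono: "finite Y \<Longrightarrow> X \<subseteq> Y \<Longrightarrow> vec_norm X u \<le> vec_norm Y u"
  unfolding vec_norm_def L2_set_def by (auto intro!: sum_mono2)

lemma vec_norm_supp:
  "finite Y \<Longrightarrow> X \<subseteq> Y \<Longrightarrow> (\<And>k. k \<in> Y - X \<Longrightarrow> u k = 0) \<Longrightarrow> vec_norm Y u = vec_norm X u"
  unfolding vec_norm_def L2_set_def
  by (rule arg_cong[where f = sqrt], rule sum.mono_neutral_right) auto

lemma vec_norm1_supp:
  "finite Y \<Longrightarrow> X \<subseteq> Y \<Longrightarrow> (\<And>k. k \<in> Y - X \<Longrightarrow> u k = 0) \<Longrightarrow> vec_norm1 Y u = vec_norm1 X u"
  unfolding vec_norm1_def by (rule sum.mono_neutral_right) auto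

lemma vec_norm1_split:
  "finite Y \<Longrightarrow> X \<subseteq> Y \<Longrightarrow> vec_norm1 Y u = vec_norm1 X u + vec_norm1 (Y - X) u"
  unfolding vec_norm1_def by (metis add.commute sum.subset_diff)

lemma vec_norm1_power2_le:
  assumes "finite X" shows "(vec_norm1 X u)\<^sup>2 \<le> real (card X) * (vec_norm X u)\<^sup>2"
  using sum_squared_le_sum_of_squares[of "\<lambda>k. cmod (u k)" X] assms
  by (simp add: vec_norm1_def vec_norm_power2 mult.commute)

lemma vec_norm1_le:
  assumes "finite X" "card X \<le> n" shows "vec_norm1 X u \<le> sqrt n * vec_norm X u"
proof (rule power2_le_imp_le)
  have "(vec_norm1 X u)\<^sup>2 \<le> real (card X) * (vec_norm X u)\<^sup>2"
    by (rule vec_norm1_power2_le[OF assms(1)])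
  also have "\<dots> \<le> real n * (vec_norm X u)\<^sup>2" using assms(2) by (intro mult_right_mono) auto
  finally show "(vec_norm1 X u)\<^sup>2 \<le> (sqrt n * vec_norm X u)\<^sup>2" by (simp add: power_mult_distrib)
qed simp

lemma mat_vec_add: "mat_vec J A (\<lambda>j. u j + w j) l = mat_vec J A u l + mat_vec J A w l"
  by (simp add: mat_vec_def algebra_simps sum.distrib)

lemma mat_vec_diff: "mat_vec J A (\<lambda>j. u j - w j) l = mat_vec J A u l - mat_vec J A w l"
  by (simp add: mat_vec_def algebra_simps sum_subtractf)

lemma residual_eq_mat_vec: "residual J A y z l = y l - mat_vec J A z l"
  by (simp add: residual_def mat_vec_def)

lemma residual_norm_eq: "residual_norm J m A y z = vec_norm {..<m} (\<lambda>l. y l - mat_vec J A z l)"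
  by (simp add: residual_norm_def residual_eq_mat_vec vec_norm_def)

text \<open>If the \<open>l1\<close> term is the smaller one, the deviation is at most 1/50 of the
  squared norm, so \<open>A\<close> cannot shrink \<open>v\<close> by more than a factor of two.
  Otherwise the \<open>l1\<close> norm dominates.\<close>

lemma stable_matrix_cases:
  assumes "stable_matrix J m A s" "0 < s"
  shows "vec_norm J v \<le> 2 * vec_norm {..<m} (mat_vec J A v) \<or> s * (vec_norm J v)\<^sup>2 \<le> (vec_norm1 J v)\<^sup>2"
proof (cases "s * (vec_norm J v)\<^sup>2 \<le> (vec_norm1 J v)\<^sup>2")
  case False
  then have "(vec_norm1 J v)\<^sup>2 / s \<le> (vec_norm J v)\<^sup>2" using assms(2) by (simp add: field_simps)
  moreover have "\<bar>(vec_norm {..<m} (mat_vec J A v))\<^sup>2 - (vec_norm J v)\<^sup>2\<bar>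
            \<le> 1/100 * ((vec_norm J v)\<^sup>2 + (vec_norm1 J v)\<^sup>2 / s)"
    using assms(1) unfolding stable_matrix_def by blast
  ultimately have "(vec_norm J v)\<^sup>2 \<le> 4 * (vec_norm {..<m} (mat_vec J A v))\<^sup>2" 
    using zero_le_power2[of "vec_norm J v"] unfolding abs_le_iff distrib_left by linarith
  then have "(vec_norm J v)\<^sup>2 \<le> (2 * vec_norm {..<m} (mat_vec J A v))\<^sup>2" by (simp add: power_mult_distrib)
  then show ?thesis by (meson power2_le_imp_le vec_norm_nonneg mult_nonneg_nonneg zero_le_numeral)
qed simp

text \<open>Comparing the minimizer \<open>r\<close> with \<open>c\<close> bounds the error off
  \<open>T\<close> by the error on \<open>T\<close> plus tail and noise. The error on
  \<open>T\<close> is at most \<open>sqrt n\<close> times the Euclidean error, which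
  \<open>stable_matrix_cases\<close> bounds by \<open>A v\<close> or by the \<open>l1\<close> norm,
  so it can be absorbed. The penalty weight 6 leaves room for this: absorbing uses up only 2 of
  it.\<close>

lemma rlasso_error:
  assumes J: "finite J" and T: "T \<subseteq> J" "card T \<le> n" and n: "1 \<le> n"
    and st: "stable_matrix J m A (26 * real n)"
    and opt: "vec_norm1 J r + 6 * sqrt n * residual_norm J m A y r
                \<le> vec_norm1 J c + 6 * sqrt n * residual_norm J m A y c"
    and eta: "residual_norm J m A y c \<le> \<eta>"
    and w: "vec_norm1 (J - T) c \<le> w"
  shows "vec_norm J (\<lambda>j. c j - r j) \<le> 20 * (w / sqrt n + \<eta>)"
proof -
  define v where "v = (\<lambda>j. c j - r j)"
  define P Q M V where "P = vec_norm1 T v" and "Q = vec_norm1 (J - T) v"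
    and "M = vec_norm {..<m} (mat_vec J A v)" and "V = vec_norm J v"
  define q where "q = sqrt (real n)"
  have q: "q \<ge> 1" "q\<^sup>2 = real n" using n by (auto simp: q_def)
  have nn: "P \<ge> 0" "Q \<ge> 0" "M \<ge> 0" "V \<ge> 0" by (simp_all add: P_def Q_def M_def V_def)
  have PQ: "vec_norm1 J v = P + Q" unfolding P_def Q_def by (rule vec_norm1_split[OF J T(1)])
  have PV: "P \<le> q * V"
  proof -
    have "P \<le> q * vec_norm T v" unfolding P_def q_def
      by (rule vec_norm1_le) (use T J finite_subset in auto)
    also have "\<dots> \<le> q * V" unfolding V_def using q vec_norm_mono[OF J T(1)] by (intro mult_left_mono) auto
    finally show ?thesis .
  qed
  have cT: "vec_norm1 T c \<le> vec_norm1 T r + P"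
    unfolding vec_norm1_def P_def v_def sum.distrib[symmetric]
    by (intro sum_mono) (metis norm_triangle_sub)
  have cTc: "Q \<le> vec_norm1 (J - T) r + vec_norm1 (J - T) c"
    unfolding vec_norm1_def Q_def v_def sum.distrib[symmetric]
    by (intro sum_mono) (metis add.commute norm_triangle_ineq4)
  have ME: "M \<le> residual_norm J m A y r + residual_norm J m A y c"
  proof -
    have "M = vec_norm {..<m} (\<lambda>l. (y l - mat_vec J A r l) - (y l - mat_vec J A c l))"
      unfolding M_def v_def by (rule vec_norm_cong) (simp add: mat_vec_diff)
    then show ?thesis using vec_norm_diff_le unfolding residual_norm_eq by metis
  qed
  have main: "Q + 6 * (q * M) \<le> P + 2 * w + 12 * (q * \<eta>)"
  proof -
    have "6 * q * M \<le> 6 * q * (residual_norm J m A y r + residual_norm J m A y c)"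
      using ME q by (intro mult_left_mono) auto
    moreover have "6 * q * residual_norm J m A y c \<le> 6 * q * \<eta>" 
      using eta q by (intro mult_left_mono) auto
    ultimately show ?thesis
      using opt cT cTc w vec_norm1_split[OF J T(1), of c] vec_norm1_split[OF J T(1), of r]
      unfolding q_def[symmetric] by (simp add: algebra_simps)
  qed
  \<comment> \<open>Here the sparsity level \<open>26 * n\<close> enters: 26 exceeds 5 squared.
    Together with \<open>P \<le> q * V\<close> the second alternative then gives
    \<open>4 * P \<le> Q\<close>.\<close>
  have dich: "V \<le> 2 * M \<or> 5 * (q * V) \<le> P + Q"
  proof -
    have "26 * real n * V\<^sup>2 \<le> (P + Q)\<^sup>2 \<Longrightarrow> 5 * (q * V) \<le> P + Q"
    proof -
      assume a: "26 * real n * V\<^sup>2 \<le> (P + Q)\<^sup>2"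
      have "(5 * (q * V))\<^sup>2 \<le> 26 * real n * V\<^sup>2" using q(2) by (simp add: power_mult_distrib mult_right_mono)
      then have "(5 * (q * V))\<^sup>2 \<le> (P + Q)\<^sup>2" using a by linarith
      then show ?thesis using nn by (meson add_nonneg_nonneg power2_le_imp_le)
    qed
    then show ?thesis
      using stable_matrix_cases[OF st, of v] n unfolding PQ V_def[symmetric] M_def[symmetric] by auto
  qed
  have qV: "5 * (q * V) \<le> 10 * (q * M) + P + Q"
    using dich
  proof
    assume "V \<le> 2 * M"
    then have "q * V \<le> q * (2 * M)" using q by (intro mult_left_mono) auto
    then have "q * V \<le> 2 * (q * M)" by (simp only: mult.left_commute)
    then show ?thesis using nn by linarith
  next
    assume "5 * (q * V) \<le> P + Q"
    moreover have "0 \<le> q * M" using q nn by simp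
    ultimately show ?thesis using nn by linarith
  qed
  \<comment> \<open>Inserted into \<open>main\<close>, this leaves
    \<open>Q / 2 + 4 * (q * M)\<close> on the left; three times that quantity dominates the
    right-hand side of \<open>qV\<close>.\<close>
  have P2: "2 * P \<le> Q + 4 * (q * M)"
    using dich
  proof
    assume "V \<le> 2 * M"
    then have "q * V \<le> q * (2 * M)" using q by (intro mult_left_mono) auto
    then have "q * V \<le> 2 * (q * M)" by (simp only: mult.left_commute)
    then show ?thesis using nn PV by linarith
  next
    assume "5 * (q * V) \<le> P + Q"
    moreover have "0 \<le> q * M" using q nn by simp
    ultimately show ?thesis using nn PV by linarith
  qed
  have "q * V \<le> 20 * (w + q * \<eta>)"
  proof -
    have "0 \<le> w" using w vec_norm1_nonneg[of "J - T" c] by linarith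
    moreover have "0 \<le> q * \<eta>" using eta q vec_norm_nonneg unfolding residual_norm_eq
      by (smt (verit) mult_nonneg_nonneg)
    moreover have "0 \<le> q * M" using q nn by simp
    ultimately show ?thesis using main qV P2 nn unfolding distrib_left by linarith
  qed
  then have "V \<le> 20 * (w / q + \<eta>)" using q by (simp add: field_simps)
  then show ?thesis by (simp add: V_def v_def q_def)
qed

section \<open>Orthogonal matching pursuit\<close>

lemma exp_minus_le_tenth: "exp (- (147/51)) \<le> (1/10 :: real)"
proof -
  have "10 \<le> (1 + (147/51) / real 10) ^ 10" by (simp add: power_divide)
  also have "\<dots> \<le> exp (147/51)" by (rule exp_ge_one_plus_x_over_n_power_n) auto
  finally show ?thesis by (simp add: exp_minus field_simps)
qed

text \<open>49/51 is the quotient of the isometry bounds 98/100 and 102/100. Over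
  \<open>3 * q\<close> steps the excess over \<open>V\<close> shrinks by
  \<open>exp (- (147/51))\<close>, which is below one tenth.\<close>

lemma geometric_decay:
  fixes R :: "nat \<Rightarrow> real" and q :: nat
  assumes q: "1 \<le> q" and R0: "0 \<le> R k" and V: "0 \<le> V"
    and step: "\<And>i. i < 3 * q \<Longrightarrow> R (Suc (k + i)) - V \<le> (1 - 49/51 / q) * (R (k + i) - V)"
  shows "R (k + 3 * q) \<le> V + R k / 10"
proof -
  define \<theta> where "\<theta> = 1 - 49/51 / real q"
  have "real q \<ge> 1" using q by simp
  then have "49/51 / real q \<le> 49/51" by (simp add: field_simps)
  then have th: "0 \<le> \<theta>" unfolding \<theta>_def by simp
  have "i \<le> 3 * q \<Longrightarrow> R (k + i) - V \<le> \<theta> ^ i * (R k - V)" for i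
  proof (induction i)
    case (Suc i)
    have "R (k + Suc i) - V \<le> \<theta> * (R (k + i) - V)" using step[of i] Suc.prems by (simp add: \<theta>_def)
    also have "\<dots> \<le> \<theta> * (\<theta> ^ i * (R k - V))" using Suc th by (intro mult_left_mono) auto
    finally show ?case by (simp add: mult_ac)
  qed simp
  then have *: "R (k + 3 * q) - V \<le> \<theta> ^ (3 * q) * (R k - V)" by simp
  have "\<theta> \<le> exp (- (49/51 / real q))" using exp_ge_add_one_self[of "- (49/51 / real q)"] by (simp add: \<theta>_def)
  then have "\<theta> ^ (3 * q) \<le> exp (- (49/51 / real q)) ^ (3 * q)" using th by (rule power_mono)
  also have "\<dots> = exp (- (147/51))" using q by (simp add: exp_of_nat_mult[symmetric])
  finally have "\<theta> ^ (3 * q) \<le> 1/10" using exp_minus_le_tenth by linarith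
  then have "\<theta> ^ (3 * q) * (R k - V) \<le> R k / 10"
  proof (cases "R k \<le> V")
    case True
    then have "\<theta> ^ (3 * q) * (R k - V) \<le> 0" using th by (simp add: mult_nonneg_nonpos)
    then show ?thesis using R0 by linarith
  next
    case False
    then have "\<theta> ^ (3 * q) * (R k - V) \<le> 1/10 * (R k - V)"
      using \<open>\<theta> ^ (3 * q) \<le> 1/10\<close> by (intro mult_right_mono) auto
    also have "1/10 * (R k - V) \<le> R k / 10" using V by simp
    finally show ?thesis .
  qed
  then show ?thesis using * by linarith
qed

section \<open>Greedy selection, abstractly: index sets, residuals and best tails\<close>

definition best_tail :: "('i \<Rightarrow> real) \<Rightarrow> 'i set \<Rightarrow> nat \<Rightarrow> real" where
  "best_tail x D q = (MIN Q\<in>{Q. Q \<subseteq> D \<and> card Q \<le> q}. \<Sum>j\<in>D - Q. x j)"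

lemma best_tail_attained:
  assumes "finite D"
  obtains Q where "Q \<subseteq> D" "card Q \<le> q" "best_tail x D q = (\<Sum>j\<in>D - Q. x j)"
proof -
  let ?F = "{Q. Q \<subseteq> D \<and> card Q \<le> q}"
  have "finite ?F" "{} \<in> ?F" using assms by auto
  then have "best_tail x D q \<in> (\<lambda>Q. \<Sum>j\<in>D - Q. x j) ` ?F"
    unfolding best_tail_def by (intro Min_in) auto
  then show ?thesis using that by auto
qed

lemma best_tail_le:
  assumes "finite D" "Q \<subseteq> D" "card Q \<le> q"
  shows "best_tail x D q \<le> (\<Sum>j\<in>D - Q. x j)"
  unfolding best_tail_def using assms by (intro Min_le) auto

lemma best_tail_nonneg:
  assumes "finite D" "\<And>j. 0 \<le> x j" shows "0 \<le> best_tail x D q"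
  using best_tail_attained[OF assms(1), of q x] assms(2) by (metis sum_nonneg)

text \<open>
  Here \<open>S k\<close> is the index set selected after \<open>k\<close> greedy steps, \<open>R k\<close> the squared residual,
  \<open>x\<close> the squared moduli of the coefficients to be found and \<open>h\<close> the squared noise level.
  Let \<open>\<tau>\<^sub>l\<close> be the squared best approximation error of the unselected coefficients by
  \<open>2\<^sup>l - 1\<close> terms, and let \<open>l\<close> be minimal with \<open>\<tau>\<^sub>l \<ge> 2 \<tau>\<^sub>l\<^sub>+\<^sub>1\<close>. Running \<open>3 \<cdot> 2\<^sup>i\<close>
  steps for \<open>i = 1, \<dots>, l + 1\<close> pushes the residual below \<open>\<tau>\<^sub>l\<close> up to noise, which forces
  \<open>2\<^sup>l\<close> new correct selections at the price of at most \<open>12 \<cdot> 2\<^sup>l\<close> steps.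
\<close>

lemma greedy_residual_bound:
  fixes S :: "nat \<Rightarrow> 'i set" and R :: "nat \<Rightarrow> real" and x :: "'i \<Rightarrow> real" and h :: real
  assumes E: "finite E" and h: "0 \<le> h" and x: "\<And>j. 0 \<le> x j" and Rnn: "\<And>k. 0 \<le> R k"
    and Smono: "\<And>k. S k \<subseteq> S (Suc k)"
    and Rmono: "\<And>k. R (Suc k) \<le> R k"
    and upper: "\<And>k U. k \<le> kmax \<Longrightarrow> U \<subseteq> E \<Longrightarrow> U \<subseteq> S k \<Longrightarrow> R k \<le> 1122/1000 * (\<Sum>j\<in>E - U. x j) + 11 * h"
    and step: "\<And>k U q. k < kmax \<Longrightarrow> U \<subseteq> E \<Longrightarrow> 1 \<le> q \<Longrightarrow> card (U - S k) \<le> q \<Longrightarrow>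
      R (Suc k) - (1122/1000 * (\<Sum>j\<in>E - U. x j) + 11 * h)
        \<le> (1 - 49/51 / real q) * (R k - (1122/1000 * (\<Sum>j\<in>E - U. x j) + 11 * h))"
    and lower: "\<And>k. k \<le> kmax \<Longrightarrow> 98/100 * (\<Sum>j\<in>E - S k. x j) \<le> 11/10 * R k + 11 * h"
  shows "k + 12 * card (E - S k) \<le> kmax \<Longrightarrow> R (k + 12 * card (E - S k)) \<le> 100 * h"
proof (induction "card (E - S k)" arbitrary: k rule: less_induct)
  case less
  define D where "D = E - S k"
  define t where "t = card D"
  define \<tau> where "\<tau> = (\<lambda>l::nat. best_tail x D (2 ^ l - 1))"
  have D: "finite D" using E by (simp add: D_def)
  have Sm: "S i \<subseteq> S j" if "i \<le> j" for i j using that Smono by (rule lift_Suc_mono_le[of S, rotated])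
  have Rm: "R j \<le> R i" if "i \<le> j" for i j using that Rmono by (rule lift_Suc_antimono_le[of R, rotated])
  have kt: "k + 12 * t \<le> kmax" using less.prems by (simp add: t_def D_def)
  show ?case
  proof (cases "t = 0")
    case True
    then have "E \<subseteq> S k" using D by (auto simp: t_def D_def)
    then have "R k \<le> 11 * h" using upper[of k E] kt by simp
    then show ?thesis using True h by (simp add: t_def D_def)
  next
    case False
    have tnn: "0 \<le> \<tau> l" for l unfolding \<tau>_def by (rule best_tail_nonneg[OF D x])
    define P where "P = (\<lambda>l. 2 * \<tau> (Suc l) \<le> \<tau> l)"
    have tz: "\<tau> l = 0" if "t \<le> 2 ^ l - 1" for l
    proof -
      have "\<tau> l \<le> (\<Sum>j\<in>D - D. x j)" unfolding \<tau>_def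
        by (rule best_tail_le) (use D that in \<open>auto simp: t_def\<close>)
      then show ?thesis using tnn[of l] by simp
    qed
    \<comment> \<open>The tail at \<open>Suc t\<close> vanishes, so \<open>P t\<close> holds and the
      least index with \<open>P\<close> exists.\<close>
    have "t \<le> 2 ^ Suc t - 1"
      using less_exp[of "Suc t"] by linarith
    then have "P t" using tz tnn by (simp add: P_def)
    define l0 where "l0 = (LEAST l. P l)"
    have Pl0: "P l0" unfolding l0_def by (rule LeastI) (rule \<open>P t\<close>)
    have nP: "\<tau> l < 2 * \<tau> (Suc l)" if "l < l0" for l
      using not_less_Least[of l P] that by (simp add: l0_def P_def)
    have l0t: "2 ^ l0 \<le> t"
    proof (cases l0)
      case 0 then show ?thesis using False by simp
    next
      case (Suc l)
      then have "0 < \<tau> l0" using nP[of l] tnn[of l] by simp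
      then have "\<not> t \<le> 2 ^ l0 - 1" using tz[of l0] by auto
      then show ?thesis by linarith
    qed
    \<comment> \<open>\<open>6 * (2 ^ l - 1)\<close> is the total length of the stages
      \<open>3 * 2 ^ i\<close> for \<open>i\<close> from 1 to \<open>l\<close>.\<close>
    have stage: "R (k + 6 * (2 ^ Suc l - 1)) \<le> 1122/1000 * \<tau> (Suc l) + 11 * h + R (k + 6 * (2 ^ l - 1)) / 10"
      if "l \<le> l0" for l
    proof -
      obtain Q where Q: "Q \<subseteq> D" "card Q \<le> 2 ^ Suc l - 1" "\<tau> (Suc l) = (\<Sum>j\<in>D - Q. x j)"
        using best_tail_attained[OF D, of "2 ^ Suc l - 1" x] unfolding \<tau>_def by metis
      \<comment> \<open>Indices selected before the stage stay selected, so only \<open>Q\<close>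
        can be missing from \<open>U\<close>, and \<open>2 ^ Suc l\<close> bounds the number of
        missing indices throughout the stage.\<close>
      define U where "U = (E \<inter> S k) \<union> Q"
      have U: "U \<subseteq> E" "E - U = D - Q" using Q(1) by (auto simp: U_def D_def)
      define k1 where "k1 = k + 6 * (2 ^ l - 1)"
      have two: "(2::nat) ^ l \<le> 2 ^ l0" using that by (simp add: power_increasing)
      have e: "k + 6 * (2 ^ Suc l - 1) = k1 + 3 * 2 ^ Suc l"
      proof -
        obtain z where "(2::nat) ^ l = Suc z" using not0_implies_Suc[of "2 ^ l"] by auto
        then show ?thesis unfolding k1_def by simp
      qed
      have le: "k1 + 3 * 2 ^ Suc l \<le> kmax"
      proof -
        have "k1 + 3 * 2 ^ Suc l \<le> k + 12 * 2 ^ l" unfolding k1_def by simp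
        then show ?thesis using two l0t kt by linarith
      qed
      have "R (k1 + 3 * 2 ^ Suc l) \<le> (1122/1000 * (\<Sum>j\<in>E - U. x j) + 11 * h) + R k1 / 10"
      proof (rule geometric_decay)
        show "0 \<le> 1122/1000 * (\<Sum>j\<in>E - U. x j) + 11 * h" using h x by (simp add: sum_nonneg)
        fix i :: nat assume i: "i < 3 * 2 ^ Suc l"
        have "card (U - S (k1 + i)) \<le> card Q"
          using Q(1) D Sm[of k "k1 + i"] by (intro card_mono) (auto simp: U_def k1_def intro: finite_subset)
        then have "card (U - S (k1 + i)) \<le> 2 ^ Suc l" using Q(2) by linarith
        then show "R (Suc (k1 + i)) - (1122/1000 * (\<Sum>j\<in>E - U. x j) + 11 * h)
             \<le> (1 - 49/51 / real (2 ^ Suc l)) * (R (k1 + i) - (1122/1000 * (\<Sum>j\<in>E - U. x j) + 11 * h))"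
          using i le U(1) by (intro step) auto
      qed (auto intro: Rnn)
      then show ?thesis unfolding e U(2) Q(3) k1_def .
    qed
    \<comment> \<open>The factor 5/4 reproduces itself: before \<open>l0\<close> the inequality
      \<open>\<tau> l < 2 * \<tau> (Suc l)\<close> holds, so a tenth of the previous bound adds at
      most a quarter of the new tail.\<close>
    have inv: "l \<le> l0 \<Longrightarrow> R (k + 6 * (2 ^ l - 1)) \<le> 5/4 * (1122/1000 * \<tau> l) + 25/2 * h" for l
    proof (induction l)
      case 0
      obtain Q where Q: "Q \<subseteq> D" "card Q \<le> 2 ^ 0 - 1" "\<tau> 0 = (\<Sum>j\<in>D - Q. x j)"
        using best_tail_attained[OF D, of "2 ^ 0 - 1" x] unfolding \<tau>_def by metis
      then have "Q = {}" using D finite_subset by fastforce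
      then have "E - E \<inter> S k = D - Q" by (auto simp: D_def)
      then have "R k \<le> 1122/1000 * \<tau> 0 + 11 * h" using upper[of k "E \<inter> S k"] kt Q(3) by simp
      then show ?case using h tnn[of 0] by simp
    next
      case (Suc l)
      then show ?case using stage[of l] nP[of l] h by simp
    qed
    define k' where "k' = k + 6 * (2 ^ Suc l0 - 1)"
    have k'k: "k' \<le> k + 12 * 2 ^ l0" by (simp add: k'_def)
    have k'max: "k' \<le> kmax" using k'k l0t kt by linarith
    \<comment> \<open>At \<open>l0\<close> the next tail is at most half as large, and 1/2 + 1/8 is
      5/8. It matters below that \<open>11/10 * 5/8 * 1122/1000\<close> is less than 98/100.\<close>
    have Rk': "R k' \<le> 5/8 * (1122/1000 * \<tau> l0) + 49/4 * h"
      using stage[of l0] inv[of l0] Pl0 by (simp add: P_def k'_def)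
    define t' where "t' = card (E - S k')"
    have sub: "E - S k' \<subseteq> D" using Sm[of k k'] by (auto simp: D_def k'_def)
    show ?thesis
    proof (cases "t' + 2 ^ l0 \<le> t")
      case True
      then have "t' < card (E - S k)" by (simp add: t_def D_def)
        (metis add_lessD1 add_le_imp_le_right less_add_same_cancel1 order_less_le_trans zero_less_numeral zero_less_power)
      moreover have le: "k' + 12 * t' \<le> k + 12 * t" using True k'k by linarith
      ultimately have "R (k' + 12 * t') \<le> 100 * h"
        using less.hyps[of k'] kt by (simp add: t'_def)
      then show ?thesis using Rm[OF le] by (simp add: t_def D_def)
    next
      case False
      \<comment> \<open>Fewer than \<open>2 ^ l0\<close> new correct indices form a competitor in
        the definition of \<open>\<tau> l0\<close>. The coefficients still missing therefore weigh
        at least \<open>\<tau> l0\<close>; by \<open>lower\<close> they weigh at most about the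
        residual, which is a smaller multiple of \<open>\<tau> l0\<close> plus noise. So
        \<open>\<tau> l0\<close> is itself of noise size.\<close>
      have "card (D - (E - S k')) = t - t'"
        unfolding t_def t'_def using card_Diff_subset[OF _ sub] D sub finite_subset by blast
      then have "card (D - (E - S k')) \<le> 2 ^ l0 - 1" using False by linarith
      then have "\<tau> l0 \<le> (\<Sum>j\<in>D - (D - (E - S k')). x j)" 
        unfolding \<tau>_def by (intro best_tail_le D) auto
      also have "D - (D - (E - S k')) = E - S k'" using sub by blast
      finally have "98/100 * \<tau> l0 \<le> 11/10 * R k' + 11 * h" using lower[OF k'max] by linarith
      then have "R k' \<le> 100 * h" using Rk' h by linarith
      moreover have "k' \<le> k + 12 * t" using k'k l0t by linarith
      ultimately show ?thesis using Rm[of k' "k + 12 * t"] by (simp add: t_def D_def)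
    qed
  qed
qed

section \<open>Isometry on sparse vectors and the decrease of the residual in one OMP step\<close>

lemma stable_matrix_sparse:
  assumes st: "stable_matrix J m A s" and J: "finite J" and s: "0 < s"
    and W: "W \<subseteq> J" "real (card W) \<le> s" and v: "\<And>j. j \<in> J - W \<Longrightarrow> v j = 0"
  shows "98/100 * (vec_norm J v)\<^sup>2 \<le> (vec_norm {..<m} (mat_vec J A v))\<^sup>2"
    and "(vec_norm {..<m} (mat_vec J A v))\<^sup>2 \<le> 102/100 * (vec_norm J v)\<^sup>2"
proof -
  have "(vec_norm1 J v)\<^sup>2 = (vec_norm1 W v)\<^sup>2" using vec_norm1_supp[OF J W(1)] v by simp
  also have "\<dots> \<le> real (card W) * (vec_norm W v)\<^sup>2"
    using J W(1) finite_subset by (intro vec_norm1_power2_le) blast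
  also have "\<dots> \<le> s * (vec_norm J v)\<^sup>2"
    using W(2) vec_norm_mono[OF J W(1)] by (intro mult_mono power_mono) auto
  finally have "(vec_norm1 J v)\<^sup>2 / s \<le> (vec_norm J v)\<^sup>2" using s by (simp add: field_simps)
  moreover have "\<bar>(vec_norm {..<m} (mat_vec J A v))\<^sup>2 - (vec_norm J v)\<^sup>2\<bar>
            \<le> 1/100 * ((vec_norm J v)\<^sup>2 + (vec_norm1 J v)\<^sup>2 / s)"
    using st unfolding stable_matrix_def by blast
  ultimately show "98/100 * (vec_norm J v)\<^sup>2 \<le> (vec_norm {..<m} (mat_vec J A v))\<^sup>2"
    and "(vec_norm {..<m} (mat_vec J A v))\<^sup>2 \<le> 102/100 * (vec_norm J v)\<^sup>2"
    unfolding abs_le_iff distrib_left by linarith+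
qed

lemma vec_norm_diff_power2:
  "(vec_norm X (\<lambda>l. r l - u l))\<^sup>2 = (vec_norm X r)\<^sup>2 + (vec_norm X u)\<^sup>2 - 2 * Re (\<Sum>l\<in>X. cnj (u l) * r l)"
proof -
  have "(cmod (r - u))\<^sup>2 = (cmod r)\<^sup>2 + (cmod u)\<^sup>2 - 2 * Re (cnj u * r)" for r u :: complex
    unfolding cmod_power2 by (simp add: power2_eq_square algebra_simps)
  then show ?thesis
    by (simp add: vec_norm_power2 sum.distrib sum_subtractf sum_distrib_left)
qed

lemma power2_sum_le: "(\<alpha> + \<beta>)\<^sup>2 \<le> 11/10 * \<alpha>\<^sup>2 + 11 * \<beta>\<^sup>2" for \<alpha> \<beta> :: real
  using zero_le_power2[of "\<alpha> - 10 * \<beta>"] by (simp add: power2_eq_square algebra_simps)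

text \<open>Let \<open>M\<close> be the largest correlation. Changing the coordinate
  \<open>j\<close> alone already lowers the squared residual by
  \<open>M\<^sup>2 / (102/100)\<close>. Conversely, the residual is orthogonal to the columns in
  \<open>S\<close>, so passing from \<open>p\<close> to \<open>u\<close> gains only through the at
  most \<open>q\<close> indices of \<open>D\<close>, and by \<open>low\<close> no more than
  \<open>q * M\<^sup>2 / (98/100)\<close>. The quotient of the two gains is
  \<open>49/51 / q\<close>.\<close>

lemma omp_step:
  assumes J: "finite J" and SJ: "S \<subseteq> J" and p: "{j. p j \<noteq> 0} \<subseteq> S"
    and opt: "\<And>z. {j. z j \<noteq> 0} \<subseteq> S \<Longrightarrow> residual_norm J m A y p \<le> residual_norm J m A y z"
    and j: "j \<in> J" "\<And>i. i \<in> J \<Longrightarrow> correlation J m A y p i \<le> correlation J m A y p j"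
    and opt': "\<And>z. {i. z i \<noteq> 0} \<subseteq> insert j S \<Longrightarrow> \<rho> \<le> residual_norm J m A y z" and rho: "0 \<le> \<rho>"
    and col: "\<And>i. i \<in> J \<Longrightarrow> (vec_norm {..<m} (\<lambda>l. A l i))\<^sup>2 \<le> 102/100"
    and D: "D \<subseteq> J" "D \<inter> S = {}" "card D \<le> q" "1 \<le> q"
    and u: "{i. u i \<noteq> 0} \<subseteq> S \<union> D"
    and low: "98/100 * (vec_norm J (\<lambda>i. u i - p i))\<^sup>2 \<le> (vec_norm {..<m} (mat_vec J A (\<lambda>i. u i - p i)))\<^sup>2"
  shows "\<rho>\<^sup>2 \<le> (residual_norm J m A y p)\<^sup>2
      - 49/51 / real q * ((residual_norm J m A y p)\<^sup>2 - (residual_norm J m A y u)\<^sup>2)"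
proof -
  define r where "r = residual J A y p"
  define ip where "ip = (\<lambda>i. \<Sum>l<m. cnj (A l i) * r l)"
  have corr: "correlation J m A y p i = cmod (ip i)" for i by (simp add: correlation_def ip_def r_def)
  define R where "R = (residual_norm J m A y p)\<^sup>2"
  have Rr: "R = (vec_norm {..<m} r)\<^sup>2"
    by (simp add: R_def r_def residual_norm_def vec_norm_def)
  have upd: "\<exists>z. {k. z k \<noteq> 0} \<subseteq> insert i S \<and> (residual_norm J m A y z)\<^sup>2 \<le> R - (cmod (ip i))\<^sup>2 / (102/100)"
    if i: "i \<in> J" for i
  proof -
    \<comment> \<open>The best step along column \<open>i\<close> would divide by the squared column
      norm; its upper bound 102/100 gives a gain that is uniform in \<open>i\<close>.\<close>
    define c where "c = ip i / of_real (102/100)"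
    define z where "z = p(i := p i + c)"
    have mz: "mat_vec J A z l = mat_vec J A p l + A l i * c" for l
    proof -
      have "mat_vec J A z l = (\<Sum>k\<in>J. A l k * p k + (if k = i then A l i * c else 0))"
        unfolding mat_vec_def z_def by (rule sum.cong) (auto simp: algebra_simps)
      then show ?thesis using i J by (simp add: sum.distrib mat_vec_def)
    qed
    have "(residual_norm J m A y z)\<^sup>2 = (vec_norm {..<m} (\<lambda>l. r l - A l i * c))\<^sup>2"
      unfolding residual_norm_eq r_def residual_eq_mat_vec mz by (simp add: algebra_simps)
    also have "\<dots> = R + (vec_norm {..<m} (\<lambda>l. A l i * c))\<^sup>2 - 2 * Re (\<Sum>l<m. cnj (A l i * c) * r l)"
      unfolding Rr by (rule vec_norm_diff_power2)
    also have "(\<Sum>l<m. cnj (A l i * c) * r l) = cnj c * ip i"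
      by (simp add: ip_def sum_distrib_left mult_ac)
    also have "cnj c * ip i = of_real ((cmod (ip i))\<^sup>2 / (102/100))"
      by (simp add: c_def complex_norm_square[symmetric] mult.commute flip: of_real_power)
    also have "Re (of_real ((cmod (ip i))\<^sup>2 / (102/100))) = (cmod (ip i))\<^sup>2 / (102/100)" by simp
    also have "(vec_norm {..<m} (\<lambda>l. A l i * c))\<^sup>2 = (vec_norm {..<m} (\<lambda>l. A l i))\<^sup>2 * (cmod c)\<^sup>2"
      by (simp add: vec_norm_power2 norm_mult power_mult_distrib sum_distrib_right)
    also have "R + (vec_norm {..<m} (\<lambda>l. A l i))\<^sup>2 * (cmod c)\<^sup>2 - 2 * ((cmod (ip i))\<^sup>2 / (102/100))
        \<le> R + 102/100 * (cmod c)\<^sup>2 - 2 * ((cmod (ip i))\<^sup>2 / (102/100))"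
      using mult_right_mono[OF col[OF i], of "(cmod c)\<^sup>2"] by simp
    also have "\<dots> = R - (cmod (ip i))\<^sup>2 / (102/100)"
      by (simp add: c_def norm_divide power_divide power2_eq_square)
    finally have "(residual_norm J m A y z)\<^sup>2 \<le> R - (cmod (ip i))\<^sup>2 / (102/100)" .
    moreover have "{k. z k \<noteq> 0} \<subseteq> insert i S" using p by (auto simp: z_def)
    ultimately show ?thesis by blast
  qed
  define M where "M = cmod (ip j)"
  have rnn: "0 \<le> residual_norm J m A y z" for z by (simp add: residual_norm_eq)
  have rho2: "\<rho>\<^sup>2 \<le> R - M\<^sup>2 / (102/100)"
  proof -
    obtain z where z: "{k. z k \<noteq> 0} \<subseteq> insert j S" "(residual_norm J m A y z)\<^sup>2 \<le> R - (cmod (ip j))\<^sup>2 / (102/100)"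
      using upd[OF j(1)] by blast
    from power_mono[OF opt'[OF z(1)] rho, of 2] z(2) show ?thesis unfolding M_def by (rule order_trans)
  qed
  \<comment> \<open>Orthogonality to the selected columns: an update inside \<open>S\<close> cannot
    improve on the least squares solution, so its guaranteed gain is zero.\<close>
  have ip0: "ip i = 0" if i: "i \<in> S" for i
  proof -
    obtain z where z: "{k. z k \<noteq> 0} \<subseteq> insert i S" "(residual_norm J m A y z)\<^sup>2 \<le> R - (cmod (ip i))\<^sup>2 / (102/100)"
      using upd[of i] subsetD[OF SJ i] by blast
    have "{k. z k \<noteq> 0} \<subseteq> S" using z(1) i by (simp only: insert_absorb)
    then have "R \<le> (residual_norm J m A y z)\<^sup>2"
      unfolding R_def by (intro power_mono opt rnn)
    from order_trans[OF this z(2)] have "(cmod (ip i))\<^sup>2 \<le> 0" by simp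
    then show ?thesis by simp
  qed
  define v where "v = (\<lambda>i. u i - p i)"
  have v0: "v i = 0" if "i \<notin> S \<union> D" for i
  proof -
    have "u i = 0" "p i = 0" using that u p by auto
    then show ?thesis by (simp add: v_def)
  qed
  have "(residual_norm J m A y u)\<^sup>2 = (vec_norm {..<m} (\<lambda>l. r l - mat_vec J A v l))\<^sup>2"
    unfolding residual_norm_eq r_def residual_eq_mat_vec v_def mat_vec_diff by simp
  also have "\<dots> = R + (vec_norm {..<m} (mat_vec J A v))\<^sup>2 - 2 * Re (\<Sum>l<m. cnj (mat_vec J A v l) * r l)"
    unfolding Rr by (rule vec_norm_diff_power2)
  finally have ru: "(residual_norm J m A y u)\<^sup>2 = R + (vec_norm {..<m} (mat_vec J A v))\<^sup>2
      - 2 * Re (\<Sum>l<m. cnj (mat_vec J A v l) * r l)" .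
  have fD: "finite D" using D(1) J finite_subset by blast
  have "(\<Sum>l<m. cnj (mat_vec J A v l) * r l) = (\<Sum>l<m. \<Sum>i\<in>J. cnj (v i) * (cnj (A l i) * r l))"
    by (simp add: mat_vec_def sum_distrib_left sum_distrib_right mult_ac)
  also have "\<dots> = (\<Sum>i\<in>J. cnj (v i) * ip i)"
    by (subst sum.swap) (simp add: ip_def sum_distrib_left)
  also have "\<dots> = (\<Sum>i\<in>D. cnj (v i) * ip i)"
    using J D(1) v0 ip0 by (intro sum.mono_neutral_right) auto
  finally have "Re (\<Sum>l<m. cnj (mat_vec J A v l) * r l) \<le> cmod (\<Sum>i\<in>D. cnj (v i) * ip i)"
    using complex_Re_le_cmod by metis
  also have "\<dots> \<le> (\<Sum>i\<in>D. cmod (v i) * M)"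
  proof (rule sum_norm_le)
    fix i assume "i \<in> D"
    then have "cmod (ip i) \<le> M" using j(2)[of i] D(1) by (auto simp: corr M_def)
    then show "cmod (cnj (v i) * ip i) \<le> cmod (v i) * M" by (simp add: norm_mult mult_left_mono)
  qed
  finally have ip_le: "Re (\<Sum>l<m. cnj (mat_vec J A v l) * r l) \<le> (\<Sum>i\<in>D. cmod (v i) * M)" .
  have "(\<Sum>i\<in>D. (cmod (v i))\<^sup>2) \<le> (vec_norm J v)\<^sup>2"
    unfolding vec_norm_power2 using J D(1) by (intro sum_mono2) auto
  then have "98/100 * (\<Sum>i\<in>D. (cmod (v i))\<^sup>2) - 2 * (\<Sum>i\<in>D. cmod (v i) * M) \<le> (residual_norm J m A y u)\<^sup>2 - R"
    using low ip_le unfolding ru v_def[symmetric] by linarith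
  moreover have "- (real (card D) * (M\<^sup>2 / (98/100)))
      \<le> 98/100 * (\<Sum>i\<in>D. (cmod (v i))\<^sup>2) - 2 * (\<Sum>i\<in>D. cmod (v i) * M)"
  proof -
    \<comment> \<open>Completing the square: each index of \<open>D\<close> contributes at least the
      minimum of a quadratic function of \<open>cmod (v i)\<close>.\<close>
    have "- (M\<^sup>2 / (98/100)) \<le> 98/100 * t\<^sup>2 - 2 * (t * M)" for t :: real
      using zero_le_power2[of "98/100 * t - M"] by (simp add: power2_eq_square algebra_simps)
    then have "(\<Sum>i\<in>D. - (M\<^sup>2 / (98/100))) \<le> (\<Sum>i\<in>D. 98/100 * (cmod (v i))\<^sup>2 - 2 * (cmod (v i) * M))"
      by (intro sum_mono)
    then show ?thesis by (simp add: sum_subtractf sum_distrib_left)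
  qed
  moreover have "real (card D) * (M\<^sup>2 / (98/100)) \<le> real q * (M\<^sup>2 / (98/100))"
    using D(3) by (intro mult_right_mono) auto
  ultimately have "R - (residual_norm J m A y u)\<^sup>2 \<le> real q * (M\<^sup>2 / (98/100))" by linarith
  then have "49/51 / real q * (R - (residual_norm J m A y u)\<^sup>2) \<le> 49/51 / real q * (real q * (M\<^sup>2 / (98/100)))"
    using D(4) by (intro mult_left_mono) auto
  also have "\<dots> = M\<^sup>2 / (102/100)" using D(4) by simp
  finally show ?thesis using rho2 unfolding R_def[symmetric] by linarith
qed

lemma omp_index_is_arg_max:
  assumes "finite J" "J \<noteq> {}"
  shows "is_arg_max (correlation J m A y p) (\<lambda>j. j \<in> J) (omp_index enum J m A y p)"
proof -
  let ?C = "correlation J m A y p ` J"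
  have "Max ?C \<in> ?C" using assms by (intro Max_in) auto
  then obtain j where j: "j \<in> J" "correlation J m A y p j = Max ?C" by force
  then have "correlation J m A y p i \<le> correlation J m A y p j" if "i \<in> J" for i
    using that assms(1) by simp
  with j(1) have "is_arg_max (correlation J m A y p) (\<lambda>j. j \<in> J) j" by (auto simp: is_arg_max_linorder)
  then show ?thesis unfolding omp_index_def by (rule arg_min_nat_lemma[THEN conjunct1])
qed

lemma residual_norm_restrict:
  "residual_norm J m A y (\<lambda>j. if j \<in> U then x j else 0)
     \<le> residual_norm J m A y x + vec_norm {..<m} (mat_vec J A (\<lambda>j. if j \<in> U then 0 else x j))"
proof -
  have "mat_vec J A x l = mat_vec J A (\<lambda>j. if j \<in> U then x j else 0) l + mat_vec J A (\<lambda>j. if j \<in> U then 0 else x j) l" for l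
    unfolding mat_vec_add[symmetric] by (simp add: mat_vec_def if_distrib cong: if_cong sum.cong)
  then have "residual_norm J m A y (\<lambda>j. if j \<in> U then x j else 0)
    = vec_norm {..<m} (\<lambda>l. (y l - mat_vec J A x l) + mat_vec J A (\<lambda>j. if j \<in> U then 0 else x j) l)"
    unfolding residual_norm_eq by simp
  also have "\<dots> \<le> residual_norm J m A y x + vec_norm {..<m} (mat_vec J A (\<lambda>j. if j \<in> U then 0 else x j))"
    unfolding residual_norm_eq by (rule vec_norm_add_le)
  finally show ?thesis .
qed

text \<open>The greedy bound asks for \<open>12 * card T\<close> steps, at most
  \<open>24 * n\<close>. The selected indices together with \<open>T\<close> then number at most
  \<open>26 * n\<close>, the level up to which sparse vectors are nearly isometric. The final
  residual is at most \<open>10 * \<eta>\<close>, comparison with \<open>x\<close> makes it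
  \<open>11 * \<eta>\<close>, and the lower isometry bound turns this into
  \<open>12 * \<eta>\<close>.\<close>

lemma omp_sparse_error:
  assumes J: "finite J" "J \<noteq> {}" and T: "T \<subseteq> J" "card T \<le> 2 * n" and n: "1 \<le> n"
    and st: "stable_matrix J m A (26 * real n)" and ls: "least_squares_rule J m ls"
    and x: "{j. x j \<noteq> 0} \<subseteq> T" and eta: "residual_norm J m A y x \<le> \<eta>"
  shows "vec_norm J (\<lambda>j. x j - snd (omp enum ls J m A y (24 * n)) j) \<le> 12 * \<eta>"
proof -
  define S where "S = (\<lambda>k. fst (omp enum ls J m A y k))"
  define p where "p = (\<lambda>k. snd (omp enum ls J m A y k))"
  define ix where "ix = (\<lambda>k. omp_index enum J m A y (p k))"
  define R where "R = (\<lambda>k. (residual_norm J m A y (p k))\<^sup>2)"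
  have S0: "S 0 = {}" and SSuc: "S (Suc k) = insert (ix k) (S k)"
    and p0: "p 0 = (\<lambda>_. 0)" and pSuc: "p (Suc k) = ls A y (S (Suc k))" for k
    by (simp_all add: S_def p_def ix_def Let_def case_prod_beta)
  have ixJ: "ix k \<in> J" and ixmax: "i \<in> J \<Longrightarrow> correlation J m A y (p k) i \<le> correlation J m A y (p k) (ix k)" for k i
    using omp_index_is_arg_max[OF J, of m A y "p k" enum] by (auto simp: ix_def is_arg_max_linorder)
  have SJ: "S k \<subseteq> J" for k by (induction k) (auto simp: S0 SSuc ixJ)
  have fS: "finite (S k)" for k using SJ J(1) finite_subset by blast
  have cS: "card (S k) \<le> k" for k
    by (induction k) (auto simp: S0 SSuc fS card_insert_if)
  \<comment> \<open>At \<open>k = 0\<close> the rule \<open>ls\<close> has not been applied yet;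
    there the zero vector is the only one with empty support.\<close>
  have am: "is_arg_min (residual_norm J m A y) (\<lambda>z. {j. z j \<noteq> 0} \<subseteq> S k) (p k)" for k
  proof (cases k)
    case 0
    then have "z = p k" if "{j. z j \<noteq> 0} \<subseteq> S k" for z using that by (auto simp: S0 p0)
    moreover have "{j. p k j \<noteq> 0} \<subseteq> S k" using 0 by (auto simp: p0)
    ultimately show ?thesis unfolding is_arg_min_def by blast
  next
    case (Suc i) then show ?thesis using ls SJ[of k] unfolding least_squares_rule_def by (simp add: pSuc)
  qed
  have ps: "{j. p k j \<noteq> 0} \<subseteq> S k"
    and popt: "{j. z j \<noteq> 0} \<subseteq> S k \<Longrightarrow> residual_norm J m A y (p k) \<le> residual_norm J m A y z" for k z
    using am[of k] by (auto simp: is_arg_min_linorder)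
  have rnn: "0 \<le> residual_norm J m A y z" for z by (simp add: residual_norm_eq)
  have eta0: "0 \<le> \<eta>" using eta rnn[of x] by linarith
  have fT: "finite T" using T J(1) finite_subset by blast
  have sp: "98/100 * (vec_norm J v)\<^sup>2 \<le> (vec_norm {..<m} (mat_vec J A v))\<^sup>2"
       "(vec_norm {..<m} (mat_vec J A v))\<^sup>2 \<le> 102/100 * (vec_norm J v)\<^sup>2"
    if "\<And>j. j \<in> J \<Longrightarrow> j \<notin> W \<Longrightarrow> v j = 0" "W \<subseteq> J" "card W \<le> 26 * n" for v W
  proof -
    have "real (card W) \<le> 26 * real n" using that(3) by linarith
    then show "98/100 * (vec_norm J v)\<^sup>2 \<le> (vec_norm {..<m} (mat_vec J A v))\<^sup>2"
      "(vec_norm {..<m} (mat_vec J A v))\<^sup>2 \<le> 102/100 * (vec_norm J v)\<^sup>2"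
      using stable_matrix_sparse[OF st J(1) _ that(2), of v] that(1) n by auto
  qed
  have TS: "T \<union> S k \<subseteq> J" "card (T \<union> S k) \<le> 26 * n" if "k \<le> 24 * n" for k
    using T SJ[of k] cS[of k] that card_Un_le[of T "S k"] by auto
  have lowp: "98/100 * (vec_norm J (\<lambda>j. z j - p k j))\<^sup>2 \<le> (vec_norm {..<m} (mat_vec J A (\<lambda>j. z j - p k j)))\<^sup>2"
    if "k \<le> 24 * n" "{j. z j \<noteq> 0} \<subseteq> T" for k z
  proof (rule sp(1)[OF _ TS[OF that(1)]])
    fix j assume "j \<in> J" "j \<notin> T \<union> S k"
    then have "z j = 0" "p k j = 0" using ps[of k] that(2) by auto
    then show "z j - p k j = 0" by simp
  qed
  \<comment> \<open>The coefficients off \<open>U\<close> act as additional noise; 1122/1000 is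
    11/10 from \<open>power2_sum_le\<close> times the upper isometry bound 102/100.\<close>
  have resU: "(residual_norm J m A y (\<lambda>j. if j \<in> U then x j else 0))\<^sup>2
      \<le> 1122/1000 * (\<Sum>j\<in>T - U. (cmod (x j))\<^sup>2) + 11 * \<eta>\<^sup>2" if "U \<subseteq> T" for U
  proof -
    define v where "v = (\<lambda>j. if j \<in> U then 0 else x j)"
    have "(residual_norm J m A y (\<lambda>j. if j \<in> U then x j else 0))\<^sup>2
      \<le> (vec_norm {..<m} (mat_vec J A v) + \<eta>)\<^sup>2"
      using residual_norm_restrict[of J m A y U x] eta rnn by (intro power_mono) (auto simp: v_def)
    also have "\<dots> \<le> 11/10 * (vec_norm {..<m} (mat_vec J A v))\<^sup>2 + 11 * \<eta>\<^sup>2" by (rule power2_sum_le)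
    also have "(vec_norm {..<m} (mat_vec J A v))\<^sup>2 \<le> 102/100 * (vec_norm J v)\<^sup>2"
      by (rule sp(2)[of T]) (use x T in \<open>auto simp: v_def\<close>)
    also have "vec_norm J v = vec_norm (T - U) v"
      using J T x by (intro vec_norm_supp) (auto simp: v_def)
    also have "(vec_norm (T - U) v)\<^sup>2 = (\<Sum>j\<in>T - U. (cmod (x j))\<^sup>2)"
      unfolding vec_norm_power2 by (rule sum.cong) (auto simp: v_def)
    finally show ?thesis by simp
  qed
  have col: "(vec_norm {..<m} (\<lambda>l. A l i))\<^sup>2 \<le> 102/100" if "i \<in> J" for i
  proof -
    define d where "d = (\<lambda>j. if j = i then 1 else 0 :: complex)"
    have "mat_vec J A d = (\<lambda>l. A l i)" using that J(1) by (auto simp: mat_vec_def d_def if_distrib cong: if_cong)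
    moreover have "(vec_norm J d)\<^sup>2 = 1"
    proof -
      have "(vec_norm J d)\<^sup>2 = (\<Sum>j\<in>J. if j = i then 1 else 0)"
        unfolding vec_norm_power2 by (rule sum.cong) (auto simp: d_def)
      then show ?thesis using that J(1) by simp
    qed
    ultimately show ?thesis using sp(2)[of "{i}" d] that n by (simp add: d_def)
  qed
  have "R (0 + 12 * card (T - S 0)) \<le> 100 * \<eta>\<^sup>2"
  proof (rule greedy_residual_bound[where x = "\<lambda>j. (cmod (x j))\<^sup>2" and kmax = "24 * n"])
    show "S k \<subseteq> S (Suc k)" for k by (auto simp: SSuc)
    show "R (Suc k) \<le> R k" for k
      unfolding R_def using ps[of k] by (intro power_mono popt rnn) (auto simp: SSuc)
    show "R k \<le> 1122/1000 * (\<Sum>j\<in>T - U. (cmod (x j))\<^sup>2) + 11 * \<eta>\<^sup>2" if "U \<subseteq> T" "U \<subseteq> S k" for k U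
    proof -
      have "R k \<le> (residual_norm J m A y (\<lambda>j. if j \<in> U then x j else 0))\<^sup>2"
        unfolding R_def using that by (intro power_mono popt rnn) auto
      then show ?thesis using resU[OF that(1)] by linarith
    qed
    show "R (Suc k) - (1122/1000 * (\<Sum>j\<in>T - U. (cmod (x j))\<^sup>2) + 11 * \<eta>\<^sup>2)
        \<le> (1 - 49/51 / real q) * (R k - (1122/1000 * (\<Sum>j\<in>T - U. (cmod (x j))\<^sup>2) + 11 * \<eta>\<^sup>2))"
      if k: "k < 24 * n" and U: "U \<subseteq> T" and q: "1 \<le> q" "card (U - S k) \<le> q" for k U q
    proof -
      define u where "u = (\<lambda>j. if j \<in> U then x j else 0)"
      have "R (Suc k) \<le> (residual_norm J m A y (p k))\<^sup>2
          - 49/51 / real q * ((residual_norm J m A y (p k))\<^sup>2 - (residual_norm J m A y u)\<^sup>2)"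
        unfolding R_def
      proof (rule omp_step[OF J(1) SJ[of k] ps popt ixJ[of k]])
        show "residual_norm J m A y (p (Suc k)) \<le> residual_norm J m A y z"
          if "{i. z i \<noteq> 0} \<subseteq> insert (ix k) (S k)" for z using popt[of z "Suc k"] that by (simp add: SSuc)
        show "98/100 * (vec_norm J (\<lambda>i. u i - p k i))\<^sup>2 \<le> (vec_norm {..<m} (mat_vec J A (\<lambda>i. u i - p k i)))\<^sup>2"
          using k x by (intro lowp) (auto simp: u_def)
        show "U - S k \<subseteq> J" using U T by auto
      qed (use q col ixmax in \<open>auto simp: u_def rnn\<close>)
      moreover have "49/51 / real q * (residual_norm J m A y u)\<^sup>2
          \<le> 49/51 / real q * (1122/1000 * (\<Sum>j\<in>T - U. (cmod (x j))\<^sup>2) + 11 * \<eta>\<^sup>2)"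
        using resU[OF U] unfolding u_def by (intro mult_left_mono) auto
      moreover have "a - f \<le> (1 - \<kappa>) * (b - f)" if "a \<le> b - \<kappa> * (b - g)" "\<kappa> * g \<le> \<kappa> * f" for a b f g \<kappa> :: real
        using that by (simp add: algebra_simps)
      ultimately show ?thesis unfolding R_def by blast
    qed
    show "98/100 * (\<Sum>j\<in>T - S k. (cmod (x j))\<^sup>2) \<le> 11/10 * R k + 11 * \<eta>\<^sup>2" if k: "k \<le> 24 * n" for k
    proof -
      have "(\<Sum>j\<in>T - S k. (cmod (x j))\<^sup>2) = (\<Sum>j\<in>T - S k. (cmod (x j - p k j))\<^sup>2)"
      proof (rule sum.cong)
        fix j assume "j \<in> T - S k"
        then have "p k j = 0" using ps[of k] by auto
        then show "(cmod (x j))\<^sup>2 = (cmod (x j - p k j))\<^sup>2" by simp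
      qed simp
      also have "\<dots> \<le> (vec_norm J (\<lambda>j. x j - p k j))\<^sup>2"
        unfolding vec_norm_power2 using J T by (intro sum_mono2) auto
      finally have "98/100 * (\<Sum>j\<in>T - S k. (cmod (x j))\<^sup>2) \<le> (vec_norm {..<m} (mat_vec J A (\<lambda>j. x j - p k j)))\<^sup>2"
        using lowp[OF k x] by linarith
      also have "\<dots> = (vec_norm {..<m} (\<lambda>l. (y l - mat_vec J A (p k) l) - (y l - mat_vec J A x l)))\<^sup>2"
        by (intro arg_cong[where f = "\<lambda>t. t\<^sup>2"] vec_norm_cong) (simp add: mat_vec_diff)
      also have "\<dots> \<le> (residual_norm J m A y (p k) + \<eta>)\<^sup>2"
        using vec_norm_diff_le[of "{..<m}" "\<lambda>l. y l - mat_vec J A (p k) l" "\<lambda>l. y l - mat_vec J A x l"] eta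
        by (intro power_mono) (auto simp: residual_norm_eq)
      also have "\<dots> \<le> 11/10 * R k + 11 * \<eta>\<^sup>2" unfolding R_def by (rule power2_sum_le)
      finally show ?thesis .
    qed
    show "0 + 12 * card (T - S 0) \<le> 24 * n" using T by (simp add: S0)
  qed (use fT in \<open>auto simp: R_def\<close>)
  moreover have "R (24 * n) \<le> R (0 + 12 * card (T - S 0))"
  proof (rule lift_Suc_antimono_le[of R])
    show "R (Suc k) \<le> R k" for k
      unfolding R_def using ps[of k] by (intro power_mono popt rnn) (auto simp: SSuc)
    show "0 + 12 * card (T - S 0) \<le> 24 * n" using T by (simp add: S0)
  qed
  ultimately have "(residual_norm J m A y (p (24 * n)))\<^sup>2 \<le> (10 * \<eta>)\<^sup>2" by (simp add: R_def power_mult_distrib)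
  then have "residual_norm J m A y (p (24 * n)) \<le> 10 * \<eta>"
    by (rule power2_le_imp_le) (use eta0 in simp)
  moreover have "vec_norm {..<m} (mat_vec J A (\<lambda>j. x j - p (24 * n) j))
      \<le> residual_norm J m A y (p (24 * n)) + residual_norm J m A y x"
    using vec_norm_diff_le[of "{..<m}" "\<lambda>l. y l - mat_vec J A (p (24 * n)) l" "\<lambda>l. y l - mat_vec J A x l"]
    unfolding residual_norm_eq mat_vec_diff by simp
  ultimately have "vec_norm {..<m} (mat_vec J A (\<lambda>j. x j - p (24 * n) j)) \<le> 11 * \<eta>" using eta by linarith
  then have "(vec_norm {..<m} (mat_vec J A (\<lambda>j. x j - p (24 * n) j)))\<^sup>2 \<le> (11 * \<eta>)\<^sup>2" by (intro power_mono) auto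
  then have "98/100 * (vec_norm J (\<lambda>j. x j - p (24 * n) j))\<^sup>2 \<le> 121 * \<eta>\<^sup>2"
    using lowp[of "24 * n" x] x by (simp add: power_mult_distrib)
  moreover have "(12 * \<eta>)\<^sup>2 = 144 * \<eta>\<^sup>2" by simp
  ultimately have "(vec_norm J (\<lambda>j. x j - p (24 * n) j))\<^sup>2 \<le> (12 * \<eta>)\<^sup>2"
    using zero_le_power2[of \<eta>] by linarith
  then have "vec_norm J (\<lambda>j. x j - p (24 * n) j) \<le> 12 * \<eta>" by (rule power2_le_imp_le) (use eta0 in simp)
  then show ?thesis by (simp add: p_def)
qed

text \<open>Add to \<open>T\<close> the indices whose coefficient exceeds \<open>w / n\<close>. At
  most \<open>n\<close> of them fit into an \<open>l1\<close> norm of \<open>w\<close>, and what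
  remains has squared Euclidean norm at most \<open>w / n\<close> times \<open>w\<close>. OMP needs
  this Euclidean bound because it treats the remaining coefficients as noise.\<close>

lemma large_coefficients:
  assumes J: "finite J" and T: "T \<subseteq> J" "card T \<le> n" and n: "1 \<le> n"
    and w: "vec_norm1 (J - T) c \<le> w"
  obtains T' where "T' \<subseteq> J" "card T' \<le> 2 * n" "vec_norm1 (J - T') c \<le> w" "vec_norm (J - T') c \<le> w / sqrt n"
proof -
  define G where "G = {j\<in>J - T. cmod (c j) > w / n}"
  have w0: "0 \<le> w" using w vec_norm1_nonneg[of "J - T" c] by linarith
  have fG: "finite G" using J by (simp add: G_def)
  have GJ: "vec_norm1 G c \<le> w"
    using w J unfolding vec_norm1_def G_def
    by (intro order_trans[OF sum_mono2 w[unfolded vec_norm1_def]]) auto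
  have cG: "card G \<le> n"
  proof (rule ccontr)
    assume a: "\<not> card G \<le> n"
    then have "G \<noteq> {}" by auto
    have "w \<le> real (card G) * (w / n)"
    proof -
      have "w * real n \<le> w * real (card G)" using a w0 by (intro mult_left_mono) auto
      then show ?thesis using n by (simp add: field_simps)
    qed
    also have "\<dots> = (\<Sum>j\<in>G. w / n)" by simp
    also have "\<dots> < vec_norm1 G c" unfolding vec_norm1_def
      using fG \<open>G \<noteq> {}\<close> by (intro sum_strict_mono) (auto simp: G_def)
    finally show False using GJ by simp
  qed
  define T' where "T' = T \<union> G"
  have n1: "vec_norm1 (J - T') c \<le> w"
    using w J unfolding vec_norm1_def T'_def
    by (intro order_trans[OF sum_mono2 w[unfolded vec_norm1_def]]) auto
  have "(vec_norm (J - T') c)\<^sup>2 = (\<Sum>j\<in>J - T'. cmod (c j) * cmod (c j))"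
    unfolding vec_norm_power2 by (simp add: power2_eq_square)
  also have "\<dots> \<le> (\<Sum>j\<in>J - T'. w / n * cmod (c j))"
    by (intro sum_mono mult_right_mono) (auto simp: T'_def G_def)
  also have "\<dots> = w / n * vec_norm1 (J - T') c" by (simp add: vec_norm1_def sum_distrib_left)
  also have "\<dots> \<le> w / n * w" using n1 w0 by (intro mult_left_mono) auto
  also have "\<dots> = (w / sqrt n)\<^sup>2" by (simp add: power_divide power2_eq_square)
  finally have "vec_norm (J - T') c \<le> w / sqrt n" by (rule power2_le_imp_le) (use w0 in simp)
  moreover have "card T' \<le> 2 * n" using card_Un_le[of T G] T(2) cG by (simp add: T'_def)
  moreover have "T' \<subseteq> J" using T by (auto simp: T'_def G_def)
  ultimately show ?thesis using that n1 by blast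
qed

text \<open>The part \<open>v\<close> of \<open>c\<close> off the enlarged support counts as noise:
  stability bounds \<open>A v\<close> through the Euclidean and the \<open>l1\<close> norm of
  \<open>v\<close>, both of which are controlled. The factor 25 is 12 times 2 for this noise, plus 1
  for \<open>v\<close> itself.\<close>

lemma omp_error:
  assumes J: "finite J" "J \<noteq> {}" and T: "T \<subseteq> J" "card T \<le> n" and n: "1 \<le> n"
    and st: "stable_matrix J m A (26 * real n)" and ls: "least_squares_rule J m ls"
    and eta: "residual_norm J m A y c \<le> \<eta>" and w: "vec_norm1 (J - T) c \<le> w"
  shows "vec_norm J (\<lambda>j. c j - snd (omp enum ls J m A y (24 * n)) j) \<le> 25 * (w / sqrt n + \<eta>)"
proof -
  obtain T' where T': "T' \<subseteq> J" "card T' \<le> 2 * n" "vec_norm1 (J - T') c \<le> w" "vec_norm (J - T') c \<le> w / sqrt n"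
    using large_coefficients[OF J(1) T n w] .
  have w0: "0 \<le> w" using w vec_norm1_nonneg[of "J - T" c] by linarith
  define x where "x = (\<lambda>j. if j \<in> T' then c j else 0)"
  define v where "v = (\<lambda>j. if j \<in> T' then 0 else c j)"
  define p where "p = snd (omp enum ls J m A y (24 * n))"
  have v2: "vec_norm J v \<le> w / sqrt n"
  proof -
    have "vec_norm J v = vec_norm (J - T') v" using J by (intro vec_norm_supp) (auto simp: v_def)
    also have "\<dots> = vec_norm (J - T') c" by (rule vec_norm_cong) (simp add: v_def)
    finally show ?thesis using T' by simp
  qed
  have v1: "vec_norm1 J v \<le> w"
  proof -
    have "vec_norm1 J v = vec_norm1 (J - T') v" using J by (intro vec_norm1_supp) (auto simp: v_def)
    also have "\<dots> = vec_norm1 (J - T') c" by (simp add: vec_norm1_def v_def)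
    finally show ?thesis using T' by simp
  qed
  have Av: "vec_norm {..<m} (mat_vec J A v) \<le> 2 * (w / sqrt n)"
  proof (rule power2_le_imp_le)
    define d where "d = w\<^sup>2 / real n"
    have sq: "(w / sqrt n)\<^sup>2 = d" by (simp add: power_divide d_def)
    have "(vec_norm J v)\<^sup>2 \<le> d" using power_mono[OF v2, of 2] unfolding sq by simp
    moreover have "(vec_norm1 J v)\<^sup>2 / (26 * real n) \<le> d"
    proof -
      have "(vec_norm1 J v)\<^sup>2 / (26 * real n) \<le> w\<^sup>2 / (26 * real n)"
        using power_mono[OF v1, of 2] by (simp add: divide_right_mono)
      also have "\<dots> \<le> d" using n unfolding d_def by (intro divide_left_mono) auto
      finally show ?thesis .
    qed
    moreover have "\<bar>(vec_norm {..<m} (mat_vec J A v))\<^sup>2 - (vec_norm J v)\<^sup>2\<bar>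
            \<le> 1/100 * ((vec_norm J v)\<^sup>2 + (vec_norm1 J v)\<^sup>2 / (26 * real n))"
      using st unfolding stable_matrix_def by blast
    moreover have "0 \<le> d" by (simp add: d_def)
    ultimately show "(vec_norm {..<m} (mat_vec J A v))\<^sup>2 \<le> (2 * (w / sqrt n))\<^sup>2"
      unfolding abs_le_iff power_mult_distrib[of 2] sq distrib_left by simp
  qed (use w0 in simp)
  have "residual_norm J m A y x \<le> \<eta> + 2 * (w / sqrt n)"
    using residual_norm_restrict[of J m A y T' c] eta Av by (simp add: x_def v_def)
  then have "vec_norm J (\<lambda>j. x j - p j) \<le> 12 * (\<eta> + 2 * (w / sqrt n))"
    unfolding p_def using T' by (intro omp_sparse_error[OF J _ _ n st ls, of T']) (auto simp: x_def)
  moreover have "vec_norm J (\<lambda>j. c j - p j) \<le> vec_norm J v + vec_norm J (\<lambda>j. x j - p j)"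
  proof -
    have "vec_norm J (\<lambda>j. c j - p j) = vec_norm J (\<lambda>j. v j + (x j - p j))"
      by (rule vec_norm_cong) (simp add: v_def x_def)
    then show ?thesis using vec_norm_add_le by metis
  qed
  moreover have "0 \<le> \<eta>" using eta by (smt (verit) residual_norm_eq vec_norm_nonneg)
  ultimately show ?thesis using v2 unfolding p_def[symmetric] distrib_left by linarith
qed

section \<open>Concentration of empirical averages\<close>

lemma exp_le_quadratic:
  fixes x :: real assumes "\<bar>x\<bar> \<le> 1" shows "exp x \<le> 1 + x + x\<^sup>2"
proof (cases "0 \<le> x")
  case True then show ?thesis using assms by (intro exp_bound) auto
next
  case False
  define y where "y = - x"
  have y: "0 < y" "y \<le> 1" using False assms by (auto simp: y_def)
  have "exp (- y) \<le> 1 / (1 + y)"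
    using exp_ge_add_one_self[of y] y by (simp add: exp_minus inverse_eq_divide frac_le)
  also have "\<dots> \<le> 1 - y + y\<^sup>2"
  proof -
    have "(1 - y + y\<^sup>2) * (1 + y) = 1 + y ^ 3" by (simp add: power2_eq_square power3_eq_cube algebra_simps)
    moreover have "0 \<le> y ^ 3" using y by simp
    ultimately show ?thesis using y by (subst pos_divide_le_eq) linarith+
  qed
  finally show ?thesis by (simp add: y_def)
qed

context prob_space begin

text \<open>Since \<open>W / h\<close> takes values between 0 and 1, its square is at most itself,
  so the mean takes over the role of the variance. The sign \<open>\<sigma>\<close> covers both
  tails.\<close>

lemma exp_moment_le:
  fixes W :: "'a \<Rightarrow> real" and \<epsilon> h \<sigma> :: real
  assumes W [measurable]: "W \<in> borel_measurable M"
    and Wb: "\<And>x. x \<in> space M \<Longrightarrow> 0 \<le> W x" "\<And>x. x \<in> space M \<Longrightarrow> W x \<le> h"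
    and h: "0 < h" and e: "0 < \<epsilon>" "\<epsilon> \<le> 1" and sg: "\<bar>\<sigma>\<bar> = 1"
  shows "integrable M (\<lambda>x. exp (\<epsilon> / h * (\<sigma> * (W x - expectation W))))"
    and "expectation (\<lambda>x. exp (\<epsilon> / h * (\<sigma> * (W x - expectation W)))) \<le> exp (\<epsilon>\<^sup>2 * expectation W / h)"
proof -
  define \<mu> where "\<mu> = expectation W"
  have Wint: "integrable M W"
    by (rule integrable_const_bound[where B = h]) (auto intro!: AE_I2 simp: Wb)
  have point: "exp (\<epsilon> * \<sigma> * (W x / h)) \<le> 1 + (\<epsilon> * \<sigma> + \<epsilon>\<^sup>2) * (W x / h)" if x: "x \<in> space M" for x
  proof -
    define u where "u = W x / h"
    have u: "0 \<le> u" "u \<le> 1" using Wb[OF x] h by (auto simp: u_def)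
    have "\<bar>\<epsilon> * \<sigma> * u\<bar> \<le> 1" using e u sg by (simp add: abs_mult mult_le_one)
    then have "exp (\<epsilon> * \<sigma> * u) \<le> 1 + \<epsilon> * \<sigma> * u + (\<epsilon> * \<sigma> * u)\<^sup>2" by (rule exp_le_quadratic)
    also have "(\<epsilon> * \<sigma> * u)\<^sup>2 = \<epsilon>\<^sup>2 * u\<^sup>2" using sg by (metis power2_abs power_mult_distrib one_power2 mult.right_neutral)
    also have "\<epsilon>\<^sup>2 * u\<^sup>2 \<le> \<epsilon>\<^sup>2 * u" using u by (intro mult_left_mono) (auto simp: power2_eq_square mult_left_le)
    finally show ?thesis by (simp add: u_def algebra_simps)
  qed
  have eq: "exp (\<epsilon> / h * (\<sigma> * (W x - \<mu>))) = exp (- \<epsilon> * \<sigma> * \<mu> / h) * exp (\<epsilon> * \<sigma> * (W x / h))" for x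
    by (simp add: exp_add[symmetric] diff_divide_distrib algebra_simps)
  have int1: "integrable M (\<lambda>x. exp (\<epsilon> * \<sigma> * (W x / h)))"
    by (rule Bochner_Integration.integrable_bound[where f = "\<lambda>x. 1 + (\<epsilon> * \<sigma> + \<epsilon>\<^sup>2) * (W x / h)"])
       (use Wint point in \<open>auto intro!: AE_I2 intro: order_trans[OF _ abs_ge_self]\<close>)
  show "integrable M (\<lambda>x. exp (\<epsilon> / h * (\<sigma> * (W x - expectation W))))"
    unfolding \<mu>_def[symmetric] eq using int1 by simp
  have "expectation (\<lambda>x. exp (\<epsilon> * \<sigma> * (W x / h))) \<le> expectation (\<lambda>x. 1 + (\<epsilon> * \<sigma> + \<epsilon>\<^sup>2) * (W x / h))"
    using int1 Wint point by (intro integral_mono) auto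
  also have "\<dots> = 1 + (\<epsilon> * \<sigma> + \<epsilon>\<^sup>2) * (\<mu> / h)" using Wint by (simp add: prob_space \<mu>_def)
  also have "\<dots> \<le> exp ((\<epsilon> * \<sigma> + \<epsilon>\<^sup>2) * (\<mu> / h))" by (rule exp_ge_add_one_self)
  finally have "exp (- \<epsilon> * \<sigma> * \<mu> / h) * expectation (\<lambda>x. exp (\<epsilon> * \<sigma> * (W x / h)))
      \<le> exp (- \<epsilon> * \<sigma> * \<mu> / h) * exp ((\<epsilon> * \<sigma> + \<epsilon>\<^sup>2) * (\<mu> / h))" by (intro mult_left_mono) auto
  also have "\<dots> = exp (\<epsilon>\<^sup>2 * \<mu> / h)" by (simp add: exp_add[symmetric] algebra_simps)
  finally show "expectation (\<lambda>x. exp (\<epsilon> / h * (\<sigma> * (W x - expectation W)))) \<le> exp (\<epsilon>\<^sup>2 * expectation W / h)"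
    unfolding \<mu>_def[symmetric] eq by simp
qed

text \<open>With exponential parameter \<open>\<epsilon> / h\<close> the summand
  \<open>\<epsilon> * expectation W\<close> of the threshold cancels the moment bound exactly, and
  only the additive deviation \<open>t\<close> remains in the exponent. A relative error is thus
  free of charge.\<close>

lemma chernoff_one_sided:
  fixes W :: "'a \<Rightarrow> real" and \<epsilon> h t \<sigma> :: real and m :: nat
  assumes W [measurable]: "W \<in> borel_measurable M"
    and Wb: "\<And>x. x \<in> space M \<Longrightarrow> 0 \<le> W x" "\<And>x. x \<in> space M \<Longrightarrow> W x \<le> h"
    and h: "0 < h" and e: "0 < \<epsilon>" "\<epsilon> \<le> 1" and sg: "\<bar>\<sigma>\<bar> = 1"
  defines "P \<equiv> PiM {..<m} (\<lambda>_. M)"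
  shows "measure P {X\<in>space P. m * (\<epsilon> * expectation W + t) \<le> (\<Sum>l<m. \<sigma> * (W (X l) - expectation W))}
           \<le> exp (- (\<epsilon> * m * t / h))"
proof -
  interpret I: product_prob_space "\<lambda>_. M" "{..<m}" by unfold_locales
  interpret PP: prob_space P unfolding P_def by unfold_locales
  have em: "integrable M (\<lambda>x. exp (\<epsilon> / h * (\<sigma> * (W x - expectation W))))"
    "expectation (\<lambda>x. exp (\<epsilon> / h * (\<sigma> * (W x - expectation W)))) \<le> exp (\<epsilon>\<^sup>2 * expectation W / h)"
    by (rule exp_moment_le; use W Wb h e sg in auto)+
  define f where "f = (\<lambda>X :: nat \<Rightarrow> 'a. \<Sum>l<m. \<sigma> * (W (X l) - expectation W))"
  have fe: "exp (\<epsilon> / h * f X) = (\<Prod>l<m. exp (\<epsilon> / h * (\<sigma> * (W (X l) - expectation W))))" for X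
    by (simp add: f_def sum_distrib_left exp_sum)
  have int: "integrable P (\<lambda>X. exp (\<epsilon> / h * f X))"
    unfolding fe P_def by (rule I.product_integrable_prod) (use em in auto)
  have "measure P {X\<in>space P. m * (\<epsilon> * expectation W + t) \<le> f X}
     \<le> exp (- (\<epsilon> / h) * (m * (\<epsilon> * expectation W + t))) * (\<integral>X\<in>space P. exp (\<epsilon> / h * f X) \<partial>P)"
  proof (rule PP.Chernoff_ineq_ge)
    show "set_integrable P (space P) (\<lambda>X. exp (\<epsilon> / h * f X))"
      unfolding set_integrable_def by (rule integrable_mult_indicator[OF sets.top int])
  qed (use e h in auto)
  also have "(\<integral>X\<in>space P. exp (\<epsilon> / h * f X) \<partial>P) = (\<Prod>l<m. expectation (\<lambda>x. exp (\<epsilon> / h * (\<sigma> * (W x - expectation W)))))"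
    unfolding set_integral_space[OF int] unfolding fe P_def by (rule I.product_integral_prod) (use em in auto)
  also have "\<dots> \<le> (\<Prod>l<m. exp (\<epsilon>\<^sup>2 * expectation W / h))"
    using em(2) by (intro prod_mono) auto
  also have "\<dots> = exp (m * (\<epsilon>\<^sup>2 * expectation W / h))" by (simp only: prod_constant card_lessThan exp_of_nat_mult)
  finally have "measure P {X\<in>space P. m * (\<epsilon> * expectation W + t) \<le> f X}
     \<le> exp (- (\<epsilon> / h) * (m * (\<epsilon> * expectation W + t))) * exp (m * (\<epsilon>\<^sup>2 * expectation W / h))"
    by (simp add: mult_left_mono)
  also have "\<dots> = exp (- (\<epsilon> * m * t / h))"
    unfolding exp_add[symmetric] using h by (intro arg_cong[where f = exp]) (simp add: field_simps power2_eq_square)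
  finally show ?thesis by (simp add: f_def)
qed

lemma chernoff_average:
  fixes W :: "'a \<Rightarrow> real" and \<epsilon> h t :: real and m :: nat
  assumes W [measurable]: "W \<in> borel_measurable M"
    and Wb: "\<And>x. x \<in> space M \<Longrightarrow> 0 \<le> W x" "\<And>x. x \<in> space M \<Longrightarrow> W x \<le> h"
    and h: "0 < h" and e: "0 < \<epsilon>" "\<epsilon> \<le> 1" and m: "0 < m"
  defines "P \<equiv> PiM {..<m} (\<lambda>_. M)"
  shows "measure P {X\<in>space P. \<epsilon> * expectation W + t < \<bar>(\<Sum>l<m. W (X l)) / m - expectation W\<bar>}
           \<le> 2 * exp (- (\<epsilon> * m * t / h))"
proof -
  interpret I: product_prob_space "\<lambda>_. M" "{..<m}" by unfold_locales
  interpret PP: prob_space P unfolding P_def by unfold_locales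
  let ?B = "\<lambda>\<sigma>. {X\<in>space P. m * (\<epsilon> * expectation W + t) \<le> (\<Sum>l<m. \<sigma> * (W (X l) - expectation W))}"
  have [measurable]: "(\<lambda>X. W (X l)) \<in> borel_measurable P" if "l < m" for l
    using that unfolding P_def
    by (intro measurable_compose[OF measurable_component_singleton[of l "{..<m}" "\<lambda>_. M"] W]) simp
  have sets: "?B \<sigma> \<in> sets P" for \<sigma> by measurable
  have sub: "{X\<in>space P. \<epsilon> * expectation W + t < \<bar>(\<Sum>l<m. W (X l)) / m - expectation W\<bar>} \<subseteq> ?B 1 \<union> ?B (- 1)"
  proof safe
    fix X assume X: "X \<in> space P" and a: "\<epsilon> * expectation W + t < \<bar>(\<Sum>l<m. W (X l)) / m - expectation W\<bar>"
      and b: "\<not> m * (\<epsilon> * expectation W + t) \<le> (\<Sum>l<m. - 1 * (W (X l) - expectation W))"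
    have "m * (\<epsilon> * expectation W + t) < m * \<bar>(\<Sum>l<m. W (X l)) / m - expectation W\<bar>"
      using a m by (intro mult_strict_left_mono) auto
    also have "\<dots> = \<bar>(\<Sum>l<m. W (X l)) - m * expectation W\<bar>"
    proof -
      have "m * \<bar>(\<Sum>l<m. W (X l)) / m - expectation W\<bar> = \<bar>m * ((\<Sum>l<m. W (X l)) / m - expectation W)\<bar>"
        by (simp add: abs_mult)
      then show ?thesis using m by (simp add: right_diff_distrib)
    qed
    finally show "m * (\<epsilon> * expectation W + t) \<le> (\<Sum>l<m. 1 * (W (X l) - expectation W))"
      using b by (simp add: sum_subtractf)
  qed
  have "measure P {X\<in>space P. \<epsilon> * expectation W + t < \<bar>(\<Sum>l<m. W (X l)) / m - expectation W\<bar>}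
      \<le> measure P (?B 1 \<union> ?B (- 1))"
    by (rule PP.finite_measure_mono[OF sub]) (use sets in blast)
  also have "\<dots> \<le> measure P (?B 1) + measure P (?B (- 1))" by (rule measure_Un_le) (rule sets)+
  also have "\<dots> \<le> exp (- (\<epsilon> * m * t / h)) + exp (- (\<epsilon> * m * t / h))"
    unfolding P_def by (intro add_mono chernoff_one_sided W Wb h e) auto
  finally show ?thesis by simp
qed

end

text \<open>The slice of \<open>t\<^sup>2\<close> between the heights \<open>h / 2\<close> and
  \<open>h\<close>; slices at consecutive dyadic heights telescope to a truncated square, see
  \<open>sum_level_part\<close>.\<close>

definition level_part :: "real \<Rightarrow> real \<Rightarrow> real" where
  "level_part h t = min (t\<^sup>2) h - min (t\<^sup>2) (h / 2)"

lemma level_part_nonneg: "0 \<le> h \<Longrightarrow> 0 \<le> level_part h t"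
  by (auto simp: level_part_def min_def)

lemma level_part_le: "0 \<le> h \<Longrightarrow> level_part h t \<le> h"
  by (auto simp: level_part_def min_def)

lemma measurable_level_part [measurable]: "level_part h \<in> borel_measurable borel"
  unfolding level_part_def by measurable

text \<open>If \<open>g\<close> is at most \<open>sqrt h / 2\<close>, then \<open>z\<close> is at
  most \<open>7/10 * sqrt h\<close>, whose square is below \<open>h / 2\<close>, and both slices
  vanish. Otherwise a slice is, up to a constant, the square of its argument clamped between
  \<open>sqrt (h / 2)\<close> and \<open>sqrt h\<close>, hence Lipschitz with constant
  \<open>2 * sqrt h\<close>. The indicator makes the errors summable over the levels.\<close>

lemma level_part_diff:
  assumes h: "0 < h" and e: "0 < \<epsilon>" "\<epsilon> \<le> 1/5" and nn: "0 \<le> g" "0 \<le> z" and d: "\<bar>g - z\<bar> \<le> \<epsilon> * sqrt h"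
  shows "\<bar>level_part h g - level_part h z\<bar> \<le> 2 * \<epsilon> * h * of_bool (h < 4 * g\<^sup>2)"
proof -
  define p where "p = sqrt h"
  have p: "0 < p" "p\<^sup>2 = h" using h by (auto simp: p_def)
  show ?thesis
  proof (cases "h < 4 * g\<^sup>2")
    case False
    then have "(2 * g)\<^sup>2 \<le> p\<^sup>2" by (simp add: power_mult_distrib p(2))
    then have g: "2 * g \<le> p" using p by (meson less_imp_le power2_le_imp_le)
    have "\<epsilon> * p \<le> 1/5 * p" using e p by (intro mult_right_mono) auto
    then have "10 * z \<le> 7 * p" using g d unfolding p_def[symmetric] by linarith
    then have "(10 * z)\<^sup>2 \<le> (7 * p)\<^sup>2" using nn by (intro power_mono) auto
    then have "100 * z\<^sup>2 \<le> 49 * h" by (simp add: power_mult_distrib p(2))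
    then have "z\<^sup>2 \<le> h / 2" using h by simp
    moreover have "g\<^sup>2 \<le> h / 2" using False h by simp
    ultimately show ?thesis using h False by (simp add: level_part_def min_def)
  next
    case True
    define p' where "p' = sqrt (h / 2)"
    have p': "0 < p'" "p'\<^sup>2 = h / 2" "p' \<le> p" using h by (auto simp: p_def p'_def)
    define c where "c = (\<lambda>t. max p' (min t p))"
    have lp: "level_part h t = (c t)\<^sup>2 - p'\<^sup>2" if "0 \<le> t" for t
    proof -
      have "t\<^sup>2 \<le> p\<^sup>2 \<longleftrightarrow> t \<le> p" "t\<^sup>2 \<le> p'\<^sup>2 \<longleftrightarrow> t \<le> p'"
        using that p p' by (auto simp: abs_le_square_iff[symmetric])
      then show ?thesis using p p' by (auto simp: level_part_def c_def min_def max_def)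
    qed
    have c: "0 \<le> c t" "c t \<le> p" for t using p p' by (auto simp: c_def)
    have "\<bar>c g - c z\<bar> \<le> \<bar>g - z\<bar>" by (auto simp: c_def min_def max_def)
    then have cd: "\<bar>c g - c z\<bar> \<le> \<epsilon> * p" using d unfolding p_def[symmetric] by linarith
    have "\<bar>level_part h g - level_part h z\<bar> = \<bar>c g - c z\<bar> * (c g + c z)"
    proof -
      have "level_part h g - level_part h z = (c g - c z) * (c g + c z)"
        unfolding lp[OF nn(1)] lp[OF nn(2)] by (simp add: power2_eq_square algebra_simps)
      then show ?thesis using c[of g] c[of z] by (simp add: abs_mult)
    qed
    also have "\<dots> \<le> (\<epsilon> * p) * (p + p)" using cd c[of g] c[of z] e p by (intro mult_mono add_mono) auto
    also have "\<dots> = 2 * \<epsilon> * h" using p(2) by (simp add: power2_eq_square)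
    finally show ?thesis using True by simp
  qed
qed

lemma sum_level_part:
  "(\<Sum>i<L. level_part (H / 2 ^ i) t) = min (t\<^sup>2) H - min (t\<^sup>2) (H / 2 ^ L)"
  using sum_lessThan_telescope'[of "\<lambda>i. min (t\<^sup>2) (H / 2 ^ i)" L] by (simp add: level_part_def mult.commute)

text \<open>A height \<open>h\<close> below \<open>c\<close> equals twice the drop of
  \<open>min h c\<close> when \<open>h\<close> is halved, and these drops telescope.\<close>

lemma sum_dyadic_below:
  fixes H c :: real
  assumes "0 < H" "0 \<le> c"
  shows "(\<Sum>i<L. H / 2 ^ i * of_bool (H / 2 ^ i < c)) \<le> 2 * c"
proof -
  have "(\<Sum>i<L. H / 2 ^ i * of_bool (H / 2 ^ i < c)) \<le> (\<Sum>i<L. 2 * (min (H / 2 ^ i) c - min (H / 2 ^ Suc i) c))"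
  proof (rule sum_mono)
    fix i
    have "0 < H / 2 ^ i" using assms by simp
    moreover have "H / 2 ^ Suc i = (H / 2 ^ i) / 2" by simp
    ultimately show "H / 2 ^ i * of_bool (H / 2 ^ i < c) \<le> 2 * (min (H / 2 ^ i) c - min (H / 2 ^ Suc i) c)"
      by (auto simp: min_def)
  qed
  also have "\<dots> = 2 * (min H c - min (H / 2 ^ L) c)"
    unfolding sum_distrib_left[symmetric] using sum_lessThan_telescope'[of "\<lambda>i. min (H / 2 ^ i) c" L] by simp
  also have "\<dots> \<le> 2 * c"
  proof -
    have *: "2 * (a - b) \<le> 2 * c" if "0 \<le> b" "a \<le> c" for a b using that by simp
    show ?thesis by (rule *) (use assms in auto)
  qed
  finally show ?thesis .
qed

text \<open>Every level has its own approximant \<open>z i\<close>. One that misses its accuracy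
  costs at most the whole height of the level; for the others \<open>level_part_diff\<close> and
  \<open>sum_dyadic_below\<close> with \<open>c = 4 * (cmod g)\<^sup>2\<close> produce
  \<open>2 * \<epsilon> * 2 * 4 = 16 * \<epsilon>\<close>.\<close>

lemma level_decomposition:
  fixes z :: "nat \<Rightarrow> complex" and g :: complex
  assumes e: "0 < \<epsilon>" "\<epsilon> \<le> 1/5" and H: "0 < H" "(cmod g)\<^sup>2 \<le> H"
  shows "\<bar>(cmod g)\<^sup>2 - (\<Sum>i<L. level_part (H / 2 ^ i) (cmod (z i)))\<bar>
    \<le> H / 2 ^ L + 16 * \<epsilon> * (cmod g)\<^sup>2 + (\<Sum>i<L. H / 2 ^ i * of_bool (\<epsilon> * sqrt (H / 2 ^ i) < cmod (g - z i)))"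
proof -
  let ?h = "\<lambda>i. H / 2 ^ i"
  let ?b = "\<lambda>i. of_bool (\<epsilon> * sqrt (?h i) < cmod (g - z i)) :: real"
  have "\<bar>(\<Sum>i<L. level_part (?h i) (cmod g)) - (\<Sum>i<L. level_part (?h i) (cmod (z i)))\<bar>
     \<le> (\<Sum>i<L. \<bar>level_part (?h i) (cmod g) - level_part (?h i) (cmod (z i))\<bar>)"
    unfolding sum_subtractf[symmetric] by (rule sum_abs)
  also have "\<dots> \<le> (\<Sum>i<L. 2 * \<epsilon> * (?h i * of_bool (?h i < 4 * (cmod g)\<^sup>2)) + ?h i * ?b i)"
  proof (rule sum_mono)
    fix i
    have h: "0 < ?h i" using H by simp
    show "\<bar>level_part (?h i) (cmod g) - level_part (?h i) (cmod (z i))\<bar>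
        \<le> 2 * \<epsilon> * (?h i * of_bool (?h i < 4 * (cmod g)\<^sup>2)) + ?h i * ?b i"
    proof (cases "\<epsilon> * sqrt (?h i) < cmod (g - z i)")
      case True
      have "\<bar>level_part (?h i) (cmod g) - level_part (?h i) (cmod (z i))\<bar> \<le> ?h i"
        using level_part_nonneg[of "?h i"] level_part_le[of "?h i"] h 
        by (smt (verit))
      moreover have "0 \<le> 2 * \<epsilon> * (?h i * of_bool (?h i < 4 * (cmod g)\<^sup>2))"
        using e h by (intro mult_nonneg_nonneg) auto
      ultimately show ?thesis using True by simp
    next
      case False
      then have "\<bar>cmod g - cmod (z i)\<bar> \<le> \<epsilon> * sqrt (?h i)" using norm_triangle_ineq3[of g "z i"] by linarith
      then show ?thesis using level_part_diff[OF h e, of "cmod g" "cmod (z i)"] False by (simp add: mult.assoc)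
    qed
  qed
  also have "\<dots> = 2 * \<epsilon> * (\<Sum>i<L. ?h i * of_bool (?h i < 4 * (cmod g)\<^sup>2)) + (\<Sum>i<L. ?h i * ?b i)"
    by (simp add: sum.distrib sum_distrib_left)
  also have "2 * \<epsilon> * (\<Sum>i<L. ?h i * of_bool (?h i < 4 * (cmod g)\<^sup>2)) \<le> 2 * \<epsilon> * (2 * (4 * (cmod g)\<^sup>2))"
    using e H by (intro mult_left_mono sum_dyadic_below) auto
  finally have "\<bar>(min ((cmod g)\<^sup>2) H - min ((cmod g)\<^sup>2) (?h L)) - (\<Sum>i<L. level_part (?h i) (cmod (z i)))\<bar>
     \<le> 16 * \<epsilon> * (cmod g)\<^sup>2 + (\<Sum>i<L. ?h i * ?b i)"
    unfolding sum_level_part by simp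
  moreover have "min ((cmod g)\<^sup>2) H = (cmod g)\<^sup>2" using H by simp
  moreover have "0 \<le> min ((cmod g)\<^sup>2) (?h L)" "min ((cmod g)\<^sup>2) (?h L) \<le> ?h L" using H by auto
  ultimately show ?thesis by linarith
qed

section \<open>Random sampling of bounded orthonormal systems\<close>

definition unit_set :: "complex set" where "unit_set = {0, 1, -1, \<i>, - \<i>}"

text \<open>The factor 2 undoes the halving of the weights in \<open>maurey_pmf\<close>: real and
  imaginary parts of a coefficient are drawn separately, and the sum of their moduli can exceed
  \<open>cmod\<close> but not twice \<open>cmod\<close>.\<close>

definition maurey_average :: "('i \<Rightarrow> 'a \<Rightarrow> complex) \<Rightarrow> nat \<Rightarrow> (nat \<Rightarrow> 'i \<times> complex) \<Rightarrow> 'a \<Rightarrow> complex" where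
  "maurey_average \<psi> r \<omega> x = (\<Sum>k<r. 2 * snd (\<omega> k) * \<psi> (fst (\<omega> k)) x) / of_nat r"

lemma finite_unit_set [simp]: "finite unit_set"
  and card_unit_set: "card unit_set = 5"
  and sum_unit_set: "sum f unit_set = f 0 + f 1 + f (-1) + f \<i> + f (- \<i>)" for f :: "complex \<Rightarrow> 'b :: comm_monoid_add"
  by (simp_all add: unit_set_def complex_eq_iff add.assoc)

lemma norm_unit_set_le: "u \<in> unit_set \<Longrightarrow> cmod u \<le> 1"
  by (auto simp: unit_set_def)

lemma maurey_pmf:
  assumes J: "finite J" "J \<noteq> {}" and v: "vec_norm1 J v \<le> 1"
  obtains q :: "('i \<times> complex) pmf" where "set_pmf q \<subseteq> J \<times> unit_set"
    "\<And>F :: 'i \<Rightarrow> complex. measure_pmf.expectation q (\<lambda>a. 2 * snd a * F (fst a)) = (\<Sum>j\<in>J. v j * F j)"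
proof -
  define \<rho> where "\<rho> = 1 - (\<Sum>j\<in>J. (\<bar>Re (v j)\<bar> + \<bar>Im (v j)\<bar>) / 2)"
  have "(\<Sum>j\<in>J. (\<bar>Re (v j)\<bar> + \<bar>Im (v j)\<bar>) / 2) \<le> vec_norm1 J v"
    unfolding vec_norm1_def
  proof (rule sum_mono)
    fix j show "(\<bar>Re (v j)\<bar> + \<bar>Im (v j)\<bar>) / 2 \<le> cmod (v j)"
      using abs_Re_le_cmod[of "v j"] abs_Im_le_cmod[of "v j"] by simp
  qed
  then have rho: "0 \<le> \<rho>" using v by (simp add: \<rho>_def)
  define w :: "'i \<Rightarrow> complex \<Rightarrow> real" where "w = (\<lambda>j u. if u = 0 then \<rho> / card J else if u = 1 then max 0 (Re (v j)) / 2
    else if u = -1 then max 0 (- Re (v j)) / 2 else if u = \<i> then max 0 (Im (v j)) / 2 else max 0 (- Im (v j)) / 2)"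
  have w0: "0 \<le> w j u" for j u using rho by (simp add: w_def)
  have ws: "w j 0 = \<rho> / card J" "w j 1 = max 0 (Re (v j)) / 2" "w j (-1) = max 0 (- Re (v j)) / 2"
    "w j \<i> = max 0 (Im (v j)) / 2" "w j (- \<i>) = max 0 (- Im (v j)) / 2" for j
    by (simp_all add: w_def complex_eq_iff)
  define wt where "wt = (\<lambda>a. if a \<in> J \<times> unit_set then w (fst a) (snd a) else 0)"
  have fin: "finite (J \<times> unit_set)" using J by simp
  have sum1: "sum wt (J \<times> unit_set) = 1"
  proof -
    have "sum wt (J \<times> unit_set) = (\<Sum>j\<in>J. \<Sum>u\<in>unit_set. w j u)"
      unfolding sum.cartesian_product by (rule sum.cong) (auto simp: wt_def)
    also have "\<dots> = (\<Sum>j\<in>J. \<rho> / card J + (\<bar>Re (v j)\<bar> + \<bar>Im (v j)\<bar>) / 2)"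
      unfolding sum_unit_set ws by (rule sum.cong) (auto simp: max_def field_simps)
    also have "\<dots> = 1" using J by (simp add: sum.distrib \<rho>_def)
    finally show ?thesis .
  qed
  have wt0: "0 \<le> wt a" for a by (simp add: wt_def w0)
  have "(\<integral>\<^sup>+ a. ennreal (wt a) \<partial>count_space UNIV) = (\<Sum>a\<in>J \<times> unit_set. ennreal (wt a))"
    using fin by (intro nn_integral_count_space') (auto simp: wt_def)
  also have "\<dots> = 1" using sum1 by (simp add: sum_ennreal wt0)
  finally have pm: "pmf (embed_pmf wt) a = wt a" for a
    using wt0 by (intro pmf_embed_pmf) auto
  define q where "q = embed_pmf wt"
  have pmq: "pmf q a = wt a" for a by (simp add: q_def pm)
  have "set_pmf q \<subseteq> J \<times> unit_set"
    unfolding set_pmf_eq pmq by (auto simp: wt_def split: if_splits)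
  moreover have "measure_pmf.expectation q (\<lambda>a. 2 * snd a * F (fst a)) = (\<Sum>j\<in>J. v j * F j)" for F
  proof -
    have "measure_pmf.expectation q (\<lambda>a. 2 * snd a * F (fst a))
       = (\<Sum>a\<in>J \<times> unit_set. pmf q a *\<^sub>R (2 * snd a * F (fst a)))"
      using fin calculation by (intro integral_measure_pmf) auto
    also have "\<dots> = (\<Sum>j\<in>J. \<Sum>u\<in>unit_set. w j u *\<^sub>R (2 * u * F j))"
      unfolding sum.cartesian_product by (rule sum.cong) (auto simp: pmq wt_def)
    also have "\<dots> = (\<Sum>j\<in>J. v j * F j)"
    proof (rule sum.cong)
      fix j
      have "(max 0 x / 2) *\<^sub>R (2 * z) + (max 0 (- x) / 2) *\<^sub>R (- (2 * z)) = x *\<^sub>R z" for x :: real and z :: complex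
        by (auto simp: max_def scaleR_conv_of_real)
      from this[of "Re (v j)" "F j"] this[of "Im (v j)" "\<i> * F j"]
      have "(\<Sum>u\<in>unit_set. w j u *\<^sub>R (2 * u * F j)) = Re (v j) *\<^sub>R F j + Im (v j) *\<^sub>R (\<i> * F j)"
        unfolding sum_unit_set ws by (simp add: algebra_simps)
      also have "\<dots> = (of_real (Re (v j)) + \<i> * of_real (Im (v j))) * F j"
        by (simp add: scaleR_conv_of_real algebra_simps)
      also have "\<dots> = v j * F j" by (simp only: complex_eq[symmetric])
      finally show "(\<Sum>u\<in>unit_set. w j u *\<^sub>R (2 * u * F j)) = v j * F j" .
    qed simp
    finally show ?thesis .
  qed
  ultimately show ?thesis by (rule that)
qed

lemma hoeffding_average_pmf:
  fixes f :: "'b \<Rightarrow> real" and c d :: real and r :: nat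
  assumes f: "\<And>a. a \<in> set_pmf q \<Longrightarrow> \<bar>f a\<bar> \<le> c" and c: "0 < c" and r: "1 \<le> r" and d: "0 \<le> d"
  shows "measure_pmf.prob (Pi_pmf {..<r} dflt (\<lambda>_. q)) {\<omega>. d \<le> \<bar>(\<Sum>k<r. f (\<omega> k)) / r - measure_pmf.expectation q f\<bar>}
     \<le> 2 * exp (- (r * d\<^sup>2 / (2 * c\<^sup>2)))"
proof -
  define Q where "Q = Pi_pmf {..<r} dflt (\<lambda>_. q)"
  define X where "X = (\<lambda>(k :: nat) \<omega>. f (\<omega> k))"
  have mq: "map_pmf (\<lambda>\<omega>. \<omega> k) Q = q" if "k < r" for k
    using that Pi_pmf_component[of "{..<r}" k dflt "\<lambda>_. q"] by (simp add: Q_def)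
  have EX: "measure_pmf.expectation Q (X k) = measure_pmf.expectation q f" if "k < r" for k
    unfolding X_def by (subst mq[OF that, symmetric]) simp
  define \<mu> where "\<mu> = (\<Sum>k<r. measure_pmf.expectation Q (X k))"
  have mu: "\<mu> = r * measure_pmf.expectation q f" by (simp add: \<mu>_def EX)
  have "prob_space.indep_vars (measure_pmf Q) (\<lambda>_. borel) X {..<r}"
    unfolding X_def Q_def
    by (rule prob_space.indep_vars_compose2[OF measure_pmf.prob_space_axioms indep_vars_Pi_pmf]) auto
  moreover have "AE \<omega> in measure_pmf Q. X k \<omega> \<in> {- c..c}" if "k < r" for k
  proof -
    have "X k \<omega> \<in> {- c..c}" if "\<omega> \<in> set_pmf Q" for \<omega>
    proof -
      have "\<omega> k \<in> set_pmf q" using that \<open>k < r\<close> unfolding mq[OF \<open>k < r\<close>, symmetric] by auto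
      then show ?thesis using f[of "\<omega> k"] by (auto simp: X_def)
    qed
    then show ?thesis by (simp add: AE_measure_pmf_iff)
  qed
  ultimately interpret H: Hoeffding_ineq "measure_pmf Q" "{..<r}" X "\<lambda>_. - c" "\<lambda>_. c" \<mu>
    by unfold_locales (auto simp: \<mu>_def)
  have "measure_pmf.prob Q {\<omega>\<in>space (measure_pmf Q). r * d \<le> \<bar>(\<Sum>k<r. X k \<omega>) - \<mu>\<bar>}
      \<le> 2 * exp (- 2 * (r * d)\<^sup>2 / (\<Sum>k<r. (c - (- c))\<^sup>2))"
    by (rule H.Hoeffding_ineq_abs_ge) (use d c r in auto)
  also have "- 2 * (r * d)\<^sup>2 / (\<Sum>k<r. (c - (- c))\<^sup>2) = - (r * d\<^sup>2 / (2 * c\<^sup>2))"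
    using c r by (simp add: power2_eq_square field_simps)
  also have "{\<omega>\<in>space (measure_pmf Q). r * d \<le> \<bar>(\<Sum>k<r. X k \<omega>) - \<mu>\<bar>}
      = {\<omega>. d \<le> \<bar>(\<Sum>k<r. f (\<omega> k)) / r - measure_pmf.expectation q f\<bar>}"
  proof -
    have "r * d \<le> \<bar>s - r * e\<bar> \<longleftrightarrow> d \<le> \<bar>s / r - e\<bar>" for s e :: real
    proof -
      have "s - r * e = r * (s / r - e)" using r by (simp add: field_simps)
      then have "\<bar>s - r * e\<bar> = r * \<bar>s / r - e\<bar>" by (simp add: abs_mult)
      then show ?thesis using r by simp
    qed
    then show ?thesis by (simp add: X_def mu)
  qed
  finally show ?thesis by (simp add: Q_def)
qed

text \<open>Hoeffding's inequality is applied to real and imaginary part, each with deviation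
  \<open>d / 2\<close> and summands of modulus at most \<open>2 * K\<close>; hence 32 = 4 * 2 * 4
  and the factor 4 in front.\<close>

lemma maurey_tail:
  assumes q: "set_pmf q \<subseteq> J \<times> unit_set" and K: "0 < K" "\<And>j. j \<in> J \<Longrightarrow> cmod (\<psi> j x) \<le> K"
    and E: "measure_pmf.expectation q (\<lambda>a. 2 * snd a * \<psi> (fst a) x) = g" and J: "finite J"
    and r: "1 \<le> r" and d: "0 < d"
  shows "measure_pmf.prob (Pi_pmf {..<r} dflt (\<lambda>_. q)) {\<omega>. d < cmod (g - maurey_average \<psi> r \<omega> x)}
     \<le> 4 * exp (- (r * d\<^sup>2 / (32 * K\<^sup>2)))"
proof -
  define Q where "Q = Pi_pmf {..<r} dflt (\<lambda>_. q)"
  define F where "F = (\<lambda>a. 2 * snd a * \<psi> (fst a) x)"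
  have FB: "cmod (F a) \<le> 2 * K" if "a \<in> set_pmf q" for a
  proof -
    have "fst a \<in> J" "snd a \<in> unit_set" using that q by auto
    then have "cmod (snd a) * cmod (\<psi> (fst a) x) \<le> 1 * K"
      using K norm_unit_set_le by (intro mult_mono) auto
    then show ?thesis by (simp add: F_def norm_mult)
  qed
  have fin: "finite (set_pmf q)" using q J by (meson finite_SigmaI finite_subset finite_unit_set)
  have int: "integrable (measure_pmf q) F" by (rule integrable_measure_pmf_finite[OF fin])
  have ERe: "measure_pmf.expectation q (\<lambda>a. Re (F a)) = Re g"
    and EIm: "measure_pmf.expectation q (\<lambda>a. Im (F a)) = Im g"
    using integral_Re[OF int] integral_Im[OF int] E unfolding F_def by simp_all
  have mav: "maurey_average \<psi> r \<omega> x = (\<Sum>k<r. F (\<omega> k)) / of_nat r" for \<omega>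
    by (simp add: maurey_average_def F_def)
  let ?R = "{\<omega>. d / 2 \<le> \<bar>(\<Sum>k<r. Re (F (\<omega> k))) / r - measure_pmf.expectation q (\<lambda>a. Re (F a))\<bar>}"
  let ?I = "{\<omega>. d / 2 \<le> \<bar>(\<Sum>k<r. Im (F (\<omega> k))) / r - measure_pmf.expectation q (\<lambda>a. Im (F a))\<bar>}"
  have "{\<omega>. d < cmod (g - maurey_average \<psi> r \<omega> x)} \<subseteq> ?R \<union> ?I"
  proof
    fix \<omega> assume a: "\<omega> \<in> {\<omega>. d < cmod (g - maurey_average \<psi> r \<omega> x)}"
    have "cmod (g - maurey_average \<psi> r \<omega> x)
      \<le> \<bar>Re (g - maurey_average \<psi> r \<omega> x)\<bar> + \<bar>Im (g - maurey_average \<psi> r \<omega> x)\<bar>" by (rule cmod_le)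
    also have "\<dots> = \<bar>Re g - (\<Sum>k<r. Re (F (\<omega> k))) / r\<bar> + \<bar>Im g - (\<Sum>k<r. Im (F (\<omega> k))) / r\<bar>"
      unfolding mav by simp
    finally have "d / 2 \<le> \<bar>Re g - (\<Sum>k<r. Re (F (\<omega> k))) / r\<bar> \<or> d / 2 \<le> \<bar>Im g - (\<Sum>k<r. Im (F (\<omega> k))) / r\<bar>"
      using a by (auto simp del: abs_divide)
    then show "\<omega> \<in> ?R \<union> ?I" unfolding ERe EIm by (auto simp: abs_minus_commute)
  qed
  then have "measure_pmf.prob Q {\<omega>. d < cmod (g - maurey_average \<psi> r \<omega> x)} \<le> measure_pmf.prob Q (?R \<union> ?I)"
    by (rule measure_pmf.finite_measure_mono) simp
  also have "\<dots> \<le> measure_pmf.prob Q ?R + measure_pmf.prob Q ?I" by (rule measure_Un_le) simp_all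
  also have "\<dots> \<le> 2 * exp (- (r * (d / 2)\<^sup>2 / (2 * (2 * K)\<^sup>2))) + 2 * exp (- (r * (d / 2)\<^sup>2 / (2 * (2 * K)\<^sup>2)))"
  proof (rule add_mono)
    have "\<bar>Re (F a)\<bar> \<le> 2 * K" "\<bar>Im (F a)\<bar> \<le> 2 * K" if "a \<in> set_pmf q" for a
      using FB[OF that] abs_Re_le_cmod[of "F a"] abs_Im_le_cmod[of "F a"] by linarith+
    note b = this
    have K2: "0 < 2 * K" and d2: "0 \<le> d / 2" using K(1) d by auto
    show "measure_pmf.prob Q ?R \<le> 2 * exp (- (r * (d / 2)\<^sup>2 / (2 * (2 * K)\<^sup>2)))"
      unfolding Q_def by (rule hoeffding_average_pmf[OF b(1) K2 r d2])
    show "measure_pmf.prob Q ?I \<le> 2 * exp (- (r * (d / 2)\<^sup>2 / (2 * (2 * K)\<^sup>2)))"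
      unfolding Q_def by (rule hoeffding_average_pmf[OF b(2) K2 r d2])
  qed
  also have "\<dots> = 4 * exp (- (r * d\<^sup>2 / (32 * K\<^sup>2)))" by (simp add: power_divide power_mult_distrib)
  finally show ?thesis by (simp add: Q_def)
qed

lemma borel_measurable_maurey_average:
  assumes "\<omega> \<in> PiE_dflt {..<r} dflt (\<lambda>_. J \<times> U)" "\<And>j. j \<in> J \<Longrightarrow> \<psi> j \<in> borel_measurable M"
  shows "maurey_average \<psi> r \<omega> \<in> borel_measurable M"
proof -
  have "fst (\<omega> k) \<in> J" if "k < r" for k using assms(1) that by (auto simp: PiE_dflt_def mem_Times_iff)
  then show ?thesis
    unfolding maurey_average_def[abs_def] using assms(2)
    by (intro borel_measurable_divide borel_measurable_sum borel_measurable_times borel_measurable_const) auto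
qed

context prob_space begin

text \<open>For random \<open>\<omega>\<close> the expected value of \<open>bad\<close> at any point
  is bounded by \<open>maurey_tail\<close>. Averaging this over the sample points and over
  \<open>M\<close> adds two such bounds, and some \<open>\<omega>\<close> is no worse than the mean.
  One \<open>\<omega>\<close> has to serve both measures because concentration is available only for
  a fixed average; it may depend on \<open>X\<close> and \<open>v\<close>, since the later union
  bound covers all averages.\<close>

lemma maurey_approximation:
  fixes \<psi> :: "'i \<Rightarrow> 'a \<Rightarrow> complex" and X :: "nat \<Rightarrow> 'a"
  assumes J: "finite J" "J \<noteq> {}" and v: "vec_norm1 J v \<le> 1"
    and K: "0 < K" "\<And>j x. j \<in> J \<Longrightarrow> cmod (\<psi> j x) \<le> K" and \<psi>: "\<And>j. j \<in> J \<Longrightarrow> \<psi> j \<in> borel_measurable M"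
    and r: "1 \<le> r" and d: "0 < d" and m: "0 < m"
  defines "bad \<equiv> \<lambda>\<omega> x. of_bool (d < cmod ((\<Sum>j\<in>J. v j * \<psi> j x) - maurey_average \<psi> r \<omega> x)) :: real"
  shows "\<exists>\<omega>\<in>PiE_dflt {..<r} dflt (\<lambda>_. J \<times> unit_set).
    (\<Sum>l<m. bad \<omega> (X l)) / real m + expectation (bad \<omega>) \<le> 8 * exp (- (r * d\<^sup>2 / (32 * K\<^sup>2)))"
proof (rule ccontr)
  assume "\<not> ?thesis"
  then have c: "8 * exp (- (r * d\<^sup>2 / (32 * K\<^sup>2))) < (\<Sum>l<m. bad \<omega> (X l)) / real m + expectation (bad \<omega>)"
    if "\<omega> \<in> PiE_dflt {..<r} dflt (\<lambda>_. J \<times> unit_set)" for \<omega> using that by (meson not_le)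
  obtain q where q: "set_pmf q \<subseteq> J \<times> unit_set"
    "\<And>F :: 'i \<Rightarrow> complex. measure_pmf.expectation q (\<lambda>a. 2 * snd a * F (fst a)) = (\<Sum>j\<in>J. v j * F j)"
    using maurey_pmf[OF J v] by blast
  define Q where "Q = Pi_pmf {..<r} dflt (\<lambda>_. q)"
  have sQ: "set_pmf Q \<subseteq> PiE_dflt {..<r} dflt (\<lambda>_. J \<times> unit_set)"
    using q(1) by (auto simp: Q_def set_Pi_pmf PiE_dflt_def)
  have fQ: "finite (set_pmf Q)"
    by (rule finite_subset[OF sQ]) (use J in auto)
  have bmeas: "bad \<omega> \<in> borel_measurable M" if "\<omega> \<in> set_pmf Q" for \<omega>
  proof -
    have [measurable]: "maurey_average \<psi> r \<omega> \<in> borel_measurable M"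
      using sQ that \<psi> by (intro borel_measurable_maurey_average) auto
    have [measurable]: "(\<lambda>x. \<Sum>j\<in>J. v j * \<psi> j x) \<in> borel_measurable M"
      using \<psi> by (intro borel_measurable_sum borel_measurable_times borel_measurable_const)
    have "{x\<in>space M. d < cmod ((\<Sum>j\<in>J. v j * \<psi> j x) - maurey_average \<psi> r \<omega> x)} \<in> sets M" by measurable
    then show ?thesis unfolding bad_def of_bool_def by (intro measurable_If measurable_const) auto
  qed
  have bint: "integrable M (bad \<omega>)" if "\<omega> \<in> set_pmf Q" for \<omega>
    by (rule integrable_const_bound[OF _ bmeas[OF that], where B = 1]) (simp add: bad_def)
  have pt: "(\<Sum>\<omega>\<in>set_pmf Q. pmf Q \<omega> * bad \<omega> x) \<le> 4 * exp (- (r * d\<^sup>2 / (32 * K\<^sup>2)))" for x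
  proof -
    have "(\<Sum>\<omega>\<in>set_pmf Q. pmf Q \<omega> * bad \<omega> x)
      = measure_pmf.expectation Q (indicat_real {\<omega>. d < cmod ((\<Sum>j\<in>J. v j * \<psi> j x) - maurey_average \<psi> r \<omega> x)})"
      using fQ by (subst integral_measure_pmf[OF fQ]) (auto simp: bad_def indicator_def of_bool_def intro!: sum.cong)
    also have "\<dots> = measure_pmf.prob Q {\<omega>. d < cmod ((\<Sum>j\<in>J. v j * \<psi> j x) - maurey_average \<psi> r \<omega> x)}"
      by simp
    also have "\<dots> \<le> 4 * exp (- (r * d\<^sup>2 / (32 * K\<^sup>2)))"
      unfolding Q_def by (rule maurey_tail[where \<psi> = \<psi> and x = x, OF q(1) K(1) _ q(2)[of "\<lambda>j. \<psi> j x"] J(1) r d]) (rule K(2))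
    finally show ?thesis .
  qed
  have s1: "(\<Sum>\<omega>\<in>set_pmf Q. pmf Q \<omega>) = 1" by (rule sum_pmf_eq_1[OF fQ]) simp
  have "8 * exp (- (r * d\<^sup>2 / (32 * K\<^sup>2))) = (\<Sum>\<omega>\<in>set_pmf Q. pmf Q \<omega> * (8 * exp (- (r * d\<^sup>2 / (32 * K\<^sup>2)))))"
    unfolding sum_distrib_right[symmetric] s1 by simp
  also have "\<dots> < (\<Sum>\<omega>\<in>set_pmf Q. pmf Q \<omega> * ((\<Sum>l<m. bad \<omega> (X l)) / real m + expectation (bad \<omega>)))"
    using fQ sQ c by (intro sum_strict_mono mult_strict_left_mono) (auto simp: set_pmf_not_empty pmf_positive)
  also have "\<dots> = (\<Sum>l<m. \<Sum>\<omega>\<in>set_pmf Q. pmf Q \<omega> * bad \<omega> (X l)) / real m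
      + expectation (\<lambda>x. \<Sum>\<omega>\<in>set_pmf Q. pmf Q \<omega> * bad \<omega> x)"
  proof -
    have "(\<Sum>l<m. \<Sum>\<omega>\<in>set_pmf Q. pmf Q \<omega> * bad \<omega> (X l)) = (\<Sum>\<omega>\<in>set_pmf Q. pmf Q \<omega> * (\<Sum>l<m. bad \<omega> (X l)))"
      unfolding sum_distrib_left by (rule sum.swap)
    moreover have "expectation (\<lambda>x. \<Sum>\<omega>\<in>set_pmf Q. pmf Q \<omega> * bad \<omega> x) = (\<Sum>\<omega>\<in>set_pmf Q. pmf Q \<omega> * expectation (bad \<omega>))"
      using bint by simp
    ultimately show ?thesis by (simp only: distrib_left sum.distrib times_divide_eq_right sum_divide_distrib[symmetric])
  qed
  also have "\<dots> \<le> (\<Sum>l<m. 4 * exp (- (r * d\<^sup>2 / (32 * K\<^sup>2)))) / real m + expectation (\<lambda>x. 4 * exp (- (r * d\<^sup>2 / (32 * K\<^sup>2))))"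
    using pt bint by (intro add_mono divide_right_mono sum_mono integral_mono) auto
  also have "\<dots> = 8 * exp (- (r * d\<^sup>2 / (32 * K\<^sup>2)))" using m by (simp add: prob_space)
  finally show False by simp
qed

end

section \<open>From concentration at every level to stability, for fixed sample points\<close>

context prob_space begin

text \<open>The sum \<open>S\<close> of the level parts of the chosen averages mediates: it is close
  to \<open>G\<close> in the mean over \<open>M\<close> and in the mean over the sample, and
  \<open>good\<close> compares the two means of \<open>S\<close>. All additive errors are multiples
  of \<open>\<sigma>\<close>.\<close>

lemma level_recovery:
  fixes \<psi> :: "'i \<Rightarrow> 'a \<Rightarrow> complex" and X :: "nat \<Rightarrow> 'a" and r :: "nat \<Rightarrow> nat" and t h :: "nat \<Rightarrow> real"
    and \<sigma> K :: real
  defines "h \<equiv> \<lambda>i. K\<^sup>2 / 2 ^ i"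
  defines "W \<equiv> \<lambda>i \<omega> x. level_part (h i) (cmod (maurey_average \<psi> (r i) \<omega> x))"
  assumes J: "finite J" "J \<noteq> {}" and v: "vec_norm1 J v \<le> 1"
    and K: "0 < K" "\<And>j x. j \<in> J \<Longrightarrow> cmod (\<psi> j x) \<le> K" and \<psi>: "\<And>j. j \<in> J \<Longrightarrow> \<psi> j \<in> borel_measurable M"
    and m: "0 < m" and sg: "0 < \<sigma>"
    and r: "\<And>i. i < L \<Longrightarrow> 1 \<le> r i"
      "\<And>i. i < L \<Longrightarrow> 8 * exp (- (r i * (1/8000 * sqrt (h i))\<^sup>2 / (32 * K\<^sup>2))) \<le> \<sigma> / (2 * K\<^sup>2)"
    and L: "K\<^sup>2 / 2 ^ L \<le> \<sigma>" and t: "(\<Sum>i<L. t i) \<le> 3 * \<sigma>"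
    and good: "\<And>i \<omega>. i < L \<Longrightarrow> \<omega> \<in> PiE_dflt {..<r i} dflt (\<lambda>_. J \<times> unit_set) \<Longrightarrow>
      \<bar>(\<Sum>l<m. W i \<omega> (X l)) / real m - expectation (W i \<omega>)\<bar> \<le> 1/8000 * expectation (W i \<omega>) + t i"
  shows "\<bar>(\<Sum>l<m. (cmod (\<Sum>j\<in>J. v j * \<psi> j (X l)))\<^sup>2) / real m - expectation (\<lambda>x. (cmod (\<Sum>j\<in>J. v j * \<psi> j x))\<^sup>2)\<bar>
     \<le> 1/100 * expectation (\<lambda>x. (cmod (\<Sum>j\<in>J. v j * \<psi> j x))\<^sup>2) + 20 * \<sigma>"
proof -
  define g where "g = (\<lambda>x. \<Sum>j\<in>J. v j * \<psi> j x)"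
  define bad where "bad = (\<lambda>i \<omega> x. of_bool (1/8000 * sqrt (h i) < cmod (g x - maurey_average \<psi> (r i) \<omega> x)) :: real)"
  have h0: "0 < h i" for i using K by (simp add: h_def)
  have g_meas [measurable]: "g \<in> borel_measurable M"
    unfolding g_def using \<psi> by (intro borel_measurable_sum borel_measurable_times borel_measurable_const)
  have gK: "(cmod (g x))\<^sup>2 \<le> K\<^sup>2" for x
  proof (rule power_mono)
    have "cmod (g x) \<le> (\<Sum>j\<in>J. cmod (v j) * K)"
      unfolding g_def by (rule sum_norm_le) (use K in \<open>auto simp: norm_mult intro!: mult_left_mono\<close>)
    also have "\<dots> \<le> 1 * K" unfolding sum_distrib_right[symmetric] vec_norm1_def[symmetric]
      using v K by (intro mult_right_mono) auto
    finally show "cmod (g x) \<le> K" by simp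
  qed simp
  have "\<exists>\<omega>\<in>PiE_dflt {..<r i} dflt (\<lambda>_. J \<times> unit_set).
      (\<Sum>l<m. bad i \<omega> (X l)) / real m + expectation (bad i \<omega>) \<le> \<sigma> / (2 * K\<^sup>2)" if "i < L" for i
    using maurey_approximation[where \<psi> = \<psi> and X = X and dflt = dflt and d = "1/8000 * sqrt (h i)", OF J v K \<psi> r(1)[OF that] _ m]
      r(2)[OF that] h0[of i] unfolding bad_def g_def by force
  then obtain \<omega> where w: "\<And>i. i < L \<Longrightarrow> \<omega> i \<in> PiE_dflt {..<r i} dflt (\<lambda>_. J \<times> unit_set)"
    and wbad: "\<And>i. i < L \<Longrightarrow> (\<Sum>l<m. bad i (\<omega> i) (X l)) / real m + expectation (bad i (\<omega> i)) \<le> \<sigma> / (2 * K\<^sup>2)"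
    by metis
  have z_meas [measurable]: "maurey_average \<psi> (r i) (\<omega> i) \<in> borel_measurable M" if "i < L" for i
    by (rule borel_measurable_maurey_average[OF w[OF that] \<psi>])
  have W_int: "integrable M (W i (\<omega> i))" if "i < L" for i
  proof (rule integrable_const_bound[where B = "h i"])
    show "W i (\<omega> i) \<in> borel_measurable M" unfolding W_def using z_meas[OF that] by measurable
    show "AE x in M. norm (W i (\<omega> i) x) \<le> h i"
      unfolding W_def using level_part_nonneg[of "h i"] level_part_le[of "h i"] h0[of i] by simp
  qed
  have bad_int: "integrable M (bad i (\<omega> i))" if "i < L" for i
  proof (rule integrable_const_bound[where B = 1])
    have [measurable]: "maurey_average \<psi> (r i) (\<omega> i) \<in> borel_measurable M" by (rule z_meas[OF that])
    have "{x\<in>space M. 1/8000 * sqrt (h i) < cmod (g x - maurey_average \<psi> (r i) (\<omega> i) x)} \<in> sets M" by measurable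
    then show "bad i (\<omega> i) \<in> borel_measurable M" unfolding bad_def of_bool_def by (intro measurable_If measurable_const) auto
  qed (simp add: bad_def)
  define G where "G = (\<lambda>x. (cmod (g x))\<^sup>2)"
  define S where "S = (\<lambda>x. \<Sum>i<L. W i (\<omega> i) x)"
  define D where "D = (\<lambda>x. \<Sum>i<L. h i * bad i (\<omega> i) x)"
  have G_int: "integrable M G"
  proof (rule integrable_const_bound[where B = "K\<^sup>2"])
    show "AE x in M. norm (G x) \<le> K\<^sup>2" using gK by (simp add: G_def)
    show "G \<in> borel_measurable M" unfolding G_def by measurable
  qed
  have S_int: "integrable M S" unfolding S_def using W_int by auto
  have D_int: "integrable M D" unfolding D_def using bad_int by auto
  have pt: "\<bar>G x - S x\<bar> \<le> \<sigma> + 1/500 * G x + D x" for x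
  proof -
    have "\<bar>G x - S x\<bar> \<le> K\<^sup>2 / 2 ^ L + 16 * (1/8000) * G x + D x"
      unfolding G_def S_def D_def W_def bad_def h_def
      by (rule level_decomposition) (use K gK in auto)
    then show ?thesis using L by simp
  qed
  define avg where "avg = (\<lambda>f. (\<Sum>l<m. f (X l)) / real m :: real)"
  have avg_mono: "avg f \<le> avg f'" if "\<And>x. f x \<le> f' x" for f f'
    unfolding avg_def using that by (intro divide_right_mono sum_mono) auto
  have avg_lin: "avg (\<lambda>x. f x + f' x) = avg f + avg f'" "avg (\<lambda>x. c * f x) = c * avg f" "avg (\<lambda>x. c) = c" for f f' c
    using m by (simp_all add: avg_def sum.distrib add_divide_distrib sum_distrib_left)
  have avg_abs: "\<bar>avg f - avg f'\<bar> \<le> avg (\<lambda>x. \<bar>f x - f' x\<bar>)" for f f'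
    unfolding avg_def diff_divide_distrib[symmetric] sum_subtractf[symmetric] abs_divide
    by (simp add: divide_right_mono sum_abs)
  have avg_sum: "avg (\<lambda>x. \<Sum>i<L. f i x) = (\<Sum>i<L. avg (f i))" for f :: "nat \<Rightarrow> 'a \<Rightarrow> real"
    unfolding avg_def by (subst sum.swap) (simp add: sum_divide_distrib)
  have E1: "\<bar>expectation G - expectation S\<bar> \<le> \<sigma> + 1/500 * expectation G + expectation D"
  proof -
    have "\<bar>expectation G - expectation S\<bar> = \<bar>expectation (\<lambda>x. G x - S x)\<bar>" using G_int S_int by simp
    also have "\<dots> \<le> expectation (\<lambda>x. \<bar>G x - S x\<bar>)" by (rule integral_abs_bound)
    also have "\<dots> \<le> expectation (\<lambda>x. \<sigma> + 1/500 * G x + D x)"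
      using pt G_int S_int D_int by (intro integral_mono) auto
    also have "\<dots> = \<sigma> + 1/500 * expectation G + expectation D" using G_int D_int by (simp add: prob_space)
    finally show ?thesis .
  qed
  have A1: "\<bar>avg G - avg S\<bar> \<le> \<sigma> + 1/500 * avg G + avg D"
  proof -
    have "\<bar>avg G - avg S\<bar> \<le> avg (\<lambda>x. \<sigma> + 1/500 * G x + D x)"
      using avg_abs avg_mono[OF pt] by (rule order_trans)
    then show ?thesis unfolding avg_lin .
  qed
  have D0: "0 \<le> D x" for x unfolding D_def using h0 by (intro sum_nonneg) (simp add: bad_def less_imp_le)
  \<comment> \<open>A bad point loses level \<open>i\<close> entirely, at a cost of
    \<open>h i\<close>. The heights sum to at most \<open>2 * K\<^sup>2\<close>, which matches the
    bound \<open>\<sigma> / (2 * K\<^sup>2)\<close> on each bad set.\<close>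
  have D_le: "avg D + expectation D \<le> \<sigma>"
  proof -
    have "avg D + expectation D = (\<Sum>i<L. h i * (avg (bad i (\<omega> i)) + expectation (bad i (\<omega> i))))"
      unfolding D_def avg_sum avg_lin using bad_int by (simp add: sum.distrib distrib_left)
    also have "\<dots> \<le> (\<Sum>i<L. h i * (\<sigma> / (2 * K\<^sup>2)))"
      using wbad h0 unfolding avg_def by (intro sum_mono mult_left_mono) (auto simp: less_imp_le)
    also have "\<dots> = (\<Sum>i<L. (1/2) ^ i) * (\<sigma> / 2)"
      unfolding sum_distrib_right using K by (intro sum.cong) (auto simp: h_def power_divide)
    also have "\<dots> \<le> 2 * (\<sigma> / 2)"
    proof (rule mult_right_mono)
      show "(\<Sum>i<L. (1/2 :: real) ^ i) \<le> 2" by (subst sum_gp_strict) auto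
    qed (use sg in simp)
    finally show ?thesis by simp
  qed
  have SS: "\<bar>avg S - expectation S\<bar> \<le> 1/8000 * expectation S + 3 * \<sigma>"
  proof -
    have ES: "expectation S = (\<Sum>i<L. expectation (W i (\<omega> i)))" unfolding S_def using W_int by simp
    have "\<bar>avg S - expectation S\<bar> \<le> (\<Sum>i<L. \<bar>avg (W i (\<omega> i)) - expectation (W i (\<omega> i))\<bar>)"
      unfolding ES unfolding S_def avg_sum sum_subtractf[symmetric] by (rule sum_abs)
    also have "\<dots> \<le> (\<Sum>i<L. 1/8000 * expectation (W i (\<omega> i)) + t i)"
      using good w unfolding avg_def by (intro sum_mono) auto
    also have "\<dots> \<le> 1/8000 * expectation S + 3 * \<sigma>"
      using t unfolding ES by (simp add: sum.distrib sum_distrib_left)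
    finally show ?thesis .
  qed
  have "0 \<le> expectation D" by (rule Bochner_Integration.integral_nonneg) (rule D0)
  moreover have "0 \<le> avg D" using avg_mono[of "\<lambda>_. 0" D] D0 unfolding avg_lin by simp
  moreover have "0 \<le> expectation G" by (rule Bochner_Integration.integral_nonneg) (simp add: G_def)
  ultimately have "\<bar>avg G - expectation G\<bar> \<le> 1/100 * expectation G + 20 * \<sigma>"
    using E1 A1 D_le SS sg unfolding abs_le_iff by (elim conjE, intro conjI) linarith+
  then show ?thesis unfolding avg_def G_def g_def .
qed

text \<open>By homogeneity it suffices to treat vectors of \<open>l1\<close> norm one. The choice
  \<open>\<sigma> = 1 / (2000 * s)\<close> turns the additive error \<open>20 * \<sigma>\<close> of
  \<open>level_recovery\<close> into \<open>1 / (100 * s)\<close>.\<close>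

lemma stable_of_levels:
  fixes \<psi> :: "'i \<Rightarrow> 'a \<Rightarrow> complex" and X :: "nat \<Rightarrow> 'a" and r :: "nat \<Rightarrow> nat" and t h :: "nat \<Rightarrow> real"
    and s K :: real
  defines "h \<equiv> \<lambda>i. K\<^sup>2 / 2 ^ i"
  defines "W \<equiv> \<lambda>i \<omega> x. level_part (h i) (cmod (maurey_average \<psi> (r i) \<omega> x))"
  assumes J: "finite J" "J \<noteq> {}"
    and K: "0 < K" "\<And>j x. j \<in> J \<Longrightarrow> cmod (\<psi> j x) \<le> K" and \<psi>: "\<And>j. j \<in> J \<Longrightarrow> \<psi> j \<in> borel_measurable M"
    and energy: "\<And>v. expectation (\<lambda>x. (cmod (\<Sum>j\<in>J. v j * \<psi> j x))\<^sup>2) = (vec_norm J v)\<^sup>2"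
    and m: "0 < m" and s: "0 < s"
    and r: "\<And>i. i < L \<Longrightarrow> 1 \<le> r i"
      "\<And>i. i < L \<Longrightarrow> 8 * exp (- (r i * (1/8000 * sqrt (h i))\<^sup>2 / (32 * K\<^sup>2))) \<le> 1 / (2000 * s) / (2 * K\<^sup>2)"
    and L: "K\<^sup>2 / 2 ^ L \<le> 1 / (2000 * s)" and t: "(\<Sum>i<L. t i) \<le> 3 * (1 / (2000 * s))"
    and good: "\<And>i \<omega>. i < L \<Longrightarrow> \<omega> \<in> PiE_dflt {..<r i} dflt (\<lambda>_. J \<times> unit_set) \<Longrightarrow>
      \<bar>(\<Sum>l<m. W i \<omega> (X l)) / real m - expectation (W i \<omega>)\<bar> \<le> 1/8000 * expectation (W i \<omega>) + t i"
  shows "stable_matrix J m (\<lambda>l j. of_real (1 / sqrt m) * \<psi> j (X l)) s"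
  unfolding stable_matrix_def
proof
  fix v :: "'i \<Rightarrow> complex"
  define A where "A = (\<lambda>l j. of_real (1 / sqrt m) * \<psi> j (X l))"
  have Av: "(vec_norm {..<m} (mat_vec J A v))\<^sup>2 = (\<Sum>l<m. (cmod (\<Sum>j\<in>J. v j * \<psi> j (X l)))\<^sup>2) / real m" for v
  proof -
    have "mat_vec J A v l = of_real (1 / sqrt m) * (\<Sum>j\<in>J. v j * \<psi> j (X l))" for l
      unfolding mat_vec_def A_def sum_distrib_left by (rule sum.cong) (auto simp: mult_ac)
    then have "(cmod (mat_vec J A v l))\<^sup>2 = (cmod (\<Sum>j\<in>J. v j * \<psi> j (X l)))\<^sup>2 / real m" for l
      by (simp add: norm_mult norm_divide power_mult_distrib power_divide)
    then show ?thesis by (simp add: vec_norm_power2 sum_divide_distrib)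
  qed
  show "\<bar>(vec_norm {..<m} (mat_vec J A v))\<^sup>2 - (vec_norm J v)\<^sup>2\<bar> \<le> 1/100 * ((vec_norm J v)\<^sup>2 + (vec_norm1 J v)\<^sup>2 / s)"
  proof (cases "vec_norm1 J v = 0")
    case True
    then have "v j = 0" if "j \<in> J" for j using that J(1) unfolding vec_norm1_def by (simp add: sum_nonneg_eq_0_iff)
    then have "vec_norm J v = 0" "vec_norm {..<m} (mat_vec J A v) = 0"
      by (simp_all add: vec_norm_def L2_set_def mat_vec_def)
    then show ?thesis using s by simp
  next
    case False
    define c where "c = vec_norm1 J v"
    have c: "0 < c" using False vec_norm1_nonneg[of J v] unfolding c_def by linarith
    define u where "u = (\<lambda>j. v j / of_real c)"
    have vu: "v = (\<lambda>j. of_real c * u j)" using c by (simp add: u_def)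
    have "vec_norm1 J u = vec_norm1 J v / c" using c unfolding vec_norm1_def u_def by (simp add: norm_divide sum_divide_distrib)
    then have u1: "vec_norm1 J u \<le> 1" using c by (simp add: c_def)
    have "\<bar>(vec_norm {..<m} (mat_vec J A u))\<^sup>2 - (vec_norm J u)\<^sup>2\<bar> \<le> 1/100 * (vec_norm J u)\<^sup>2 + 20 * (1 / (2000 * s))"
      unfolding Av energy[symmetric]
      by (rule level_recovery[OF J u1 K \<psi> m _ r[unfolded h_def] L t good[unfolded W_def h_def]]) (use s in auto)
    then have "c\<^sup>2 * \<bar>(vec_norm {..<m} (mat_vec J A u))\<^sup>2 - (vec_norm J u)\<^sup>2\<bar>
       \<le> c\<^sup>2 * (1/100 * (vec_norm J u)\<^sup>2 + 20 * (1 / (2000 * s)))" by (intro mult_left_mono) auto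
    moreover have "(vec_norm J v)\<^sup>2 = c\<^sup>2 * (vec_norm J u)\<^sup>2"
      unfolding vu vec_norm_power2 using c by (simp add: norm_mult power_mult_distrib sum_distrib_left)
    moreover have "(vec_norm {..<m} (mat_vec J A v))\<^sup>2 = c\<^sup>2 * (vec_norm {..<m} (mat_vec J A u))\<^sup>2"
    proof -
      have "mat_vec J A v l = of_real c * mat_vec J A u l" for l
        unfolding mat_vec_def vu sum_distrib_left by (rule sum.cong) (auto simp: mult_ac)
      then show ?thesis using c unfolding vec_norm_power2 by (simp add: norm_mult power_mult_distrib sum_distrib_left)
    qed
    moreover have "c\<^sup>2 * \<bar>x - y\<bar> = \<bar>c\<^sup>2 * x - c\<^sup>2 * y\<bar>" for x y
      unfolding right_diff_distrib[symmetric] by (simp add: abs_mult)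
    moreover have "c\<^sup>2 * (1/100 * (vec_norm J u)\<^sup>2 + 20 * (1 / (2000 * s))) = 1/100 * (c\<^sup>2 * (vec_norm J u)\<^sup>2 + c\<^sup>2 / s)"
      using s by (simp add: field_simps)
    ultimately show ?thesis unfolding c_def[symmetric] by simp
  qed
qed

end

section \<open>Choice of the parameters and the union bound\<close>

context prob_space begin

text \<open>The constants: 64000000 is the square of 8000 and comes from the accuracy
  \<open>1/8000 * sqrt (h i)\<close>; 16000000 = 8000 * 2000 combines the relative error 1/8000 in
  Chernoff's bound with \<open>\<sigma> = 1 / (2000 * s)\<close>; 99 = 33 * 3 contains the rounding
  of \<open>r i\<close> and the bound \<open>L \<le> 3 * \<Lambda>\<close>. With this
  \<open>\<Lambda>\<close> the tail \<open>8 * exp (- \<Lambda>)\<close> is exactly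
  \<open>\<sigma> / (2 * K\<^sup>2)\<close>.\<close>

lemma bounded_system_stable:
  fixes \<psi> :: "'i \<Rightarrow> 'a \<Rightarrow> complex" and s K \<gamma> :: real and m :: nat
  defines "\<Lambda> \<equiv> ln (32000 * s * K\<^sup>2)"
  assumes J: "finite J" "J \<noteq> {}"
    and K: "1 \<le> K" "\<And>j x. j \<in> J \<Longrightarrow> cmod (\<psi> j x) \<le> K" and \<psi>: "\<And>j. j \<in> J \<Longrightarrow> \<psi> j \<in> borel_measurable M"
    and energy: "\<And>v. expectation (\<lambda>x. (cmod (\<Sum>j\<in>J. v j * \<psi> j x))\<^sup>2) = (vec_norm J v)\<^sup>2"
    and s: "1 \<le> s" and g: "0 < \<gamma>" "\<gamma> < 1"
    and m: "16000000 * s * K\<^sup>2 * (99 * 64000000 * \<Lambda>\<^sup>2 * ln (5 * card J) + ln (6 * \<Lambda> / \<gamma>)) \<le> real m"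
  defines "P \<equiv> PiM {..<m} (\<lambda>_. M)"
  shows "\<exists>E\<in>sets P. 1 - \<gamma> \<le> measure P E \<and> (\<forall>X\<in>E. stable_matrix J m (\<lambda>l j. of_real (1 / sqrt m) * \<psi> j (X l)) s)"
proof -
  interpret I: product_prob_space "\<lambda>_. M" "{..<m}" by unfold_locales
  interpret PP: prob_space P unfolding P_def by unfold_locales
  define N where "N = card J"
  have N: "1 \<le> N" using J by (simp add: N_def Suc_leI card_gt_0_iff)
  have K2: "1 \<le> K\<^sup>2" using K(1) by simp
  then have sK: "1 \<le> s * K\<^sup>2" using s mult_mono[of 1 s 1 "K\<^sup>2"] by simp
  have Lam1: "1 \<le> \<Lambda>"
  proof -
    have "exp 1 \<le> 32000 * s * K\<^sup>2" using exp_le sK by (simp add: mult.assoc)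
    then show ?thesis unfolding \<Lambda>_def using sK by (subst ln_ge_iff) (auto simp: mult.assoc)
  qed
  have expLam: "exp \<Lambda> = 32000 * s * K\<^sup>2" unfolding \<Lambda>_def using sK by (simp add: mult.assoc)
  define \<sigma> where "\<sigma> = 1 / (2000 * s)"
  have sg: "0 < \<sigma>" using s by (simp add: \<sigma>_def)
  \<comment> \<open>Since \<open>ln 2\<close> is at least 2/3, \<open>2 * \<Lambda>\<close> levels
    give \<open>2 ^ L \<ge> exp \<Lambda>\<close>, which pushes the untreated part below the last
    level under \<open>\<sigma>\<close>.\<close>
  define L where "L = nat \<lceil>2 * \<Lambda>\<rceil>"
  have L: "2 * \<Lambda> \<le> L" "L \<le> 3 * \<Lambda>" using Lam1 unfolding L_def by linarith+
  have L1: "1 \<le> L" using L(1) Lam1 by linarith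
  define r where "r = (\<lambda>i::nat. nat \<lceil>32 * 64000000 * 2 ^ i * \<Lambda>\<rceil>)"
  have r_ge: "32 * 64000000 * 2 ^ i * \<Lambda> \<le> r i" for i unfolding r_def by linarith
  have two: "1 \<le> 2 ^ i * \<Lambda>" for i using Lam1 mult_mono[of 1 "2 ^ i" 1 \<Lambda>] by simp
  have r_le: "r i \<le> 33 * 64000000 * (2 ^ i * \<Lambda>)" for i
  proof -
    have "real (r i) \<le> 32 * 64000000 * (2 ^ i * \<Lambda>) + 1" unfolding r_def using two[of i] by (simp add: mult.assoc)
    then show ?thesis using two[of i] by linarith
  qed
  have r1: "1 \<le> r i" for i
  proof -
    have "1 \<le> real (r i)" using r_ge[of i] two[of i] by (simp add: mult.assoc)
    then show ?thesis by simp
  qed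
  define h where "h = (\<lambda>i::nat. K\<^sup>2 / 2 ^ i)"
  have h0: "0 < h i" for i using K(1) by (simp add: h_def)
  define t where "t = (\<lambda>i::nat. \<sigma> * (1 / L + 1 / 2 ^ i))"
  define W where "W = (\<lambda>i \<omega> x. level_part (h i) (cmod (maurey_average \<psi> (r i) \<omega> x)))"
  define C where "C = (\<lambda>i. PiE_dflt {..<r i} undefined (\<lambda>_. J \<times> unit_set))"
  have fC: "finite (C i)" for i unfolding C_def using J by auto
  have cC: "card (C i) = (5 * N) ^ r i" for i
    unfolding C_def using J by (subst card_PiE_dflt) (auto simp: card_cartesian_product card_unit_set N_def mult.commute)
  have W_meas [measurable]: "W i \<omega> \<in> borel_measurable M" if "\<omega> \<in> C i" for i \<omega>
  proof -
    have [measurable]: "maurey_average \<psi> (r i) \<omega> \<in> borel_measurable M"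
      using that \<psi> unfolding C_def by (rule borel_measurable_maurey_average)
    show ?thesis unfolding W_def by measurable
  qed
  define Y where "Y = real m / (16000000 * s * K\<^sup>2)"
  define Y1 where "Y1 = 99 * 64000000 * \<Lambda>\<^sup>2 * ln (5 * N)"
  define Y2 where "Y2 = ln (6 * \<Lambda> / \<gamma>)"
  have Y12: "Y1 + Y2 \<le> Y"
    unfolding Y_def Y1_def Y2_def N_def using m sK by (simp add: pos_le_divide_eq mult.commute mult.assoc mult.left_commute)
  have ln5: "0 \<le> ln (5 * N)" using N by simp
  have Y1: "0 \<le> Y1" unfolding Y1_def using ln5 by simp
  have "1 \<le> 6 * \<Lambda> / \<gamma>" using Lam1 g by (simp add: pos_le_divide_eq)
  then have Y2: "0 \<le> Y2" unfolding Y2_def by simp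
  have m0: "0 < m"
  proof (rule ccontr)
    assume "\<not> 0 < m"
    then have "Y = 0" by (simp add: Y_def)
    moreover have "0 < Y2" unfolding Y2_def using Lam1 g by (subst ln_gt_zero_iff) (auto simp: field_simps)
    ultimately show False using Y12 Y1 by linarith
  qed
  define Bad where "Bad = (\<lambda>i \<omega>. {X\<in>space P. 1/8000 * expectation (W i \<omega>) + t i
      < \<bar>(\<Sum>l<m. W i \<omega> (X l)) / real m - expectation (W i \<omega>)\<bar>})"
  have Bad_sets: "Bad i \<omega> \<in> sets P" if "\<omega> \<in> C i" for i \<omega>
  proof -
    have [measurable]: "(\<lambda>X. W i \<omega> (X l)) \<in> borel_measurable P" if "l < m" for l
      using that unfolding P_def
      by (intro measurable_compose[OF measurable_component_singleton[of l "{..<m}" "\<lambda>_. M"] W_meas[OF \<open>\<omega> \<in> C i\<close>]]) simp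
    show ?thesis unfolding Bad_def by measurable
  qed
  have Bad_measure: "measure P (Bad i \<omega>) \<le> 2 * exp (- (Y * (2 ^ i / L + 1)))" if "\<omega> \<in> C i" for i \<omega>
  proof -
    have "measure P (Bad i \<omega>) \<le> 2 * exp (- (1/8000 * m * t i / h i))"
      unfolding Bad_def P_def
    proof (rule chernoff_average)
      show "0 \<le> W i \<omega> x" "W i \<omega> x \<le> h i" for x
        unfolding W_def using level_part_nonneg level_part_le h0 by (auto simp: less_imp_le)
    qed (use that h0 m0 in auto)
    also have "1/8000 * m * t i / h i = Y * (2 ^ i / L + 1)"
    proof -
      have "t i / h i = \<sigma> / K\<^sup>2 * (2 ^ i / L + 1)" unfolding t_def h_def using K(1) L1 by (simp add: field_simps)
      moreover have "1/8000 * m * (\<sigma> / K\<^sup>2) = Y" unfolding Y_def \<sigma>_def by simp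
      ultimately show ?thesis by (metis mult.assoc times_divide_eq_right)
    qed
    finally show ?thesis .
  qed
  have level: "(\<Sum>\<omega>\<in>C i. measure P (Bad i \<omega>)) \<le> \<gamma> / L" for i
  proof -
    have "(\<Sum>\<omega>\<in>C i. measure P (Bad i \<omega>)) \<le> (\<Sum>\<omega>\<in>C i. 2 * exp (- (Y * (2 ^ i / L + 1))))"
      using Bad_measure by (intro sum_mono)
    also have "\<dots> = 2 * ((5 * N) ^ r i * exp (- (Y * (2 ^ i / L + 1))))" by (simp add: cC)
    also have "real ((5 * N) ^ r i) = exp (r i * ln (5 * N))" using N by (simp add: exp_of_nat_mult)
    \<comment> \<open>The summand \<open>2 ^ i / L\<close> of the exponent pays for the number of
      averages, and the summand 1 leaves \<open>exp (- Y2)\<close>, which is later split among the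
      levels.\<close>
    also have "exp (r i * ln (5 * N)) * exp (- (Y * (2 ^ i / L + 1))) \<le> exp (- Y2)"
    proof -
      have "r i * ln (5 * N) \<le> 33 * 64000000 * (2 ^ i * \<Lambda>) * ln (5 * N)" using r_le ln5 by (intro mult_right_mono)
      also have "\<dots> = Y1 * (2 ^ i / (3 * \<Lambda>))" unfolding Y1_def using Lam1 by (simp add: power2_eq_square)
      also have "\<dots> \<le> Y1 * (2 ^ i / L)" using L L1 Lam1 Y1 by (intro mult_left_mono divide_left_mono) auto
      also have "\<dots> \<le> Y * (2 ^ i / L)" using Y12 Y2 by (intro mult_right_mono) auto
      finally have "r i * ln (5 * N) - Y * (2 ^ i / L + 1) \<le> - Y2" using Y12 Y1 by (simp add: distrib_left)
      then show ?thesis by (simp add: exp_add[symmetric])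
    qed
    also have "2 * exp (- Y2) = \<gamma> / (3 * \<Lambda>)"
      unfolding Y2_def using Lam1 g by (simp add: exp_minus field_simps)
    also have "\<dots> \<le> \<gamma> / L" using L L1 Lam1 g by (intro divide_left_mono) auto
    finally show ?thesis by simp
  qed
  define B where "B = (\<Union>i<L. \<Union>\<omega>\<in>C i. Bad i \<omega>)"
  have B_sets: "B \<in> sets P" unfolding B_def using fC Bad_sets by (intro sets.finite_UN) auto
  have "measure P B \<le> (\<Sum>i<L. measure P (\<Union>\<omega>\<in>C i. Bad i \<omega>))"
    unfolding B_def using fC Bad_sets by (intro measure_UNION_le sets.finite_UN) auto
  also have "\<dots> \<le> (\<Sum>i<L. \<Sum>\<omega>\<in>C i. measure P (Bad i \<omega>))"
    using fC Bad_sets by (intro sum_mono measure_UNION_le) auto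
  also have "\<dots> \<le> (\<Sum>i<L. \<gamma> / L)" using level by (intro sum_mono)
  also have "\<dots> = \<gamma>" using L1 by simp
  finally have B_measure: "measure P B \<le> \<gamma>" .
  show ?thesis
  proof (intro bexI conjI ballI)
    show "space P - B \<in> sets P" using B_sets by auto
    show "1 - \<gamma> \<le> measure P (space P - B)" using PP.prob_compl[OF B_sets] B_measure by simp
    fix X assume X: "X \<in> space P - B"
    show "stable_matrix J m (\<lambda>l j. of_real (1 / sqrt m) * \<psi> j (X l)) s"
    proof (rule stable_of_levels[where L = L and r = r and t = t and dflt = undefined and K = K, OF J _ K(2) \<psi> energy m0])
      show "0 < K" "0 < s" using K s by auto
      show "1 \<le> r i" for i by (rule r1)
      show "K\<^sup>2 / 2 ^ L \<le> 1 / (2000 * s)"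
      proof -
        have "exp \<Lambda> \<le> 2 ^ L"
        proof -
          have "\<Lambda> \<le> ln 2 * (2 * \<Lambda>)" using ln2_ge_two_thirds Lam1 by (simp add: mult_left_le_one_le)
          also have "\<dots> \<le> ln 2 * L" using L by (intro mult_left_mono) auto
          finally have "exp \<Lambda> \<le> exp (ln 2 * L)" by simp
          then show ?thesis by (simp add: exp_of_nat2_mult)
        qed
        then have "32000 * (s * K\<^sup>2) \<le> 2 ^ L" unfolding expLam by (simp add: mult.assoc)
        then have "2000 * (s * K\<^sup>2) \<le> 2 ^ L" using sK by linarith
        then show ?thesis using s by (simp add: field_simps)
      qed
      show "8 * exp (- (r i * (1/8000 * sqrt (K\<^sup>2 / 2 ^ i))\<^sup>2 / (32 * K\<^sup>2))) \<le> 1 / (2000 * s) / (2 * K\<^sup>2)" for i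
      proof -
        have "(1/8000 * sqrt (K\<^sup>2 / 2 ^ i))\<^sup>2 = K\<^sup>2 / (64000000 * 2 ^ i)" by (simp add: power_mult_distrib power_divide)
        then have "r i * (1/8000 * sqrt (K\<^sup>2 / 2 ^ i))\<^sup>2 / (32 * K\<^sup>2) = r i / (32 * 64000000 * 2 ^ i)"
          using K(1) by simp
        moreover have "\<Lambda> \<le> r i / (32 * 64000000 * 2 ^ i)" using r_ge[of i] by (simp add: field_simps)
        ultimately have "exp (- (r i * (1/8000 * sqrt (K\<^sup>2 / 2 ^ i))\<^sup>2 / (32 * K\<^sup>2))) \<le> exp (- \<Lambda>)" by simp
        also have "\<dots> = 1 / (32000 * s * K\<^sup>2)" unfolding exp_minus expLam by (simp add: inverse_eq_divide)
        finally show ?thesis by simp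
      qed
      show "(\<Sum>i<L. t i) \<le> 3 * (1 / (2000 * s))"
      proof -
        have "(\<Sum>i<L. t i) = \<sigma> * (1 + (\<Sum>i<L. (1/2) ^ i))"
          unfolding t_def sum_distrib_left[symmetric] sum.distrib using L1 by (simp add: power_one_over)
        also have "\<dots> \<le> \<sigma> * (1 + 2)"
        proof (intro mult_left_mono add_left_mono)
          show "(\<Sum>i<L. (1/2 :: real) ^ i) \<le> 2" by (subst sum_gp_strict) auto
        qed (use sg in simp)
        finally show ?thesis by (simp add: \<sigma>_def)
      qed
      fix i \<omega> assume "i < L" "\<omega> \<in> PiE_dflt {..<r i} undefined (\<lambda>_. J \<times> unit_set)"
      then have "X \<notin> Bad i \<omega>" using X by (auto simp: B_def C_def)
      then show "\<bar>(\<Sum>l<m. level_part (K\<^sup>2 / 2 ^ i) (cmod (maurey_average \<psi> (r i) \<omega> (X l)))) / real m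
            - expectation (\<lambda>x. level_part (K\<^sup>2 / 2 ^ i) (cmod (maurey_average \<psi> (r i) \<omega> x)))\<bar>
          \<le> 1/8000 * expectation (\<lambda>x. level_part (K\<^sup>2 / 2 ^ i) (cmod (maurey_average \<psi> (r i) \<omega> x))) + t i"
        using X unfolding Bad_def W_def h_def by auto
    qed
  qed
qed

end

section \<open>Weighted orthonormal systems and the Wiener space\<close>

lemma L2_norm_power2: "(L2_norm M g)\<^sup>2 = (\<integral>\<^sup>+x. (g x)\<^sup>2 \<partial>M)"
proof (cases "(\<integral>\<^sup>+x. (g x)\<^sup>2 \<partial>M) = \<infinity>")
  case True then show ?thesis by (simp add: L2_norm_def)
next
  case False
  then obtain s where s: "0 \<le> s" "(\<integral>\<^sup>+x. (g x)\<^sup>2 \<partial>M) = ennreal s"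
    by (cases "\<integral>\<^sup>+x. (g x)\<^sup>2 \<partial>M") auto
  then show ?thesis by (simp add: L2_norm_def ennreal_power)
qed

lemma L2_norm_le:
  assumes "(\<integral>\<^sup>+x. (g x)\<^sup>2 \<partial>M) \<le> ennreal (c\<^sup>2)" "0 \<le> c" shows "L2_norm M g \<le> ennreal c"
proof -
  obtain s where s: "0 \<le> s" "(\<integral>\<^sup>+x. (g x)\<^sup>2 \<partial>M) = ennreal s"
    using assms(1) by (cases "\<integral>\<^sup>+x. (g x)\<^sup>2 \<partial>M") (auto simp: top_unique)
  then have "s \<le> c\<^sup>2" using assms(1) by (simp add: ennreal_le_iff)
  then have "sqrt s \<le> c" using assms(2) by (intro real_le_lsqrt)
  then show ?thesis using s by (simp add: L2_norm_def ennreal_le_iff assms(2))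
qed

lemma square_integrable_iff:
  "square_integrable M f \<longleftrightarrow> f \<in> borel_measurable M \<and> integrable M (\<lambda>x. (cmod (f x))\<^sup>2)"
proof -
  have "L2_norm M (\<lambda>x. ennreal (cmod (f x))) < \<infinity> \<longleftrightarrow> (\<integral>\<^sup>+x. ennreal ((cmod (f x))\<^sup>2) \<partial>M) < \<infinity>"
    unfolding L2_norm_def by (auto simp: ennreal_power Let_def less_top)
  then show ?thesis unfolding square_integrable_def integrable_iff_bounded by auto
qed

lemma borel_measurable_cnj [measurable]: "cnj \<in> borel_measurable borel"
  by (intro borel_measurable_continuous_onI continuous_intros)

lemma square_integrable_mult_cnj:
  assumes "square_integrable M f" "square_integrable M g"
  shows "integrable M (\<lambda>x. f x * cnj (g x))"
proof (rule Bochner_Integration.integrable_bound[where f = "\<lambda>x. (cmod (f x))\<^sup>2 + (cmod (g x))\<^sup>2"])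
  have [measurable]: "f \<in> borel_measurable M" "g \<in> borel_measurable M"
    using assms by (auto simp: square_integrable_iff)
  show "(\<lambda>x. f x * cnj (g x)) \<in> borel_measurable M" by measurable
  have "cmod (f x * cnj (g x)) \<le> (cmod (f x))\<^sup>2 + (cmod (g x))\<^sup>2" for x
  proof -
    have "0 \<le> cmod (f x) * cmod (g x)" by simp
    then show ?thesis using sum_squares_bound[of "cmod (f x)" "cmod (g x)"]
      unfolding norm_mult complex_mod_cnj mult.assoc by linarith
  qed
  then show "AE x in M. norm (f x * cnj (g x)) \<le> norm ((cmod (f x))\<^sup>2 + (cmod (g x))\<^sup>2)" by simp
qed (use assms in \<open>simp add: square_integrable_iff\<close>)

lemma square_integrable_add:
  assumes "square_integrable M f" "square_integrable M g"
  shows "square_integrable M (\<lambda>x. f x + g x)"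
proof -
  have [measurable]: "f \<in> borel_measurable M" "g \<in> borel_measurable M"
    using assms by (auto simp: square_integrable_iff)
  have "(cmod (z + w))\<^sup>2 \<le> 2 * (cmod z)\<^sup>2 + 2 * (cmod w)\<^sup>2" for z w :: complex
  proof -
    have "(cmod (z + w))\<^sup>2 \<le> (cmod z + cmod w)\<^sup>2" by (intro power_mono norm_triangle_ineq) auto
    also have "\<dots> \<le> 2 * (cmod z)\<^sup>2 + 2 * (cmod w)\<^sup>2"
      using zero_le_power2[of "cmod z - cmod w"] by (simp add: power2_eq_square algebra_simps)
    finally show ?thesis .
  qed
  then have "integrable M (\<lambda>x. (cmod (f x + g x))\<^sup>2)"
    using assms
    by - (rule Bochner_Integration.integrable_bound[where f = "\<lambda>x. 2 * (cmod (f x))\<^sup>2 + 2 * (cmod (g x))\<^sup>2"],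
       auto simp: square_integrable_iff)
  then show ?thesis by (simp add: square_integrable_iff)
qed

lemma square_integrable_cmult: "square_integrable M f \<Longrightarrow> square_integrable M (\<lambda>x. c * f x)"
  by (auto simp: square_integrable_iff norm_mult power_mult_distrib)

lemma square_integrable_zero: "square_integrable M (\<lambda>x. 0)"
  by (simp add: square_integrable_iff)

lemma square_integrable_sum:
  assumes "\<And>j. j \<in> F \<Longrightarrow> square_integrable M (b j)"
  shows "square_integrable M (\<lambda>x. \<Sum>j\<in>F. c j * b j x)"
  using assms
proof (induction F rule: infinite_finite_induct)
  case (insert j F)
  then have "square_integrable M (\<lambda>x. c j * b j x + (\<Sum>j\<in>F. c j * b j x))"
    by (intro square_integrable_add square_integrable_cmult) auto
  then show ?case using insert by simp
qed (auto simp: square_integrable_zero)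

lemma square_integrable_diff_sum:
  assumes "square_integrable M f" "\<And>j. j \<in> F \<Longrightarrow> square_integrable M (b j)"
  shows "square_integrable M (\<lambda>x. f x - (\<Sum>j\<in>F. c j * b j x))"
  using square_integrable_add[OF assms(1) square_integrable_cmult[OF square_integrable_sum[of F M b c], of "-1"]] assms(2)
  by simp

locale weighted_system = prob_space M for M :: "'a measure" +
  fixes I :: "'i set" and b :: "'i \<Rightarrow> 'a \<Rightarrow> complex"
  assumes countable_I: "countable I" and I_nonempty: "I \<noteq> {}"
    and orthonormal: "orthonormal_system M I b"
    and phi_star_L2: "L2_norm M (phi_star I b) < \<infinity>"
begin

lemma b_square_integrable: "j \<in> I \<Longrightarrow> square_integrable M (b j)"
  using orthonormal by (simp add: orthonormal_system_def)

lemma b_measurable [measurable]: "j \<in> I \<Longrightarrow> b j \<in> borel_measurable M"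
  using b_square_integrable by (simp add: square_integrable_iff)

lemma b_inner: "i \<in> I \<Longrightarrow> j \<in> I \<Longrightarrow> (LINT x|M. b i x * cnj (b j x)) = (if i = j then 1 else 0)"
  using orthonormal by (simp add: orthonormal_system_def L2_inner_def)

lemma coeff_diff_sum:
  assumes f: "square_integrable M f" and F: "finite F" "F \<subseteq> I" and j: "j \<in> I"
  shows "coeff M b (\<lambda>x. f x - (\<Sum>i\<in>F. c i * b i x)) j = coeff M b f j - (if j \<in> F then c j else 0)"
proof -
  have "(LINT x|M. (f x - (\<Sum>i\<in>F. c i * b i x)) * cnj (b j x))
     = (LINT x|M. f x * cnj (b j x) - (\<Sum>i\<in>F. c i * (b i x * cnj (b j x))))"
    by (simp add: algebra_simps sum_distrib_left)
  also have "\<dots> = (LINT x|M. f x * cnj (b j x)) - (\<Sum>i\<in>F. c i * (LINT x|M. b i x * cnj (b j x)))"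
    using F j f b_square_integrable square_integrable_mult_cnj[of M _ "b j"]
    by (subst Bochner_Integration.integral_diff) (auto simp: subset_iff)
  also have "(\<Sum>i\<in>F. c i * (LINT x|M. b i x * cnj (b j x))) = (\<Sum>i\<in>F. if i = j then c j else 0)"
    using F j by (intro sum.cong) (auto simp: b_inner subset_iff)
  also have "\<dots> = (if j \<in> F then c j else 0)" using F by simp
  finally show ?thesis by (simp add: coeff_def L2_inner_def)
qed

lemma coeff_sum:
  assumes "finite F" "F \<subseteq> I" "j \<in> I"
  shows "coeff M b (\<lambda>x. \<Sum>i\<in>F. c i * b i x) j = (if j \<in> F then c j else 0)"
  using coeff_diff_sum[OF square_integrable_zero assms, of "\<lambda>i. - c i"]
  by (simp add: sum_negf) (simp add: coeff_def L2_inner_def)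

lemma inner_sum:
  assumes f: "square_integrable M f" and F: "finite F" "F \<subseteq> I"
  shows "(LINT x|M. f x * cnj (\<Sum>i\<in>F. c i * b i x)) = (\<Sum>i\<in>F. cnj (c i) * coeff M b f i)"
proof -
  have "(LINT x|M. f x * cnj (\<Sum>i\<in>F. c i * b i x)) = (LINT x|M. (\<Sum>i\<in>F. cnj (c i) * (f x * cnj (b i x))))"
    by (simp add: sum_distrib_left mult_ac)
  also have "\<dots> = (\<Sum>i\<in>F. cnj (c i) * (LINT x|M. f x * cnj (b i x)))"
    using F f b_square_integrable square_integrable_mult_cnj[of M f] by (auto simp: subset_iff)
  finally show ?thesis by (simp add: coeff_def L2_inner_def)
qed

lemma integral_norm_sum_power2:
  assumes F: "finite F" "F \<subseteq> I"
  shows "(LINT x|M. (cmod (\<Sum>i\<in>F. c i * b i x))\<^sup>2) = (\<Sum>i\<in>F. (cmod (c i))\<^sup>2)"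
proof -
  let ?h = "\<lambda>x. \<Sum>i\<in>F. c i * b i x"
  have h: "square_integrable M ?h" using F b_square_integrable by (intro square_integrable_sum) auto
  have "complex_of_real (LINT x|M. (cmod (?h x))\<^sup>2) = (LINT x|M. complex_of_real ((cmod (?h x))\<^sup>2))"
    by (rule integral_complex_of_real[symmetric])
  also have "\<dots> = (LINT x|M. ?h x * cnj (?h x))" by (simp only: complex_norm_square)
  also have "\<dots> = (\<Sum>i\<in>F. cnj (c i) * coeff M b ?h i)" by (rule inner_sum[OF h F])
  also have "\<dots> = (\<Sum>i\<in>F. complex_of_real ((cmod (c i))\<^sup>2))"
    using F by (intro sum.cong) (auto simp: coeff_sum subset_iff complex_norm_square mult.commute simp del: of_real_power)
  finally show ?thesis by (simp only: of_real_sum[symmetric] of_real_eq_iff)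
qed

lemma bessel:
  assumes f: "square_integrable M f" and F: "finite F" "F \<subseteq> I"
  shows "(\<Sum>i\<in>F. (cmod (coeff M b f i))\<^sup>2) \<le> (LINT x|M. (cmod (f x))\<^sup>2)"
proof -
  let ?h = "\<lambda>x. \<Sum>i\<in>F. coeff M b f i * b i x"
  let ?s = "\<Sum>i\<in>F. (cmod (coeff M b f i))\<^sup>2"
  have h: "square_integrable M ?h" using F b_square_integrable by (intro square_integrable_sum) auto
  have fh: "integrable M (\<lambda>x. f x * cnj (?h x))" by (rule square_integrable_mult_cnj[OF f h])
  have "(LINT x|M. f x * cnj (?h x)) = (\<Sum>i\<in>F. complex_of_real ((cmod (coeff M b f i))\<^sup>2))"
    unfolding inner_sum[OF f F] by (intro sum.cong) (auto simp: complex_norm_square mult.commute simp del: of_real_power)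
  then have s: "(LINT x|M. Re (f x * cnj (?h x))) = ?s"
    using integral_Re[OF fh] by (simp del: of_real_power)
  define u where "u = (\<lambda>x. Re (f x * cnj (?h x)))"
  have u: "integrable M u" unfolding u_def by (rule integrable_Re[OF fh])
  have "0 \<le> (LINT x|M. (cmod (f x - ?h x))\<^sup>2)" by (rule Bochner_Integration.integral_nonneg) simp
  also have "\<dots> = (LINT x|M. (cmod (f x))\<^sup>2 + (cmod (?h x))\<^sup>2 - 2 * u x)"
  proof (rule Bochner_Integration.integral_cong)
    have "(cmod (z - w))\<^sup>2 = (cmod z)\<^sup>2 + (cmod w)\<^sup>2 - 2 * Re (z * cnj w)" for z w
      unfolding cmod_power2 by (simp add: power2_eq_square algebra_simps)
    then show "(cmod (f x - ?h x))\<^sup>2 = (cmod (f x))\<^sup>2 + (cmod (?h x))\<^sup>2 - 2 * u x" for x unfolding u_def by blast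
  qed simp
  also have "\<dots> = (LINT x|M. (cmod (f x))\<^sup>2) + (LINT x|M. (cmod (?h x))\<^sup>2) - 2 * (LINT x|M. u x)"
    using f h u unfolding square_integrable_iff by simp
  also have "(LINT x|M. u x) = ?s" unfolding u_def by (rule s)
  finally show ?thesis unfolding integral_norm_sum_power2[OF F] by simp
qed

abbreviation K where "K \<equiv> B_tilde M I b"

abbreviation weight :: "'a \<Rightarrow> real" where "weight x \<equiv> enn2real (phi M I b x)"

lemma phi_star_measurable [measurable]: "phi_star I b \<in> borel_measurable M"
  unfolding phi_star_def using countable_I by measurable

lemma b_le_phi_star: "j \<in> I \<Longrightarrow> ennreal (cmod (b j x)) \<le> phi_star I b x"
  unfolding phi_star_def by (rule SUP_upper)

lemma L2_norm_phi_star: "L2_norm M (phi_star I b) = ennreal K"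
  using phi_star_L2 by (simp add: B_tilde_def)

lemma nn_integral_phi_star: "(\<integral>\<^sup>+x. (phi_star I b x)\<^sup>2 \<partial>M) = ennreal (K\<^sup>2)"
  unfolding L2_norm_power2[symmetric] L2_norm_phi_star
  by (simp add: ennreal_power B_tilde_def)

lemma K_ge_1: "1 \<le> K"
proof -
  obtain j where j: "j \<in> I" using I_nonempty by blast
  have "(LINT x|M. (cmod (b j x))\<^sup>2) = 1"
    using integral_norm_sum_power2[of "{j}" "\<lambda>_. 1"] j by simp
  then have "1 = (\<integral>\<^sup>+x. ennreal ((cmod (b j x))\<^sup>2) \<partial>M)"
    using b_square_integrable[OF j] by (subst nn_integral_eq_integral) (auto simp: square_integrable_iff)
  also have "\<dots> \<le> (\<integral>\<^sup>+x. (phi_star I b x)\<^sup>2 \<partial>M)"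
    by (intro nn_integral_mono) (simp add: ennreal_power[symmetric] power_mono b_le_phi_star[OF j])
  finally have "1 \<le> K\<^sup>2" unfolding nn_integral_phi_star by (simp add: ennreal_le_iff flip: ennreal_1)
  moreover have "0 \<le> K" by (simp add: B_tilde_def)
  ultimately show ?thesis by (metis abs_of_nonneg one_power2 power2_le_iff_abs_le real_le_rsqrt real_sqrt_abs zero_le_one)
qed

lemma phi_eq: "phi M I b x = phi_star I b x / ennreal K"
  by (simp add: phi_def L2_norm_phi_star)

lemma phi_measurable [measurable]: "phi M I b \<in> borel_measurable M"
  unfolding phi_eq[abs_def] by measurable

lemma weight_eq: "phi_star I b x < \<infinity> \<Longrightarrow> weight x = enn2real (phi_star I b x) / K"
  unfolding phi_eq using K_ge_1 by (cases "phi_star I b x") (auto simp: divide_ennreal)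

lemma norm_b_le: "j \<in> I \<Longrightarrow> phi_star I b x < \<infinity> \<Longrightarrow> cmod (b j x) \<le> K * weight x"
  using b_le_phi_star[of j x] K_ge_1 by (cases "phi_star I b x") (auto simp: weight_eq ennreal_le_iff)

text \<open>A bound at every point, as \<open>bounded_system_stable\<close> demands. Where
  \<open>phi_star\<close> is infinite, \<open>enn2real\<close> sets the weight to 0, and division by
  0 gives 0.\<close>

lemma norm_b_div_weight_le:
  assumes "j \<in> I" shows "cmod (b j x / of_real (weight x)) \<le> K"
proof (cases "phi_star I b x < \<infinity> \<and> weight x \<noteq> 0")
  case True
  then have "0 < weight x" by (simp add: less_le)
  then show ?thesis using norm_b_le[OF assms, of x] True by (simp add: norm_divide pos_divide_le_eq)
next
  case False
  then have "weight x = 0"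
    using K_ge_1 by (auto simp: phi_eq not_less top_unique ennreal_top_divide)
  then show ?thesis using K_ge_1 by simp
qed

lemma phi_star_finite_AE: "AE x in M. phi_star I b x < \<infinity>"
proof -
  have "AE x in M. (phi_star I b x)\<^sup>2 \<noteq> \<infinity>"
    by (rule nn_integral_PInf_AE) (use nn_integral_phi_star in auto)
  then show ?thesis
  proof (rule eventually_mono)
    fix x assume "(phi_star I b x)\<^sup>2 \<noteq> \<infinity>"
    then show "phi_star I b x < \<infinity>"
      by (cases "phi_star I b x = \<top>") (auto simp: less_top power2_eq_square ennreal_mult_top)
  qed
qed

abbreviation nu :: "'a measure" where "nu \<equiv> density M (\<lambda>x. (phi M I b x)\<^sup>2)"

text \<open>\<open>weight\<close> loses information only where \<open>phi\<close> is infinite, and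
  this is a null set. A real density gives access to \<open>integral_density\<close>.\<close>

lemma nu_eq: "nu = density M (\<lambda>x. ennreal ((weight x)\<^sup>2))"
proof (rule density_cong)
  show "AE x in M. (phi M I b x)\<^sup>2 = ennreal ((weight x)\<^sup>2)"
    using phi_star_finite_AE
  proof (rule eventually_mono)
    fix x assume "phi_star I b x < \<infinity>"
    then have "phi M I b x < \<infinity>" unfolding phi_eq using K_ge_1
      by (cases "phi_star I b x") (auto simp: divide_ennreal)
    then have "phi M I b x = ennreal (weight x)" by simp
    then show "(phi M I b x)\<^sup>2 = ennreal ((weight x)\<^sup>2)" by (metis enn2real_nonneg ennreal_power)
  qed
qed measurable

lemma nn_integral_phi: "(\<integral>\<^sup>+x. (phi M I b x)\<^sup>2 \<partial>M) = 1"
proof -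
  have "(\<integral>\<^sup>+x. (phi M I b x)\<^sup>2 \<partial>M) = (\<integral>\<^sup>+x. (phi_star I b x)\<^sup>2 / ennreal (K\<^sup>2) \<partial>M)"
    unfolding phi_eq using K_ge_1
    by (intro nn_integral_cong) (simp add: divide_ennreal_def power_mult_distrib ennreal_power inverse_ennreal power_inverse)
  also have "\<dots> = ennreal (K\<^sup>2) / ennreal (K\<^sup>2)"
    by (subst nn_integral_divide) (auto simp: nn_integral_phi_star)
  also have "\<dots> = 1" using K_ge_1 by (subst divide_ennreal) auto
  finally show ?thesis .
qed

lemma prob_space_nu: "prob_space nu"
  by (rule prob_spaceI) (simp add: emeasure_density nn_integral_phi cong: nn_integral_cong)

text \<open>The density vanishes where the weight does, so such points are almost surely not
  drawn.\<close>

lemma AE_nu: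
  assumes "AE x in M. P x"
  shows "AE x in nu. P x \<and> phi_star I b x < \<infinity> \<and> 0 < weight x"
  unfolding nu_eq
proof (subst AE_density)
  show "AE x in M. 0 < ennreal ((weight x)\<^sup>2) \<longrightarrow> P x \<and> phi_star I b x < \<infinity> \<and> 0 < weight x"
    using assms phi_star_finite_AE by eventually_elim (auto simp: less_le)
qed measurable

lemma energy_nu:
  assumes J: "finite J" "J \<subseteq> I"
  shows "(LINT x|nu. (cmod (\<Sum>j\<in>J. v j * (b j x / of_real (weight x))))\<^sup>2) = (vec_norm J v)\<^sup>2"
proof -
  have [measurable]: "(\<lambda>x. \<Sum>j\<in>J. v j * (b j x / of_real (weight x))) \<in> borel_measurable M"
    using J by (intro borel_measurable_sum) (auto simp: subset_iff)
  have [measurable]: "(\<lambda>x. \<Sum>j\<in>J. v j * b j x) \<in> borel_measurable M"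
    using J by (intro borel_measurable_sum) (auto simp: subset_iff)
  have "(LINT x|nu. (cmod (\<Sum>j\<in>J. v j * (b j x / of_real (weight x))))\<^sup>2)
      = (LINT x|M. (weight x)\<^sup>2 *\<^sub>R (cmod (\<Sum>j\<in>J. v j * (b j x / of_real (weight x))))\<^sup>2)"
    unfolding nu_eq by (rule integral_density; (measurable | simp))
  also have "\<dots> = (LINT x|M. (cmod (\<Sum>j\<in>J. v j * b j x))\<^sup>2)"
  proof (rule integral_cong_AE)
    show "AE x in M. (weight x)\<^sup>2 *\<^sub>R (cmod (\<Sum>j\<in>J. v j * (b j x / of_real (weight x))))\<^sup>2 = (cmod (\<Sum>j\<in>J. v j * b j x))\<^sup>2"
      using phi_star_finite_AE
    proof (rule eventually_mono)
      fix x assume fin: "phi_star I b x < \<infinity>"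
      \<comment> \<open>If the weight is 0 while \<open>phi_star\<close> is finite, all
        \<open>b j x\<close> vanish, so the cancellation survives division by zero.\<close>
      have "of_real (weight x) * (b j x / of_real (weight x)) = b j x" if "j \<in> J" for j
        using norm_b_le[of j x] fin that J(2) by (cases "weight x = 0") auto
      then have "(\<Sum>j\<in>J. v j * b j x) = of_real (weight x) * (\<Sum>j\<in>J. v j * (b j x / of_real (weight x)))"
        unfolding sum_distrib_left by (intro sum.cong) (auto simp: mult.left_commute)
      then show "(weight x)\<^sup>2 *\<^sub>R (cmod (\<Sum>j\<in>J. v j * (b j x / of_real (weight x))))\<^sup>2 = (cmod (\<Sum>j\<in>J. v j * b j x))\<^sup>2"
        by (simp add: norm_mult power_mult_distrib)
    qed
  qed measurable
  also have "\<dots> = (vec_norm J v)\<^sup>2" unfolding vec_norm_power2 by (rule integral_norm_sum_power2[OF J])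
  finally show ?thesis .
qed

end

section \<open>Values of the series at the sample points and the essential supremum\<close>

lemma sum_le_infsum_ennreal:
  fixes f :: "'i \<Rightarrow> ennreal"
  assumes "finite F" "F \<subseteq> A" shows "sum f F \<le> infsum f A"
  by (subst nonneg_infsum_complete) (use assms in \<open>auto intro!: SUP_upper2[of F]\<close>)

lemma has_sum_norm_diff_le:
  fixes f :: "'i \<Rightarrow> 'b :: real_normed_vector"
  assumes f: "(f has_sum s) A" and F: "finite F" "F \<subseteq> A"
    and B: "\<And>Y. finite Y \<Longrightarrow> F \<subseteq> Y \<Longrightarrow> Y \<subseteq> A \<Longrightarrow> norm (sum f Y - z) \<le> B"
  shows "norm (s - z) \<le> B"
proof (rule tendsto_upperbound)
  show "((\<lambda>Y. norm (sum f Y - z)) \<longlongrightarrow> norm (s - z)) (finite_subsets_at_top A)"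
    using f unfolding has_sum_def by (intro tendsto_intros)
  show "\<forall>\<^sub>F Y in finite_subsets_at_top A. norm (sum f Y - z) \<le> B"
    unfolding eventually_finite_subsets_at_top using F B by blast
qed simp

lemma finite_tail_small:
  fixes a :: "'i \<Rightarrow> real"
  assumes a: "\<And>j. j \<in> A \<Longrightarrow> 0 \<le> a j" and B: "\<And>F. finite F \<Longrightarrow> F \<subseteq> A \<Longrightarrow> sum a F \<le> B" and e: "0 < e"
  obtains F where "finite F" "F \<subseteq> A" "\<And>F'. finite F' \<Longrightarrow> F' \<subseteq> A - F \<Longrightarrow> sum a F' \<le> e"
proof -
  define S where "S = sum a ` {F. finite F \<and> F \<subseteq> A}"
  have S: "bdd_above S" "S \<noteq> {}" unfolding S_def using B by (auto intro!: bdd_aboveI2)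
  then obtain F where F: "finite F" "F \<subseteq> A" "Sup S - e < sum a F"
    using less_cSupD[of S "Sup S - e"] e unfolding S_def by auto
  show ?thesis
  proof (rule that[OF F(1,2)])
    fix F' assume F': "finite F'" "F' \<subseteq> A - F"
    have "sum a (F \<union> F') \<le> Sup S" using F F' S by (intro cSup_upper) (auto simp: S_def)
    moreover have "sum a (F \<union> F') = sum a F + sum a F'" using F F' by (intro sum.union_disjoint) auto
    ultimately show "sum a F' \<le> e" using F(3) by linarith
  qed
qed

context weighted_system begin

text \<open>
  The exceptional null set does not depend on the function: on \<open>{\<phi>\<^sup>* \<le> R}\<close> the
  series depends continuously, in the supremum norm, on its coefficient sequence in \<open>\<ell>\<^sub>1\<close>,
  and finitely supported sequences with values in a countable dense set are dense in \<open>\<ell>\<^sub>1\<close>.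
\<close>

lemma AE_le_Linf_norm:
  "AE x in M. \<forall>c B g. (\<forall>F. finite F \<and> F \<subseteq> I \<longrightarrow> (\<Sum>j\<in>F. cmod (c j)) \<le> B) \<and> g \<in> borel_measurable M \<and>
     (\<forall>y\<in>space M. phi_star I b y < \<infinity> \<longrightarrow> ((\<lambda>j. c j * b j y) has_sum g y) I)
     \<longrightarrow> ennreal (cmod (g x)) \<le> Linf_norm M g"
proof -
  obtain Q :: "complex set" where Q: "countable Q" "\<And>X. open X \<Longrightarrow> X \<noteq> {} \<Longrightarrow> \<exists>d\<in>Q. d \<in> X"
    using countable_dense_setE by blast
  define D where "D = (SIGMA F:{F. finite F \<and> F \<subseteq> I}. PiE F (\<lambda>_. Q))"
  have D: "countable D" unfolding D_def
  proof (rule countable_SIGMA)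
    show "countable {F. finite F \<and> F \<subseteq> I}" by (rule countable_Collect_finite_subset[OF countable_I])
    show "countable (PiE F (\<lambda>_. Q))" if "F \<in> {F. finite F \<and> F \<subseteq> I}" for F
      using that Q(1) by (intro countable_PiE) auto
  qed
  define G where "G = (\<lambda>p y. \<Sum>j\<in>fst p. snd p j * b j y)"
  \<comment> \<open>The cut-off at \<open>R\<close> makes \<open>l1\<close> closeness of
    coefficients a uniform closeness of functions; countably many \<open>p\<close> and
    \<open>R\<close> contribute a single null set.\<close>
  define T where "T = (\<lambda>(R::nat) p y. if phi_star I b y \<le> of_nat R then ennreal (cmod (G p y)) else 0)"
  have T_meas: "T R p \<in> borel_measurable M" if "p \<in> D" for R p
  proof -
    have [measurable]: "G p \<in> borel_measurable M"
      unfolding G_def using that b_measurable unfolding D_def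
      by (intro borel_measurable_sum borel_measurable_times borel_measurable_const) auto
    show ?thesis unfolding T_def by measurable
  qed
  have "AE x in M. \<forall>p\<in>D. \<forall>R. T R p x \<le> esssup M (T R p)"
    using D by (intro AE_ball_countable' AE_all_countable[THEN iffD2] allI esssup_AE)
  then show ?thesis
    using phi_star_finite_AE AE_space
  proof eventually_elim
    case (elim x)
    have T: "T R p x \<le> esssup M (T R p)" if "p \<in> D" for R p using elim that by blast
    show ?case
    proof (intro allI impI, elim conjE)
      fix c :: "'i \<Rightarrow> complex" and B :: real and g
      assume cB: "\<forall>F. finite F \<and> F \<subseteq> I \<longrightarrow> (\<Sum>j\<in>F. cmod (c j)) \<le> B" and g: "g \<in> borel_measurable M"
        and sum: "\<forall>y\<in>space M. phi_star I b y < \<infinity> \<longrightarrow> ((\<lambda>j. c j * b j y) has_sum g y) I"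
      show "ennreal (cmod (g x)) \<le> Linf_norm M g"
      proof (cases "Linf_norm M g")
        case (real a)
        obtain p where p: "phi_star I b x = ennreal p" "0 \<le> p"
          using elim(2) by (cases "phi_star I b x") auto
        obtain R :: nat where R: "p \<le> real R" "1 \<le> R"
          using real_arch_simple[of "max p 1"] by auto
        have Rx: "phi_star I b x \<le> of_nat R" using R p by (simp add: ennreal_of_nat_eq_real_of_nat ennreal_leI)
        have "cmod (g x) \<le> a"
        proof (rule field_le_epsilon)
          fix e :: real assume e: "0 < e"
          \<comment> \<open>Two errors of size \<open>d\<close>, one from rounding the coefficients
            in \<open>F\<close> and one from the tail off \<open>F\<close>, are multiplied by
            \<open>R\<close> and add up to \<open>e / 2\<close>.\<close>
          define d where "d = e / (4 * real R)"
          have d: "0 < d" using e R by (simp add: d_def)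
          obtain F where F: "finite F" "F \<subseteq> I" "\<And>F'. finite F' \<Longrightarrow> F' \<subseteq> I - F \<Longrightarrow> (\<Sum>j\<in>F'. cmod (c j)) \<le> d"
            using finite_tail_small[of I "\<lambda>j. cmod (c j)" B d] cB d by auto
          have "\<exists>q\<in>Q. cmod (c j - q) < d / (real (card F) + 1)" for j
          proof -
            have "0 < d / (real (card F) + 1)" using d by (intro divide_pos_pos) auto
            then show ?thesis using Q(2)[of "ball (c j) (d / (real (card F) + 1))"] by (auto simp: dist_norm)
          qed
          then obtain q where q: "\<And>j. q j \<in> Q" "\<And>j. cmod (c j - q j) < d / (real (card F) + 1)" by metis
          define P where "P = (F, restrict q F)"
          have P: "P \<in> D" using F q by (auto simp: P_def D_def)
          have qF: "(\<Sum>j\<in>F. cmod (c j - q j)) \<le> d"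
          proof -
            have "(\<Sum>j\<in>F. cmod (c j - q j)) \<le> (\<Sum>j\<in>F. d / (real (card F) + 1))"
              using q(2) by (intro sum_mono less_imp_le)
            also have "\<dots> = d * (real (card F) / (real (card F) + 1))" by simp
            also have "\<dots> \<le> d * 1" using d by (intro mult_left_mono) auto
            finally show ?thesis by simp
          qed
          have near: "cmod (g y - G P y) \<le> real R * (2 * d)" if y: "y \<in> space M" "phi_star I b y \<le> of_nat R" for y
          proof (rule has_sum_norm_diff_le[where f = "\<lambda>j. c j * b j y" and A = I and F = F])
            have "phi_star I b y < \<infinity>" using y(2) by (rule order_le_less_trans) (simp add: of_nat_less_top)
            then show "((\<lambda>j. c j * b j y) has_sum g y) I" using sum y(1) by blast
            have by': "cmod (b j y) \<le> real R" if "j \<in> I" for j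
            proof -
              have "ennreal (cmod (b j y)) \<le> ennreal (real R)"
                using order_trans[OF b_le_phi_star[OF that] y(2)] by (simp add: ennreal_of_nat_eq_real_of_nat)
              then show ?thesis by (simp add: ennreal_le_iff)
            qed
            fix Y assume Y: "finite Y" "F \<subseteq> Y" "Y \<subseteq> I"
            have GP: "G P y = (\<Sum>j\<in>F. q j * b j y)" by (simp add: G_def P_def)
            have "(\<Sum>j\<in>Y. c j * b j y) - G P y = (\<Sum>j\<in>F. (c j - q j) * b j y) + (\<Sum>j\<in>Y - F. c j * b j y)"
              unfolding GP sum.subset_diff[OF Y(2,1)] by (simp add: algebra_simps sum_subtractf)
            also have "cmod \<dots> \<le> (\<Sum>j\<in>F. cmod (c j - q j) * real R) + (\<Sum>j\<in>Y - F. cmod (c j) * real R)"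
            proof (rule order_trans[OF norm_triangle_ineq add_mono])
              show "cmod (\<Sum>j\<in>F. (c j - q j) * b j y) \<le> (\<Sum>j\<in>F. cmod (c j - q j) * real R)"
                using by' F(2) by (intro sum_norm_le) (auto simp: norm_mult intro!: mult_left_mono)
              show "cmod (\<Sum>j\<in>Y - F. c j * b j y) \<le> (\<Sum>j\<in>Y - F. cmod (c j) * real R)"
                using by' Y(3) by (intro sum_norm_le) (auto simp: norm_mult intro!: mult_left_mono)
            qed
            also have "\<dots> = ((\<Sum>j\<in>F. cmod (c j - q j)) + (\<Sum>j\<in>Y - F. cmod (c j))) * real R"
              by (simp add: sum_distrib_right distrib_right)
            also have "\<dots> \<le> (d + d) * real R"
              using qF F(3)[of "Y - F"] Y by (intro mult_right_mono add_mono) auto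
            finally show "cmod ((\<Sum>j\<in>Y. c j * b j y) - G P y) \<le> real R * (2 * d)" by (simp add: mult.commute)
          qed (use F in auto)
          have Rd: "real R * (2 * d) = e / 2" using R by (simp add: d_def)
          \<comment> \<open>The bound passes from \<open>g\<close> to the approximant almost
            everywhere, then to the value of the approximant at \<open>x\<close> by the choice of
            the null set, and back to \<open>g x\<close>. The two changes of function cost
            \<open>e / 2\<close> each.\<close>
          have "AE y in M. ennreal (cmod (g y)) \<le> ennreal a"
            using esssup_AE[of "\<lambda>y. ennreal (cmod (g y))" M] real unfolding Linf_norm_def by simp
          then have "AE y in M. T R P y \<le> ennreal (a + e / 2)"
            using AE_space
          proof eventually_elim
            case (elim y)
            then have "cmod (g y) \<le> a" using real by (simp add: ennreal_le_iff)
            moreover have "cmod (G P y) \<le> cmod (g y) + e / 2" if "phi_star I b y \<le> of_nat R"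
              using near[OF elim(2) that] norm_triangle_ineq2[of "G P y" "g y"]
              unfolding Rd by (simp add: norm_minus_commute)
            ultimately show ?case unfolding T_def by (auto intro!: ennreal_leI)
          qed
          then have "esssup M (T R P) \<le> ennreal (a + e / 2)" by (rule esssup_I[OF T_meas[OF P]])
          then have "T R P x \<le> ennreal (a + e / 2)" using T[OF P] by (rule order_trans[rotated])
          then have "cmod (G P x) \<le> a + e / 2" using Rx real e by (simp add: T_def ennreal_le_iff del: ennreal_plus)
          moreover have "cmod (g x) \<le> cmod (G P x) + e / 2"
            using near[OF elim(3) Rx] norm_triangle_ineq2[of "g x" "G P x"] unfolding Rd by simp
          ultimately show "cmod (g x) \<le> a + e" by simp
        qed
        then show ?thesis using real by (simp add: ennreal_leI)
      qed simp
    qed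
  qed
qed

lemma sum_coeff_le_wiener_norm:
  "finite F \<Longrightarrow> F \<subseteq> I \<Longrightarrow> (\<Sum>j\<in>F. ennreal (cmod (coeff M b f j))) \<le> wiener_norm M I b f"
  unfolding wiener_norm_def by (rule sum_le_infsum_ennreal)

text \<open>Setting the coefficients on \<open>J\<close> to zero presents the remainder in the form
  over which \<open>AE_le_Linf_norm\<close> quantifies: a coefficient family, a bound for its finite
  sums, and the function it represents.\<close>

lemma wiener_space_remainder:
  assumes f: "f \<in> wiener_space M I b" and J: "finite J" "J \<subseteq> I"
  defines "g \<equiv> \<lambda>x. f x - partial_expansion M b J f x"
  shows "square_integrable M g"
    and "\<And>x. x \<in> space M \<Longrightarrow> phi_star I b x < \<infinity> \<Longrightarrow>
      ((\<lambda>j. (if j \<in> J then 0 else coeff M b f j) * b j x) has_sum g x) I"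
    and "\<And>F. finite F \<Longrightarrow> F \<subseteq> I \<Longrightarrow> (\<Sum>j\<in>F. cmod (if j \<in> J then 0 else coeff M b f j)) \<le> enn2real (wiener_norm M I b f)"
proof -
  have fs: "square_integrable M f" and fw: "wiener_norm M I b f < \<infinity>"
    and fh: "x \<in> space M \<Longrightarrow> phi_star I b x < \<infinity> \<Longrightarrow> ((\<lambda>j. coeff M b f j * b j x) has_sum f x) I" for x
    using f by (auto simp: wiener_space_def)
  show "square_integrable M g" unfolding g_def partial_expansion_def
    using fs J b_square_integrable by (intro square_integrable_diff_sum) auto
  show "((\<lambda>j. (if j \<in> J then 0 else coeff M b f j) * b j x) has_sum g x) I"
    if x: "x \<in> space M" "phi_star I b x < \<infinity>" for x
  proof -
    have "((\<lambda>j. if j \<in> J then - (coeff M b f j * b j x) else 0) has_sum - partial_expansion M b J f x) I"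
      using J by (intro has_sum_finite_neutralI[of J]) (auto simp: partial_expansion_def sum_negf)
    from has_sum_add[OF fh[OF x] this] have "((\<lambda>j. coeff M b f j * b j x
        + (if j \<in> J then - (coeff M b f j * b j x) else 0)) has_sum g x) I" by (simp add: g_def)
    moreover have "(\<lambda>j. coeff M b f j * b j x + (if j \<in> J then - (coeff M b f j * b j x) else 0))
        = (\<lambda>j. (if j \<in> J then 0 else coeff M b f j) * b j x)" by auto
    ultimately show ?thesis by simp
  qed
  show "(\<Sum>j\<in>F. cmod (if j \<in> J then 0 else coeff M b f j)) \<le> enn2real (wiener_norm M I b f)"
    if F: "finite F" "F \<subseteq> I" for F
  proof -
    have "(\<Sum>j\<in>F. cmod (if j \<in> J then 0 else coeff M b f j)) \<le> (\<Sum>j\<in>F. cmod (coeff M b f j))"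
      by (intro sum_mono) auto
    also have "\<dots> = enn2real (\<Sum>j\<in>F. ennreal (cmod (coeff M b f j)))"
      by (simp add: sum_ennreal sum_nonneg)
    also have "\<dots> \<le> enn2real (wiener_norm M I b f)"
      using sum_coeff_le_wiener_norm[OF F] fw by (intro enn2real_mono) auto
    finally show ?thesis .
  qed
qed

end

section \<open>Recovery\<close>

text \<open>The difficulty is that \<open>ln (inverse \<gamma> * log_factor B n)\<close> may be
  negative, as the logarithmic factor can be as small as \<open>ln 2\<close>. Its logarithm is still
  at least -43/100, while the first summand \<open>x\<close> is at least 4/9, so a fixed share of
  \<open>x\<close> survives and pays for all constants. Half of \<open>\<gamma>\<close> is reserved
  for stability and half for the noise, hence \<open>\<gamma> / 2\<close> and
  \<open>4 / \<gamma>\<close>.\<close>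

lemma sampling_condition:
  fixes B \<gamma> :: real and n N :: nat
  defines "\<Lambda> \<equiv> ln (32000 * (26 * real n) * B\<^sup>2)"
  assumes B: "1 \<le> B" and n: "1 \<le> n" "n < N" and g: "0 < \<gamma>" "\<gamma> < 1"
    and m: "10 ^ 24 * B\<^sup>2 * real n * ((log_factor B n)\<^sup>2 * ln (real N) + ln (inverse \<gamma> * log_factor B n)) \<le> m"
  shows "16000000 * (26 * real n) * B\<^sup>2 * (99 * 64000000 * \<Lambda>\<^sup>2 * ln (5 * real N) + ln (6 * \<Lambda> / (\<gamma> / 2))) \<le> m"
    and "B\<^sup>2 * real n * ln (4 / \<gamma>) \<le> m"
proof -
  define F where "F = log_factor B n"
  define x where "x = F\<^sup>2 * ln (real N)"
  define q where "q = ln (F / \<gamma>)"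
  have B2: "1 \<le> B\<^sup>2" using B by simp
  have Bn: "1 \<le> B\<^sup>2 * real n" using B2 n mult_mono[of 1 "B\<^sup>2" 1 "real n"] by simp
  have lnF: "ln (B\<^sup>2 * real n) \<le> F" unfolding F_def log_factor_def by auto
  have N2: "2 \<le> N" using n by simp
  have F: "2/3 \<le> F" and x: "4/9 \<le> x"
  proof -
    have "2/3 \<le> F \<and> 4/9 \<le> x"
    proof (cases "n = 1")
      case True
      then have F1: "1 \<le> F" by (simp add: F_def log_factor_def)
      have "2/3 \<le> ln (real N)" using ln2_ge_two_thirds N2 ln_le_cancel_iff[of 2 "real N"] by linarith
      moreover have "1 * ln (real N) \<le> x" unfolding x_def
        by (rule mult_right_mono) (use F1 N2 in \<open>auto simp: one_le_power\<close>)
      ultimately show ?thesis using F1 by simp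
    next
      case False
      then have n2: "2 \<le> n" using n by simp
      have "2 \<le> B\<^sup>2 * real n" using B2 n2 mult_mono[of 1 "B\<^sup>2" 2 "real n"] by simp
      then have "ln 2 \<le> ln (B\<^sup>2 * real n)" by simp
      then have F1: "2/3 \<le> F" using lnF ln2_ge_two_thirds by linarith
      have "3 \<le> real N" using n n2 by simp
      then have "exp 1 \<le> real N" using exp_le by linarith
      then have "1 \<le> ln (real N)" using N2 by (simp add: ln_ge_iff)
      moreover have "(2/3)\<^sup>2 \<le> F\<^sup>2" using F1 by (intro power_mono) auto
      ultimately have "(2/3)\<^sup>2 * 1 \<le> x" unfolding x_def by (intro mult_mono) auto
      then show ?thesis using F1 by (simp add: power_divide)
    qed
    then show "2/3 \<le> F" "4/9 \<le> x" by auto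
  qed
  have lnF0: "- (43/100) \<le> ln F"
  proof -
    have "1 + 43/100 + (43/100)\<^sup>2 / 2 \<le> exp (43/100 :: real)" by (rule exp_lower_Taylor_quadratic) simp
    then have "3/2 \<le> exp (43/100 :: real)" by (simp add: power_divide)
    then have "inverse (exp (43/100 :: real)) \<le> inverse (3/2)" by (intro le_imp_inverse_le) auto
    then have "exp (- (43/100)) \<le> F" using F by (simp add: exp_minus)
    then show ?thesis using F by (simp add: ln_ge_iff)
  qed
  have q: "q = ln F - ln \<gamma>" using F g by (simp add: q_def ln_div)
  have lng: "ln \<gamma> < 0" using g by simp
  \<comment> \<open>A narrow margin: 97/100 times 4/9 is about 0.431 and has to cover 0.43.\<close>
  have xq: "3/100 * x \<le> x + q" using q lnF0 lng x by linarith
  have Lam: "0 < \<Lambda>" "\<Lambda> \<le> 31 * F"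
  proof -
    have e: "32000 * (26 * real n) * B\<^sup>2 = 832000 * (B\<^sup>2 * real n)" by simp
    show "0 < \<Lambda>" unfolding \<Lambda>_def e using Bn by (intro ln_gt_zero) linarith
    have "ln (832000 :: real) \<le> ln (2 ^ 20)" by (subst ln_le_cancel_iff) auto
    also have "\<dots> = 20 * ln 2" by (subst ln_realpow) auto
    also have "\<dots> \<le> 20" using ln_2_less_1 by simp
    finally have "\<Lambda> \<le> 20 + ln (B\<^sup>2 * real n)"
      unfolding \<Lambda>_def e using Bn by (subst ln_mult) auto
    then show "\<Lambda> \<le> 31 * F" using lnF F by linarith
  qed
  have ln5: "ln (5 * real N) \<le> 4 * ln (real N)"
  proof -
    have "(2::real) ^ 3 \<le> real N ^ 3" using N2 by (intro power_mono) auto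
    then have "5 * real N \<le> real N ^ 3 * real N" using N2 by (intro mult_right_mono) auto
    also have "\<dots> = real N ^ 4" by (simp add: power_numeral_reduce)
    finally have "ln (5 * real N) \<le> ln (real N ^ 4)" using N2 by (subst ln_le_cancel_iff) auto
    then show ?thesis using N2 by (simp add: ln_realpow)
  qed
  have t1: "\<Lambda>\<^sup>2 * ln (5 * real N) \<le> 3844 * x"
  proof -
    have "\<Lambda>\<^sup>2 * ln (5 * real N) \<le> (31 * F)\<^sup>2 * (4 * ln (real N))"
      using Lam ln5 N2 by (intro mult_mono power_mono) auto
    then show ?thesis by (simp add: x_def power_mult_distrib)
  qed
  have t2: "ln (6 * \<Lambda> / (\<gamma> / 2)) \<le> 9 + q"
  proof -
    have "6 * \<Lambda> / (\<gamma> / 2) \<le> 372 * (F / \<gamma>)" using Lam g by (simp add: field_simps)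
    then have "ln (6 * \<Lambda> / (\<gamma> / 2)) \<le> ln (372 * (F / \<gamma>))"
      using Lam g F by (subst ln_le_cancel_iff) auto
    also have "\<dots> = ln 372 + q" unfolding q_def using F g by (subst ln_mult) auto
    also have "ln 372 \<le> (9 :: real)"
    proof -
      have "ln (372 :: real) \<le> ln (2 ^ 9)" by (subst ln_le_cancel_iff) auto
      also have "\<dots> = 9 * ln 2" by (subst ln_realpow) auto
      also have "\<dots> \<le> 9" using ln_2_less_1 by simp
      finally show ?thesis .
    qed
    finally show ?thesis by simp
  qed
  have t3: "ln (4 / \<gamma>) \<le> 3 + q"
  proof -
    have "ln (4 :: real) = 2 * ln 2" using ln_realpow[of "2 :: real" 2] by simp
    then have "ln (4 :: real) \<le> 2" using ln_2_less_1 by simp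
    then show ?thesis using g q lnF0 by (simp add: ln_div)
  qed
  have main: "B\<^sup>2 * real n * y \<le> m" if "y \<le> 10 ^ 24 * (x + q)" for y
  proof -
    have "B\<^sup>2 * real n * y \<le> B\<^sup>2 * real n * (10 ^ 24 * (x + q))" using that Bn by (intro mult_left_mono) auto
    also have "\<dots> = 10 ^ 24 * B\<^sup>2 * real n * (F\<^sup>2 * ln (real N) + ln (inverse \<gamma> * F))"
      by (simp add: x_def q_def divide_inverse mult_ac)
    finally show ?thesis using m unfolding F_def[symmetric] by linarith
  qed
  \<comment> \<open>3844 is \<open>4 * 31\<^sup>2\<close>, and 416000000 is 26 times 16000000. The
    constants multiply to about \<open>10 ^ 22\<close>; dividing by 3/100 stays below
    \<open>10 ^ 24\<close>.\<close>
  have "416000000 * (99 * 64000000 * (\<Lambda>\<^sup>2 * ln (5 * real N)) + ln (6 * \<Lambda> / (\<gamma> / 2))) \<le> 10 ^ 24 * (x + q)"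
  proof -
    have "416000000 * (99 * 64000000 * (\<Lambda>\<^sup>2 * ln (5 * real N)) + ln (6 * \<Lambda> / (\<gamma> / 2)))
       \<le> 416000000 * (99 * 64000000 * (3844 * x) + (9 + q))" using t1 t2 by simp
    also have "\<dots> \<le> 10 ^ 24 * (x + q)" using xq x by simp
    finally show ?thesis .
  qed
  from main[OF this]
  show "16000000 * (26 * real n) * B\<^sup>2 * (99 * 64000000 * \<Lambda>\<^sup>2 * ln (5 * real N) + ln (6 * \<Lambda> / (\<gamma> / 2))) \<le> m"
    by (simp add: mult_ac)
  show "B\<^sup>2 * real n * ln (4 / \<gamma>) \<le> m"
    by (rule main) (use t3 xq x in simp)
qed

section \<open>Coefficient tails, noise level and the error in \<open>L2\<close>\<close>

context weighted_system begin

text \<open>Off \<open>T\<close> the coefficients of \<open>f\<close> are those of its approximation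
  error. Off \<open>J\<close> the indices in \<open>T\<close> need a separate argument: there the
  coefficients belong to the remainder, so Bessel's inequality bounds their Euclidean norm by
  \<open>G\<close>, and Cauchy-Schwarz over at most \<open>n\<close> indices gives
  \<open>sqrt n * G\<close>.\<close>

lemma coefficient_tail_bounds:
  assumes f: "f \<in> wiener_space M I b" and J: "finite J" "J \<subseteq> I"
    and T: "finite T" "T \<subseteq> I" "card T \<le> n"
    and w: "wiener_norm M I b (\<lambda>x. f x - (\<Sum>j\<in>T. c j * b j x)) = ennreal w" "0 \<le> w"
    and G: "Linf_norm M (\<lambda>x. f x - partial_expansion M b J f x) = ennreal G" "0 \<le> G"
  shows "\<And>F. finite F \<Longrightarrow> F \<subseteq> I - T \<Longrightarrow> (\<Sum>j\<in>F. cmod (coeff M b f j)) \<le> w"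
    and "\<And>F. finite F \<Longrightarrow> F \<subseteq> I - J \<Longrightarrow> (\<Sum>j\<in>F. cmod (coeff M b f j)) \<le> sqrt n * G + w"
    and "(LINT x|M. (cmod (f x - partial_expansion M b J f x))\<^sup>2) \<le> G\<^sup>2"
proof -
  have fs: "square_integrable M f" using f by (simp add: wiener_space_def)
  let ?g = "\<lambda>x. f x - partial_expansion M b J f x"
  have gs: "square_integrable M ?g" by (rule wiener_space_remainder(1)[OF f J])
  show tail: "(\<Sum>j\<in>F. cmod (coeff M b f j)) \<le> w" if F: "finite F" "F \<subseteq> I - T" for F
  proof -
    let ?d = "\<lambda>x. f x - (\<Sum>j\<in>T. c j * b j x)"
    have "coeff M b ?d j = coeff M b f j" if "j \<in> F" for j
      using that F(2) by (subst coeff_diff_sum[OF fs T(1,2)]) auto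
    then have "ennreal (\<Sum>j\<in>F. cmod (coeff M b f j)) = (\<Sum>j\<in>F. ennreal (cmod (coeff M b ?d j)))"
      by simp
    also have "\<dots> \<le> ennreal w" unfolding w(1)[symmetric] using F by (intro sum_coeff_le_wiener_norm) auto
    finally show ?thesis using w(2) by (simp add: ennreal_le_iff)
  qed
  show g2: "(LINT x|M. (cmod (?g x))\<^sup>2) \<le> G\<^sup>2"
  proof -
    have "AE x in M. ennreal (cmod (?g x)) \<le> ennreal G"
      using esssup_AE[of "\<lambda>x. ennreal (cmod (?g x))" M] G(1) unfolding Linf_norm_def by simp
    then have "AE x in M. (cmod (?g x))\<^sup>2 \<le> G\<^sup>2"
      by (rule eventually_mono) (use G(2) in \<open>auto simp: ennreal_le_iff intro!: power_mono\<close>)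
    then have "(LINT x|M. (cmod (?g x))\<^sup>2) \<le> (LINT x|M. G\<^sup>2)"
      using gs by (intro integral_mono_AE) (auto simp: square_integrable_iff)
    then show ?thesis by (simp add: prob_space)
  qed
  show "(\<Sum>j\<in>F. cmod (coeff M b f j)) \<le> sqrt n * G + w" if F: "finite F" "F \<subseteq> I - J" for F
  proof -
    have "(vec_norm (F \<inter> T) (coeff M b f))\<^sup>2 = (\<Sum>j\<in>F \<inter> T. (cmod (coeff M b ?g j))\<^sup>2)"
      unfolding vec_norm_power2 partial_expansion_def
      using F by (intro sum.cong) (auto simp: coeff_diff_sum[OF fs J])
    also have "\<dots> \<le> (LINT x|M. (cmod (?g x))\<^sup>2)" using F by (intro bessel gs) auto
    also have "\<dots> \<le> G\<^sup>2" by (rule g2)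
    finally have v: "vec_norm (F \<inter> T) (coeff M b f) \<le> G" by (rule power2_le_imp_le[OF _ G(2)])
    have "card (F \<inter> T) \<le> n" using T card_mono[of T "F \<inter> T"] by simp
    then have "vec_norm1 (F \<inter> T) (coeff M b f) \<le> sqrt n * vec_norm (F \<inter> T) (coeff M b f)"
      using F by (intro vec_norm1_le) auto
    also have "\<dots> \<le> sqrt n * G" using v by (intro mult_left_mono) auto
    finally have "(\<Sum>j\<in>F \<inter> T. cmod (coeff M b f j)) \<le> sqrt n * G" by (simp add: vec_norm1_def)
    moreover have "(\<Sum>j\<in>F - T. cmod (coeff M b f j)) \<le> w" using F by (intro tail) auto
    moreover have "(\<Sum>j\<in>F. cmod (coeff M b f j)) = (\<Sum>j\<in>F \<inter> T. cmod (coeff M b f j)) + (\<Sum>j\<in>F - T. cmod (coeff M b f j))"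
      using F(1) by (rule sum.Int_Diff)
    ultimately show ?thesis by linarith
  qed
qed

text \<open>
  Where \<open>\<phi>\<close> is small, \<open>\<bar>g / \<phi>\<bar>\<close> is not controlled by the supremum norm of \<open>g\<close>, but it is at most
  \<open>K\<close> times the \<open>\<ell>\<^sub>1\<close>-norm of the coefficients of \<open>g\<close>. The minimum of the two bounds is a
  fixed random variable which is bounded by \<open>K\<^sup>2 n\<close> and has mean at most one.
\<close>

definition noise_weight :: "nat \<Rightarrow> 'a \<Rightarrow> real" where
  "noise_weight n x = min (1 / (weight x)\<^sup>2) (K\<^sup>2 * real n)"

lemma remainder_div_weight_le:
  assumes f: "f \<in> wiener_space M I b" and J: "finite J" "J \<subseteq> I" and n: "1 \<le> n"
    and x: "x \<in> space M" "phi_star I b x < \<infinity>" "0 < weight x"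
    and G: "cmod (f x - partial_expansion M b J f x) \<le> G" and w: "0 \<le> w"
    and tail: "\<And>F. finite F \<Longrightarrow> F \<subseteq> I - J \<Longrightarrow> (\<Sum>j\<in>F. cmod (coeff M b f j)) \<le> sqrt n * G + w"
  shows "(cmod ((f x - partial_expansion M b J f x) / of_real (weight x)))\<^sup>2 \<le> noise_weight n x * (G + w / sqrt n)\<^sup>2"
proof -
  define g where "g = f x - partial_expansion M b J f x"
  define \<rho> where "\<rho> = G + w / sqrt n"
  have G0: "0 \<le> G" using G norm_ge_zero order_trans by blast
  have rho: "G \<le> \<rho>" "0 \<le> \<rho>" using w G0 by (auto simp: \<rho>_def)
  have sq: "sqrt n * \<rho> = sqrt n * G + w" using n by (simp add: \<rho>_def distrib_left)
  have "cmod (g - 0) \<le> (K * weight x) * (sqrt n * \<rho>)"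
  proof (rule has_sum_norm_diff_le[where F = "{}"])
    show "((\<lambda>j. (if j \<in> J then 0 else coeff M b f j) * b j x) has_sum g) I"
      unfolding g_def by (rule wiener_space_remainder(2)[OF f J x(1,2)])
    fix Y assume Y: "finite Y" "Y \<subseteq> I"
    have "cmod (\<Sum>j\<in>Y. (if j \<in> J then 0 else coeff M b f j) * b j x)
        \<le> (\<Sum>j\<in>Y. cmod (if j \<in> J then 0 else coeff M b f j) * (K * weight x))"
      using norm_b_le[OF _ x(2)] Y by (intro sum_norm_le) (auto simp: norm_mult intro!: mult_left_mono)
    also have "\<dots> = (\<Sum>j\<in>Y - J. cmod (coeff M b f j)) * (K * weight x)"
      unfolding sum_distrib_right[symmetric] using Y
      by (intro arg_cong2[where f = "(*)"] sum.mono_neutral_cong_right) auto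
    also have "\<dots> \<le> (sqrt n * \<rho>) * (K * weight x)"
      unfolding sq using tail[of "Y - J"] Y K_ge_1 by (intro mult_right_mono) auto
    finally show "cmod ((\<Sum>j\<in>Y. (if j \<in> J then 0 else coeff M b f j) * b j x) - 0) \<le> (K * weight x) * (sqrt n * \<rho>)"
      by (simp add: mult.commute)
  qed auto
  then have "cmod g / weight x \<le> K * (sqrt n * \<rho>)" using x(3) by (simp add: pos_divide_le_eq mult_ac)
  then have "(cmod g / weight x)\<^sup>2 \<le> (K * (sqrt n * \<rho>))\<^sup>2" using x(3) by (intro power_mono) auto
  then have b2: "(cmod g / weight x)\<^sup>2 \<le> (K\<^sup>2 * real n) * \<rho>\<^sup>2" by (simp add: power_mult_distrib)
  have "cmod g / weight x \<le> \<rho> / weight x" using G rho x(3) unfolding g_def by (intro divide_right_mono) auto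
  then have "(cmod g / weight x)\<^sup>2 \<le> (\<rho> / weight x)\<^sup>2" using x(3) by (intro power_mono) auto
  then have "(cmod g / weight x)\<^sup>2 \<le> (1 / (weight x)\<^sup>2) * \<rho>\<^sup>2" by (simp add: power_divide)
  with b2 have "(cmod g / weight x)\<^sup>2 \<le> noise_weight n x * \<rho>\<^sup>2" by (auto simp: noise_weight_def min_def)
  then show ?thesis using x(3) by (simp add: norm_divide g_def \<rho>_def)
qed

lemma samples_residual:
  assumes J: "finite J" "J \<subseteq> I"
  shows "residual J (sampling_matrix M I b m X) (samples M I b m X f) (coeff M b f) l
    = of_real (1 / sqrt m) * ((f (X l) - partial_expansion M b J f (X l)) / of_real (weight (X l)))"
  unfolding residual_def sampling_matrix_def samples_def partial_expansion_def
  by (simp add: diff_divide_distrib right_diff_distrib sum_distrib_left sum_divide_distrib mult_ac)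

lemma noise_bound:
  assumes f: "f \<in> wiener_space M I b" and J: "finite J" "J \<subseteq> I" and n: "1 \<le> n"
    and X: "\<And>l. l < m \<Longrightarrow> X l \<in> space M \<and> phi_star I b (X l) < \<infinity> \<and> 0 < weight (X l)
        \<and> cmod (f (X l) - partial_expansion M b J f (X l)) \<le> G"
    and avg: "(\<Sum>l<m. noise_weight n (X l)) / real m \<le> 3" and w: "0 \<le> w" and G: "0 \<le> G"
    and tail: "\<And>F. finite F \<Longrightarrow> F \<subseteq> I - J \<Longrightarrow> (\<Sum>j\<in>F. cmod (coeff M b f j)) \<le> sqrt n * G + w"
  shows "residual_norm J m (sampling_matrix M I b m X) (samples M I b m X f) (coeff M b f) \<le> 2 * (G + w / sqrt n)"
proof -
  define \<rho> where "\<rho> = G + w / sqrt n"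
  have rho: "0 \<le> \<rho>" using G w by (simp add: \<rho>_def)
  have "(residual_norm J m (sampling_matrix M I b m X) (samples M I b m X f) (coeff M b f))\<^sup>2
     = (\<Sum>l<m. (cmod ((f (X l) - partial_expansion M b J f (X l)) / of_real (weight (X l))))\<^sup>2 / real m)"
    unfolding residual_norm_def samples_residual[OF J] vec_norm_def[symmetric] vec_norm_power2
    by (intro sum.cong) (auto simp: norm_mult norm_divide power_mult_distrib power_divide)
  also have "\<dots> \<le> (\<Sum>l<m. noise_weight n (X l) * \<rho>\<^sup>2 / real m)"
    unfolding \<rho>_def using X by (intro sum_mono divide_right_mono remainder_div_weight_le[OF f J n _ _ _ _ w tail]) auto
  also have "\<dots> = (\<Sum>l<m. noise_weight n (X l)) / real m * \<rho>\<^sup>2"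
    by (simp add: sum_distrib_right sum_divide_distrib)
  also have "\<dots> \<le> 3 * \<rho>\<^sup>2" using avg by (intro mult_right_mono) auto
  also have "\<dots> \<le> (2 * \<rho>)\<^sup>2" by (simp add: power_mult_distrib)
  finally show ?thesis unfolding \<rho>_def[symmetric] by (rule power2_le_imp_le) (use rho in simp)
qed

lemma L2_error_le:
  assumes f: "f \<in> wiener_space M I b" and J: "finite J" "J \<subseteq> I"
    and g2: "(LINT x|M. (cmod (f x - partial_expansion M b J f x))\<^sup>2) \<le> G\<^sup>2" and G: "0 \<le> G"
  shows "L2_norm M (\<lambda>x. ennreal (cmod (f x - (\<Sum>j\<in>J. z j * b j x))))
     \<le> ennreal (2 * (G + vec_norm J (\<lambda>j. coeff M b f j - z j)))"
proof (rule L2_norm_le)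
  define D where "D = vec_norm J (\<lambda>j. coeff M b f j - z j)"
  have D: "0 \<le> D" by (simp add: D_def)
  let ?g = "\<lambda>x. f x - partial_expansion M b J f x"
  let ?d = "\<lambda>x. \<Sum>j\<in>J. (coeff M b f j - z j) * b j x"
  have gs: "square_integrable M ?g" by (rule wiener_space_remainder(1)[OF f J])
  have ds: "square_integrable M ?d" using J b_square_integrable by (intro square_integrable_sum) auto
  have d2: "(LINT x|M. (cmod (?d x))\<^sup>2) = D\<^sup>2"
    unfolding D_def vec_norm_power2 by (rule integral_norm_sum_power2[OF J])
  have pt: "(cmod (f x - (\<Sum>j\<in>J. z j * b j x)))\<^sup>2 \<le> 2 * (cmod (?g x))\<^sup>2 + 2 * (cmod (?d x))\<^sup>2" for x
  proof -
    have "f x - (\<Sum>j\<in>J. z j * b j x) = ?g x + ?d x"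
      by (simp add: partial_expansion_def left_diff_distrib sum_subtractf)
    then have "cmod (f x - (\<Sum>j\<in>J. z j * b j x)) \<le> cmod (?g x) + cmod (?d x)" by (metis norm_triangle_ineq)
    then have "(cmod (f x - (\<Sum>j\<in>J. z j * b j x)))\<^sup>2 \<le> (cmod (?g x) + cmod (?d x))\<^sup>2" by (intro power_mono) auto
    also have "\<dots> \<le> 2 * (cmod (?g x))\<^sup>2 + 2 * (cmod (?d x))\<^sup>2"
      using zero_le_power2[of "cmod (?g x) - cmod (?d x)"] by (simp add: power2_eq_square algebra_simps)
    finally show ?thesis .
  qed
  have "(\<integral>\<^sup>+x. (ennreal (cmod (f x - (\<Sum>j\<in>J. z j * b j x))))\<^sup>2 \<partial>M)
      \<le> (\<integral>\<^sup>+x. ennreal (2 * (cmod (?g x))\<^sup>2 + 2 * (cmod (?d x))\<^sup>2) \<partial>M)"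
    using pt by (intro nn_integral_mono) (simp add: ennreal_power ennreal_leI del: ennreal_plus)
  also have "\<dots> = ennreal (LINT x|M. 2 * (cmod (?g x))\<^sup>2 + 2 * (cmod (?d x))\<^sup>2)"
    using gs ds unfolding square_integrable_iff by (intro nn_integral_eq_integral) auto
  also have "(LINT x|M. 2 * (cmod (?g x))\<^sup>2 + 2 * (cmod (?d x))\<^sup>2) = 2 * (LINT x|M. (cmod (?g x))\<^sup>2) + 2 * D\<^sup>2"
    using gs ds unfolding square_integrable_iff d2[symmetric] by simp
  also have "ennreal \<dots> \<le> ennreal ((2 * (G + D))\<^sup>2)"
  proof (rule ennreal_leI)
    have "0 \<le> G * D" using G D by simp
    then have "2 * G\<^sup>2 + 2 * D\<^sup>2 \<le> (2 * (G + D))\<^sup>2" by (simp add: power2_eq_square algebra_simps)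
    then show "2 * (LINT x|M. (cmod (?g x))\<^sup>2) + 2 * D\<^sup>2 \<le> (2 * (G + D))\<^sup>2" using g2 by linarith
  qed
  finally show "(\<integral>\<^sup>+x. (ennreal (cmod (f x - (\<Sum>j\<in>J. z j * b j x))))\<^sup>2 \<partial>M)
      \<le> ennreal ((2 * (G + vec_norm J (\<lambda>j. coeff M b f j - z j)))\<^sup>2)" by (simp add: D_def)
qed (use G in simp)

end

section \<open>Probability of good sample points and the recovery bound\<close>

context weighted_system begin

lemma noise_weight_measurable [measurable]: "noise_weight n \<in> borel_measurable M"
  unfolding noise_weight_def[abs_def] by measurable

lemma noise_weight_bounds: "0 \<le> noise_weight n x" "noise_weight n x \<le> K\<^sup>2 * real n"
  by (auto simp: noise_weight_def)

lemma noise_weight_mean: "(LINT x|nu. noise_weight n x) \<le> 1"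
proof -
  have "(LINT x|nu. noise_weight n x) = (LINT x|M. (weight x)\<^sup>2 *\<^sub>R noise_weight n x)"
    unfolding nu_eq by (rule integral_density; (measurable | simp))
  also have "\<dots> \<le> (LINT x|M. 1)"
  proof (rule integral_mono)
    show le: "(weight x)\<^sup>2 *\<^sub>R noise_weight n x \<le> 1" for x
    proof (cases "weight x = 0")
      case False
      have "(weight x)\<^sup>2 * noise_weight n x \<le> (weight x)\<^sup>2 * (1 / (weight x)\<^sup>2)"
        by (intro mult_left_mono) (auto simp: noise_weight_def)
      then show ?thesis using False by simp
    qed simp
    show "integrable M (\<lambda>x. (weight x)\<^sup>2 *\<^sub>R noise_weight n x)"
    proof (rule integrable_const_bound[where B = 1])
      show "AE x in M. norm ((weight x)\<^sup>2 *\<^sub>R noise_weight n x) \<le> 1"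
        using le noise_weight_bounds by (intro AE_I2) (simp add: abs_mult)
    qed measurable
  qed simp
  finally show ?thesis by (simp add: prob_space)
qed

lemma noise_probability:
  assumes "0 < m" "1 \<le> n"
  shows "measure (iid_points M I b m) {X\<in>space (iid_points M I b m). 3 < (\<Sum>l<m. noise_weight n (X l)) / real m}
     \<le> 2 * exp (- (real m / (K\<^sup>2 * real n)))"
proof -
  interpret N: prob_space nu by (rule prob_space_nu)
  let ?P = "iid_points M I b m"
  let ?\<mu> = "LINT x|nu. noise_weight n x"
  have Pd: "?P = PiM {..<m} (\<lambda>_. nu)" by (simp add: iid_points_def)
  interpret I: product_prob_space "\<lambda>_. nu" "{..<m}" by unfold_locales
  interpret PP: prob_space ?P unfolding Pd by unfold_locales
  have h: "0 < K\<^sup>2 * real n" using K_ge_1 assms by simp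
  have q: "noise_weight n \<in> borel_measurable nu" by simp
  have [measurable]: "(\<lambda>X. noise_weight n (X l)) \<in> borel_measurable ?P" if "l < m" for l
    using that unfolding Pd
    by (intro measurable_compose[OF measurable_component_singleton[of l "{..<m}" "\<lambda>_. nu"] q]) simp
  \<comment> \<open>Chernoff's bound is used with relative error 1 and \<open>t = 1\<close>: as the
    mean is at most 1, an average above 3 exceeds it by more than the mean plus 1.\<close>
  have "measure ?P {X\<in>space ?P. 3 < (\<Sum>l<m. noise_weight n (X l)) / real m}
      \<le> measure ?P {X\<in>space ?P. 1 * ?\<mu> + 1 < \<bar>(\<Sum>l<m. noise_weight n (X l)) / real m - ?\<mu>\<bar>}"
  proof (rule PP.finite_measure_mono)
    show "{X\<in>space ?P. 3 < (\<Sum>l<m. noise_weight n (X l)) / real m}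
      \<subseteq> {X\<in>space ?P. 1 * ?\<mu> + 1 < \<bar>(\<Sum>l<m. noise_weight n (X l)) / real m - ?\<mu>\<bar>}"
      using noise_weight_mean[of n] by auto
    show "{X\<in>space ?P. 1 * ?\<mu> + 1 < \<bar>(\<Sum>l<m. noise_weight n (X l)) / real m - ?\<mu>\<bar>} \<in> sets ?P" by measurable
  qed
  also have "\<dots> \<le> 2 * exp (- (1 * real m * 1 / (K\<^sup>2 * real n)))"
    unfolding Pd by (rule N.chernoff_average[OF q]) (use noise_weight_bounds h assms in auto)
  finally show ?thesis by simp
qed

text \<open>The noise is at most \<open>2 * (G + w / sqrt n)\<close>, the decoder contributes the
  factor 25 and \<open>L2_error_le\<close> the factor 2. This adds up to 102 times \<open>G\<close>
  plus 150 times \<open>w / sqrt n\<close>, within 151.\<close>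

lemma recovery_bound_of_good_points:
  fixes Z :: "(nat \<Rightarrow> 'i \<Rightarrow> complex) \<Rightarrow> (nat \<Rightarrow> complex) \<Rightarrow> 'i \<Rightarrow> complex"
  assumes n: "1 \<le> n" and J: "finite J" "J \<subseteq> I" and f: "f \<in> wiener_space M I b"
    and decoder: "\<And>A y c T \<eta> w. T \<subseteq> J \<Longrightarrow> card T \<le> n \<Longrightarrow> stable_matrix J m A (26 * real n) \<Longrightarrow>
      residual_norm J m A y c \<le> \<eta> \<Longrightarrow> vec_norm1 (J - T) c \<le> w \<Longrightarrow>
      vec_norm J (\<lambda>j. c j - Z A y j) \<le> 25 * (w / sqrt n + \<eta>)"
    and stable: "stable_matrix J m (sampling_matrix M I b m X) (26 * real n)"
    and X: "\<And>l. l < m \<Longrightarrow> X l \<in> space M \<and> phi_star I b (X l) < \<infinity> \<and> 0 < weight (X l)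
        \<and> ennreal (cmod (f (X l) - partial_expansion M b J f (X l))) \<le> Linf_norm M (\<lambda>x. f x - partial_expansion M b J f x)"
    and avg: "(\<Sum>l<m. noise_weight n (X l)) / real m \<le> 3"
  shows "recovery_bound 150 M I b n J (\<lambda>f x. \<Sum>j\<in>J. Z (sampling_matrix M I b m X) (samples M I b m X f) j * b j x) f"
proof -
  define z where "z = Z (sampling_matrix M I b m X) (samples M I b m X f)"
  define err where "err = L2_norm M (\<lambda>x. ennreal (cmod (f x - (\<Sum>j\<in>J. z j * b j x))))"
  define a where "a = 1 / sqrt (real n)"
  have a: "0 < a" "a \<le> 1" using n by (auto simp: a_def)
  have powr: "real n powr (- 1 / 2) = a"
  proof -
    have "real n powr (- 1 / 2) = real n powr (- (1 / 2))" by simp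
    also have "\<dots> = a" unfolding a_def powr_minus_divide using n by (simp add: powr_half_sqrt)
    finally show ?thesis .
  qed
  define Li where "Li = Linf_norm M (\<lambda>x. f x - partial_expansion M b J f x)"
  have "err \<le> ennreal 151 * (ennreal a * best_n_term M I b n f + Li)"
  proof (cases "Li = \<top> \<or> best_n_term M I b n f = \<top>")
    case True
    then have "ennreal 151 * (ennreal a * best_n_term M I b n f + Li) = \<top>"
      using a by (auto simp: ennreal_mult_top)
    then show ?thesis by (simp only: top_greatest)
  next
    case False
    then obtain G where G: "Li = ennreal G" "0 \<le> G" by (cases Li) auto
    show ?thesis
    proof (rule ennreal_le_epsilon)
      fix e :: real assume e: "0 < e"
      \<comment> \<open>The infimum in \<open>best_n_term\<close> need not be attained; the slack
        \<open>d\<close> is finally multiplied by 151.\<close>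
      define d where "d = e / 151"
      have "best_n_term M I b n f < best_n_term M I b n f + ennreal d"
        using False e by (cases "best_n_term M I b n f") (auto simp: d_def ennreal_less_iff simp flip: ennreal_plus)
      then obtain T c where T: "T \<subseteq> I" "finite T" "card T \<le> n"
        and Tw: "wiener_norm M I b (\<lambda>x. f x - (\<Sum>j\<in>T. c j * b j x)) < best_n_term M I b n f + ennreal d"
        unfolding best_n_term_def INF_less_iff by blast
      then obtain w where w: "wiener_norm M I b (\<lambda>x. f x - (\<Sum>j\<in>T. c j * b j x)) = ennreal w" "0 \<le> w"
        by (cases "wiener_norm M I b (\<lambda>x. f x - (\<Sum>j\<in>T. c j * b j x))") auto
      note tails = coefficient_tail_bounds[OF f J T(2,1,3) w G[unfolded Li_def]]
      have XG: "X l \<in> space M \<and> phi_star I b (X l) < \<infinity> \<and> 0 < weight (X l)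
        \<and> cmod (f (X l) - partial_expansion M b J f (X l)) \<le> G" if "l < m" for l
        using X[OF that] unfolding Li_def[symmetric] G(1) using G(2) by (simp add: ennreal_le_iff)
      have noise: "residual_norm J m (sampling_matrix M I b m X) (samples M I b m X f) (coeff M b f) \<le> 2 * (G + w / sqrt n)"
        by (rule noise_bound[OF f J n XG avg w(2) G(2) tails(2)])
      have "vec_norm J (\<lambda>j. coeff M b f j - z j) \<le> 25 * (w / sqrt n + 2 * (G + w / sqrt n))"
        unfolding z_def
      proof (rule decoder[OF _ _ stable noise])
        show "card (T \<inter> J) \<le> n" using T card_mono[of T "T \<inter> J"] by simp
        show "vec_norm1 (J - T \<inter> J) (coeff M b f) \<le> w"
          unfolding vec_norm1_def using J by (intro tails(1)) auto
      qed simp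
      then have D: "vec_norm J (\<lambda>j. coeff M b f j - z j) \<le> 25 * (a * w + 2 * (G + a * w))" by (simp add: a_def)
      have "err \<le> ennreal (2 * (G + vec_norm J (\<lambda>j. coeff M b f j - z j)))"
        unfolding err_def by (rule L2_error_le[OF f J tails(3) G(2)])
      also have "\<dots> \<le> ennreal (151 * (a * w + G))"
      proof (rule ennreal_leI)
        have "0 \<le> a * w" using a w by simp
        then show "2 * (G + vec_norm J (\<lambda>j. coeff M b f j - z j)) \<le> 151 * (a * w + G)" using D G(2) by simp
      qed
      also have "\<dots> = ennreal 151 * (ennreal a * ennreal w + ennreal G)"
        using a w G by (simp add: ennreal_mult ennreal_plus)
      also have "\<dots> \<le> ennreal 151 * (ennreal a * (best_n_term M I b n f + ennreal d) + Li)"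
        unfolding G(1) using Tw w(1) by (intro mult_left_mono add_mono order_refl) auto
      also have "\<dots> = ennreal 151 * (ennreal a * best_n_term M I b n f + Li) + ennreal 151 * (ennreal a * ennreal d)"
        by (simp add: distrib_left add_ac)
      also have "ennreal 151 * (ennreal a * ennreal d) \<le> ennreal e"
      proof -
        have "ennreal 151 * (ennreal a * ennreal d) = ennreal (151 * (a * d))" 
        proof -
          have "0 \<le> d" using e by (simp add: d_def)
          then show ?thesis using a by (simp add: ennreal_mult)
        qed
        also have "\<dots> \<le> ennreal e"
        proof (rule ennreal_leI)
          have "a * d \<le> 1 * d" using a e by (intro mult_right_mono) (auto simp: d_def)
          then show "151 * (a * d) \<le> e" by (simp add: d_def)
        qed
        finally show ?thesis .
      qed
      finally show "err \<le> ennreal 151 * (ennreal a * best_n_term M I b n f + Li) + ennreal e"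
        by (simp add: add_left_mono)
    qed
  qed
  then show ?thesis unfolding recovery_bound_def err_def z_def Li_def powr by simp
qed

text \<open>A decoder enters only through its error bound for stable matrices, which lets both
  decoders share this argument. From the event of stability one removes the points with large noise
  average and a null set. None of these events depends on \<open>f\<close>, so one event serves the
  whole Wiener space.\<close>

lemma decoder_recovery:
  fixes Z :: "(nat \<Rightarrow> 'i \<Rightarrow> complex) \<Rightarrow> (nat \<Rightarrow> complex) \<Rightarrow> 'i \<Rightarrow> complex"
  assumes n: "1 \<le> n" and J: "finite J" "J \<subseteq> I" "n < card J" and g: "0 < \<gamma>" "\<gamma> < 1"
    and m: "10 ^ 24 * K\<^sup>2 * real n * ((log_factor K n)\<^sup>2 * ln (real (card J)) + ln (inverse \<gamma> * log_factor K n)) \<le> real m"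
    and decoder: "\<And>A y c T \<eta> w. T \<subseteq> J \<Longrightarrow> card T \<le> n \<Longrightarrow> stable_matrix J m A (26 * real n) \<Longrightarrow>
      residual_norm J m A y c \<le> \<eta> \<Longrightarrow> vec_norm1 (J - T) c \<le> w \<Longrightarrow>
      vec_norm J (\<lambda>j. c j - Z A y j) \<le> 25 * (w / sqrt n + \<eta>)"
  shows "with_prob_ge (iid_points M I b m) (1 - \<gamma>) (\<lambda>X. \<forall>f\<in>wiener_space M I b.
    recovery_bound 150 M I b n J (\<lambda>f x. \<Sum>j\<in>J. Z (sampling_matrix M I b m X) (samples M I b m X f) j * b j x) f)"
proof -
  interpret N: prob_space nu by (rule prob_space_nu)
  define P where "P = iid_points M I b m"
  have Pd: "P = PiM {..<m} (\<lambda>_. nu)" by (simp add: P_def iid_points_def)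
  interpret I: product_prob_space "\<lambda>_. nu" "{..<m}" by unfold_locales
  interpret PP: prob_space P unfolding Pd by unfold_locales
  note m1 = sampling_condition(1)[OF K_ge_1 n J(3) g m]
  note m2 = sampling_condition(2)[OF K_ge_1 n J(3) g m]
  have Kn: "0 < K\<^sup>2 * real n" using K_ge_1 n by simp
  have l4: "0 < ln (4 / \<gamma>)" using g by (intro ln_gt_zero) (simp add: field_simps)
  have m0: "0 < m"
  proof -
    have "0 < K\<^sup>2 * real n * ln (4 / \<gamma>)" using Kn l4 by (rule mult_pos_pos)
    then show ?thesis using m2 by simp
  qed
  define \<psi> where "\<psi> = (\<lambda>j x. b j x / complex_of_real (weight x))"
  have "\<exists>E\<in>sets P. 1 - \<gamma> / 2 \<le> measure P E \<and>
     (\<forall>X\<in>E. stable_matrix J m (\<lambda>l j. of_real (1 / sqrt m) * \<psi> j (X l)) (26 * real n))"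
    unfolding Pd
  proof (rule N.bounded_system_stable[where K = K])
    show "finite J" "J \<noteq> {}" using J by auto
    show "cmod (\<psi> j x) \<le> K" if "j \<in> J" for j x unfolding \<psi>_def using that J by (intro norm_b_div_weight_le) auto
    show "\<psi> j \<in> borel_measurable nu" if "j \<in> J" for j
    proof -
      have [measurable]: "b j \<in> borel_measurable M" using that J by (intro b_measurable) auto
      show ?thesis unfolding \<psi>_def by measurable
    qed
    show "(LINT x|nu. (cmod (\<Sum>j\<in>J. v j * \<psi> j x))\<^sup>2) = (vec_norm J v)\<^sup>2" for v
      unfolding \<psi>_def by (rule energy_nu[OF J(1,2)])
  qed (use K_ge_1 n g m1 in auto)
  then obtain E1 where E1: "E1 \<in> sets P" "1 - \<gamma> / 2 \<le> measure P E1"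
    "\<And>X. X \<in> E1 \<Longrightarrow> stable_matrix J m (sampling_matrix M I b m X) (26 * real n)"
    unfolding \<psi>_def sampling_matrix_def[abs_def] by blast
  define E2 where "E2 = {X\<in>space P. 3 < (\<Sum>l<m. noise_weight n (X l)) / real m}"
  have E2_sets: "E2 \<in> sets P"
  proof -
    have q: "noise_weight n \<in> borel_measurable nu" by simp
    have [measurable]: "(\<lambda>X. noise_weight n (X l)) \<in> borel_measurable P" if "l < m" for l
      using that unfolding Pd
      by (intro measurable_compose[OF measurable_component_singleton[of l "{..<m}" "\<lambda>_. nu"] q]) simp
    show ?thesis unfolding E2_def by measurable
  qed
  have E2: "measure P E2 \<le> \<gamma> / 2"
  proof -
    have "ln (4 / \<gamma>) \<le> real m / (K\<^sup>2 * real n)" using m2 Kn by (simp add: pos_le_divide_eq mult.commute)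
    then have "exp (- (real m / (K\<^sup>2 * real n))) \<le> exp (- ln (4 / \<gamma>))" by simp
    also have "\<dots> = \<gamma> / 4" using g by (simp add: exp_minus)
    finally show ?thesis using noise_probability[OF m0 n] unfolding E2_def P_def by linarith
  qed
  \<comment> \<open>The quantifier over all functions stands inside the predicate on points, so each
    sample point needs only one null set.\<close>
  define Good where "Good = (\<lambda>x. (\<forall>c B g. (\<forall>F. finite F \<and> F \<subseteq> I \<longrightarrow> (\<Sum>j\<in>F. cmod (c j)) \<le> B) \<and> g \<in> borel_measurable M \<and>
     (\<forall>y\<in>space M. phi_star I b y < \<infinity> \<longrightarrow> ((\<lambda>j. c j * b j y) has_sum g y) I)
     \<longrightarrow> ennreal (cmod (g x)) \<le> Linf_norm M g) \<and> phi_star I b x < \<infinity> \<and> 0 < weight x)"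
  have "AE x in nu. Good x" unfolding Good_def by (rule AE_nu[OF AE_le_Linf_norm])
  then have "AE X in P. Good (X l)" if "l < m" for l
    unfolding Pd using that N.prob_space_axioms by (intro AE_PiM_component) auto
  then have "AE X in P. \<forall>l\<in>{..<m}. Good (X l)" by (intro AE_ball_countable') auto
  then obtain E3 where E3: "{X\<in>space P. \<not> (\<forall>l\<in>{..<m}. Good (X l))} \<subseteq> E3" "emeasure P E3 = 0" "E3 \<in> sets P"
    by (rule AE_E)
  define E where "E = E1 - (E2 \<union> E3)"
  have E_sets: "E \<in> sets P" unfolding E_def using E1 E2_sets E3 by auto
  have "measure P E1 \<le> measure P (E \<union> (E2 \<union> E3))"
    using E1(1) E_sets E2_sets E3 by (intro PP.finite_measure_mono) (auto simp: E_def)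
  also have "\<dots> \<le> measure P E + (measure P E2 + measure P E3)"
    using E_sets E2_sets E3 by (intro order_trans[OF measure_Un_le] add_left_mono measure_Un_le) auto
  also have "measure P E3 = 0" using E3(2) by (simp add: measure_def)
  finally have E_measure: "1 - \<gamma> \<le> measure P E" using E1(2) E2 by simp
  show ?thesis unfolding with_prob_ge_def P_def[symmetric]
  proof (intro bexI[OF _ E_sets] conjI ballI E_measure)
    fix X f assume X: "X \<in> E" and f: "f \<in> wiener_space M I b"
    have XP: "X \<in> space P" using X E_sets sets.sets_into_space by blast
    have gm: "(\<lambda>x. f x - partial_expansion M b J f x) \<in> borel_measurable M"
      using wiener_space_remainder(1)[OF f J(1,2)] by (simp add: square_integrable_iff)
    show "recovery_bound 150 M I b n J (\<lambda>f x. \<Sum>j\<in>J. Z (sampling_matrix M I b m X) (samples M I b m X f) j * b j x) f"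
    proof (rule recovery_bound_of_good_points[OF n J(1,2) f decoder])
      show "stable_matrix J m (sampling_matrix M I b m X) (26 * real n)" using X E1(3) by (simp add: E_def)
      show "(\<Sum>l<m. noise_weight n (X l)) / real m \<le> 3" using X XP by (auto simp: E_def E2_def)
      fix l assume l: "l < m"
      have "X l \<in> space M" using XP l unfolding Pd space_PiM by (auto dest: PiE_mem)
      moreover have "Good (X l)" using X XP E3(1) l by (auto simp: E_def)
      moreover have "ennreal (cmod (f (X l) - partial_expansion M b J f (X l))) \<le> Linf_norm M (\<lambda>x. f x - partial_expansion M b J f x)"
      proof -
        have le: "ennreal (cmod (g (X l))) \<le> Linf_norm M g"
          if "\<forall>F. finite F \<and> F \<subseteq> I \<longrightarrow> (\<Sum>j\<in>F. cmod (c j)) \<le> B" "g \<in> borel_measurable M"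
            "\<forall>y\<in>space M. phi_star I b y < \<infinity> \<longrightarrow> ((\<lambda>j. c j * b j y) has_sum g y) I" for c B g
          by (rule calculation(2)[unfolded Good_def, THEN conjunct1, THEN spec[of _ c], THEN spec[of _ B], THEN spec[of _ g], THEN mp])
            (intro conjI that)
        show ?thesis
          by (rule le[OF _ gm, of "\<lambda>j. if j \<in> J then 0 else coeff M b f j" "enn2real (wiener_norm M I b f)"])
            (use wiener_space_remainder(2,3)[OF f J(1,2)] in auto)
      qed
      ultimately show "X l \<in> space M \<and> phi_star I b (X l) < \<infinity> \<and> 0 < weight (X l)
        \<and> ennreal (cmod (f (X l) - partial_expansion M b J f (X l))) \<le> Linf_norm M (\<lambda>x. f x - partial_expansion M b J f x)"
        unfolding Good_def by (elim conjE) (intro conjI)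
    qed
  qed
qed

end

theorem theorem2p14:
  shows "\<exists>\<alpha> \<beta> \<tau> :: real. 0 < \<alpha> \<and> 0 < \<beta> \<and> 0 < \<tau> \<and>
    (\<forall>(\<Omega> :: 'a topology) (M :: 'a measure) (I :: 'i set) (b :: 'i \<Rightarrow> 'a \<Rightarrow> complex).
       prob_space M \<and> space M = topspace \<Omega> \<and> (\<forall>U. openin \<Omega> U \<longrightarrow> U \<in> sets M) \<and>
       countable I \<and> (\<forall>j\<in>I. continuous_map \<Omega> euclidean (b j)) \<and>
       orthonormal_system M I b \<and> L2_norm M (phi_star I b) < \<infinity> \<longrightarrow>
       (\<forall>(n :: nat) (\<gamma> :: real) (J :: 'i set) (m :: nat).
          1 \<le> n \<and> 0 < \<gamma> \<and> \<gamma> < 1 \<and> finite J \<and> J \<subseteq> I \<and> n < card J \<and>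
          real m \<ge> \<alpha> * (B_tilde M I b)\<^sup>2 * real n *
            ((log_factor (B_tilde M I b) n)\<^sup>2 * ln (real (card J)) +
             ln (inverse \<gamma> * log_factor (B_tilde M I b) n)) \<longrightarrow>
          (\<forall>r. rlasso_rule J m (3 * \<tau> * sqrt (real n)) r \<longrightarrow>
             with_prob_ge (iid_points M I b m) (1 - \<gamma>)
               (\<lambda>X. \<forall>f\<in>wiener_space M I b.
                  recovery_bound \<beta> M I b n J (rlasso_decoder r M I b J m X) f)) \<and>
          (\<forall>enum ls. inj_on enum J \<and> least_squares_rule J m ls \<longrightarrow>
             with_prob_ge (iid_points M I b m) (1 - \<gamma>)
               (\<lambda>X. \<forall>f\<in>wiener_space M I b.
                  recovery_bound \<beta> M I b n J (omp_decoder enum ls (24 * n) M I b J m X) f))))"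
proof (rule exI[of _ "10 ^ 24"], rule exI[of _ 150], rule exI[of _ 2], intro conjI allI impI; (elim conjE)?)
  fix \<Omega> :: "'a topology" and M :: "'a measure" and I :: "'i set" and b :: "'i \<Rightarrow> 'a \<Rightarrow> complex"
    and n :: nat and \<gamma> :: real and J :: "'i set" and m :: nat
  assume M: "prob_space M" "countable I" "orthonormal_system M I b" "L2_norm M (phi_star I b) < \<infinity>"
    and n: "1 \<le> n" and g: "0 < \<gamma>" "\<gamma> < 1" and J: "finite J" "J \<subseteq> I" "n < card J"
    and m: "10 ^ 24 * (B_tilde M I b)\<^sup>2 * real n *
            ((log_factor (B_tilde M I b) n)\<^sup>2 * ln (real (card J)) +
             ln (inverse \<gamma> * log_factor (B_tilde M I b) n)) \<le> real m"
  have J0: "J \<noteq> {}" using J by auto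
  interpret prob_space M by (rule M(1))
  interpret weighted_system M I b
    by unfold_locales (use M J J0 in auto)
  {
    fix r :: "(nat \<Rightarrow> 'i \<Rightarrow> complex) \<Rightarrow> (nat \<Rightarrow> complex) \<Rightarrow> 'i \<Rightarrow> complex"
    assume r: "rlasso_rule J m (3 * 2 * sqrt (real n)) r"
    show "with_prob_ge (iid_points M I b m) (1 - \<gamma>)
         (\<lambda>X. \<forall>f\<in>wiener_space M I b. recovery_bound 150 M I b n J (rlasso_decoder r M I b J m X) f)"
      unfolding rlasso_decoder_def[abs_def]
    proof (rule decoder_recovery[OF n J g m])
      fix A y c T \<eta> w
      assume T: "T \<subseteq> J" "card T \<le> n" and st: "stable_matrix J m A (26 * real n)"
        and eta: "residual_norm J m A y c \<le> \<eta>" and w: "vec_norm1 (J - T) c \<le> w"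
      \<comment> \<open>With the witness \<open>\<tau> = 2\<close> the penalty
        \<open>3 * \<tau> * sqrt n\<close> is the weight \<open>6 * sqrt n\<close> of
        \<open>rlasso_error\<close>.\<close>
      have "vec_norm1 J (r A y) + 6 * sqrt n * residual_norm J m A y (r A y)
          \<le> vec_norm1 J c + 6 * sqrt n * residual_norm J m A y c"
        using r unfolding rlasso_rule_def is_arg_min_linorder vec_norm1_def by simp
      then have "vec_norm J (\<lambda>j. c j - r A y j) \<le> 20 * (w / sqrt n + \<eta>)"
        by (rule rlasso_error[OF J(1) T n st _ eta w])
      moreover have "0 \<le> w" using w vec_norm1_nonneg order_trans by blast
      moreover have "0 \<le> \<eta>" using eta vec_norm_nonneg order_trans unfolding residual_norm_eq by blast
      ultimately show "vec_norm J (\<lambda>j. c j - r A y j) \<le> 25 * (w / sqrt n + \<eta>)"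
        by (smt (verit) divide_nonneg_nonneg real_sqrt_ge_zero of_nat_0_le_iff)
    qed
  next
    fix enum :: "'i \<Rightarrow> nat" and ls :: "(nat \<Rightarrow> 'i \<Rightarrow> complex) \<Rightarrow> (nat \<Rightarrow> complex) \<Rightarrow> 'i set \<Rightarrow> 'i \<Rightarrow> complex"
    assume ls: "least_squares_rule J m ls"
    show "with_prob_ge (iid_points M I b m) (1 - \<gamma>)
         (\<lambda>X. \<forall>f\<in>wiener_space M I b. recovery_bound 150 M I b n J (omp_decoder enum ls (24 * n) M I b J m X) f)"
      unfolding omp_decoder_def[abs_def]
      by (rule decoder_recovery[OF n J g m]) (rule omp_error[OF J(1) J0 _ _ n _ ls])
  }
qed simp_all

end
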